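(* Let $G$ be a co-chordal graph. Then the independence complex $\Delta_G$ is initially Cohen--Macaulay (over a field $\mathbb{K}$) if and only if it is weakly connected.
   Context: Graphs are finite and simple. A graph is chordal if it contains no induced cycle $C_k$ with $k\ge4$; a graph is co-chordal if its complement is chordal. The independence complex $\Delta_G$ is the simplicial complex on the vertex set $\{x_1,\dots,x_n\}$ of $G$ consisting of all independent sets of $G$. For a simplicial complex $\Delta$ on $\{x_1,\dots,x_n\}$ and $R=\mathbb{K}[x_1,\dots,x_n]$, the Stanley--Reisner ring is $\mathbb{K}[\Delta]=R/I_\Delta$, where $I_\Delta$ is generated by the squarefree monomials of the minimal non-faces. The initial dimension of a module $N$ is $\mathrm{indim}\,N=\inf\{\dim R/P\mid P\in\mathrm{Ass}_R N\}$, and $\mathrm{indim}\,\Delta=\mathrm{indim}\,\mathbb{K}[\Delta]-1$, i.e. the minimum dimension of a facet of $\Delta$ (where $\dim F=|F|-1$). $\Delta$ is initially Cohen--Macaulay over $\mathbb{K}$ if $\mathrm{depth}\,\mathbb{K}[\Delta]=\mathrm{indim}\,\mathbb{K}[\Delta]$, depth being with respect to $(x_1,\dots,x_n)$. The $i$-skeleton $\Delta^i$ consists of all faces of dimension at most $i$. A simplicial complex $\Gamma$ is strongly connected if for any two facets $F,F'$ there is a sequence of facets $F=F_0,F_1,\dots,F_t=F'$ with $|F_i\cap F_{i+1}|=\dim\Gamma$ for all $i=0,\dots,t-1$. $\Delta$ is weakly connected if $\Delta^{\mathrm{indim}\,\Delta}$ is strongly connected. *)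

theory Defs
  imports
    "HOL-Library.Poly_Mapping"
    "HOL-Library.Extended_Nat"
    "HOL-Algebra.QuotRing"
    "HOL-Algebra.Module"
    "Graph_Theory.Pair_Digraph"
begin

text \<open>Finite simple graphs are the \<open>pair_graph\<close>s of the library: finite, loopless, with a
  symmetric arc relation.\<close>

section \<open>Chordal graphs and simplicial complexes\<close>

text \<open>The function \<open>c\<close> embeds the cycle on the vertices \<open>0, ..., k - 1\<close> onto an induced subgraph.\<close>

definition has_induced_cycle :: "'v pair_pre_digraph \<Rightarrow> nat \<Rightarrow> bool" where
  "has_induced_cycle G k \<longleftrightarrow>
     (\<exists>c. inj_on c {..<k} \<and> c ` {..<k} \<subseteq> pverts G \<and>
        (\<forall>i<k. \<forall>j<k. (c i, c j) \<in> parcs G \<longleftrightarrow> j = Suc i mod k \<or> i = Suc j mod k))"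

definition chordal :: "'v pair_pre_digraph \<Rightarrow> bool" where
  "chordal G \<longleftrightarrow> (\<forall>k\<ge>4. \<not> has_induced_cycle G k)"

definition complement_graph :: "'v pair_pre_digraph \<Rightarrow> 'v pair_pre_digraph" where
  "complement_graph G =
     \<lparr>pverts = pverts G,
      parcs = {(u, v). u \<in> pverts G \<and> v \<in> pverts G \<and> u \<noteq> v \<and> (u, v) \<notin> parcs G}\<rparr>"

definition co_chordal :: "'v pair_pre_digraph \<Rightarrow> bool" where
  "co_chordal G \<longleftrightarrow> chordal (complement_graph G)"

text \<open>A simplicial complex is represented by its set of faces, including the empty face.\<close>

definition independence_complex :: "'v pair_pre_digraph \<Rightarrow> 'v set set" where
  "independence_complex G = {W. W \<subseteq> pverts G \<and> (\<forall>u\<in>W. \<forall>v\<in>W. (u, v) \<notin> parcs G)}"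

definition facets :: "'v set set \<Rightarrow> 'v set set" where
  "facets \<Delta> = {F \<in> \<Delta>. \<forall>F'\<in>\<Delta>. F \<subseteq> F' \<longrightarrow> F' = F}"

definition face_dim :: "'v set \<Rightarrow> int" where
  "face_dim F = int (card F) - 1"

definition complex_dim :: "'v set set \<Rightarrow> int" where
  "complex_dim \<Delta> = Max (face_dim ` \<Delta>)"

definition complex_indim :: "'v set set \<Rightarrow> int" where
  "complex_indim \<Delta> = Min (face_dim ` facets \<Delta>)"

definition skeleton :: "int \<Rightarrow> 'v set set \<Rightarrow> 'v set set" where
  "skeleton i \<Delta> = {F \<in> \<Delta>. face_dim F \<le> i}"

definition strongly_connected_complex :: "'v set set \<Rightarrow> bool" where
  "strongly_connected_complex \<Gamma> \<longleftrightarrow>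
     (\<forall>F\<in>facets \<Gamma>. \<forall>F'\<in>facets \<Gamma>. \<exists>t p.
        p (0::nat) = F \<and> p t = F' \<and> (\<forall>i\<le>t. p i \<in> facets \<Gamma>) \<and>
        (\<forall>i<t. int (card (p i \<inter> p (Suc i))) = complex_dim \<Gamma>))"

definition weakly_connected :: "'v set set \<Rightarrow> bool" where
  "weakly_connected \<Delta> \<longleftrightarrow> strongly_connected_complex (skeleton (complex_indim \<Delta>) \<Delta>)"


section \<open>Krull dimension, associated primes, initial dimension and depth\<close>

text \<open>The supremum is the usual dimension for nonzero rings; the zero ring gets the value 0.\<close>

definition krull_dim :: "('a, 'r) ring_scheme \<Rightarrow> enat" where
  "krull_dim R =
     Sup {enat n | n. \<exists>P. (\<forall>i\<le>n. primeideal (P i) R) \<and> (\<forall>i<n. P i \<subset> P (Suc i))}"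

definition annihilator ::
    "('a, 'r) ring_scheme \<Rightarrow> ('a, 'b, 'm) module_scheme \<Rightarrow> 'b \<Rightarrow> 'a set" where
  "annihilator R N x = {r \<in> carrier R. r \<odot>\<^bsub>N\<^esub> x = \<zero>\<^bsub>N\<^esub>}"

definition associated_primes ::
    "('a, 'r) ring_scheme \<Rightarrow> ('a, 'b, 'm) module_scheme \<Rightarrow> 'a set set" where
  "associated_primes R N = {P. primeideal P R \<and> (\<exists>x\<in>carrier N. P = annihilator R N x)}"

definition module_indim :: "('a, 'r) ring_scheme \<Rightarrow> ('a, 'b, 'm) module_scheme \<Rightarrow> enat" where
  "module_indim R N = Inf ((\<lambda>P. krull_dim (R Quot P)) ` associated_primes R N)"

text \<open>The submodule \<open>(a\<^sub>1, ..., a\<^sub>r) N = a\<^sub>1 N + ... + a\<^sub>r N\<close>.\<close>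

primrec sequence_submodule :: "('a, 'b, 'm) module_scheme \<Rightarrow> 'a list \<Rightarrow> 'b set" where
  "sequence_submodule N [] = {\<zero>\<^bsub>N\<^esub>}"
| "sequence_submodule N (a # as) =
     {a \<odot>\<^bsub>N\<^esub> x \<oplus>\<^bsub>N\<^esub> y | x y. x \<in> carrier N \<and> y \<in> sequence_submodule N as}"

text \<open>The first condition says that each \<open>a\<^sub>i\<^sub>+\<^sub>1\<close> is a nonzerodivisor on
  \<open>N / (a\<^sub>1, ..., a\<^sub>i) N\<close>, written out in \<open>N\<close>.\<close>

definition regular_sequence :: "('a, 'b, 'm) module_scheme \<Rightarrow> 'a list \<Rightarrow> bool" where
  "regular_sequence N as \<longleftrightarrow>
     (\<forall>i<length as. \<forall>x\<in>carrier N.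
        (as ! i) \<odot>\<^bsub>N\<^esub> x \<in> sequence_submodule N (take i as) \<longrightarrow>
          x \<in> sequence_submodule N (take i as)) \<and>
     sequence_submodule N as \<noteq> carrier N"

text \<open>The depth of \<open>N\<close> with respect to an ideal \<open>I\<close> of the ground ring.\<close>

definition module_depth :: "'a set \<Rightarrow> ('a, 'b, 'm) module_scheme \<Rightarrow> enat" where
  "module_depth I N = Sup {enat (length as) | as. set as \<subseteq> I \<and> regular_sequence N as}"

definition quotient_module ::
    "('a, 'r) ring_scheme \<Rightarrow> 'a set \<Rightarrow> ('a, 'a set) module" where
  "quotient_module R I =
     ring.extend (R Quot I) \<lparr>smult = \<lambda>r X. (I +>\<^bsub>R\<^esub> r) \<otimes>\<^bsub>R Quot I\<^esub> X\<rparr>"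


section \<open>Stanley--Reisner rings\<close>

text \<open>Polynomials over the field \<open>'k\<close> with variables indexed by \<open>'v\<close> are finitely supported
  functions from exponent vectors to coefficients, with the convolution product. The ring
  \<open>K[x\<^sub>v | v \<in> V]\<close> consists of those in which only variables from \<open>V\<close> occur.\<close>

type_synonym ('v, 'k) mpoly = "('v \<Rightarrow>\<^sub>0 nat) \<Rightarrow>\<^sub>0 'k"

definition polynomial_ring :: "'v set \<Rightarrow> ('v, 'k::field) mpoly ring" where
  "polynomial_ring V =
     \<lparr>carrier = {p. \<forall>m\<in>Poly_Mapping.keys p. Poly_Mapping.keys m \<subseteq> V},
      monoid.mult = (*), one = 1, zero = 0, add = (+)\<rparr>"

definition var :: "'v \<Rightarrow> ('v, 'k::field) mpoly" where
  "var v = Poly_Mapping.single (Poly_Mapping.single v 1) 1"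

definition minimal_nonfaces :: "'v set \<Rightarrow> 'v set set \<Rightarrow> 'v set set" where
  "minimal_nonfaces V \<Delta> = {F. F \<subseteq> V \<and> F \<notin> \<Delta> \<and> (\<forall>F'. F' \<subset> F \<longrightarrow> F' \<in> \<Delta>)}"

definition stanley_reisner_ideal :: "'v set \<Rightarrow> 'v set set \<Rightarrow> ('v, 'k::field) mpoly set" where
  "stanley_reisner_ideal V \<Delta> =
     genideal (polynomial_ring V) ((\<lambda>F. \<Prod>v\<in>F. var v) ` minimal_nonfaces V \<Delta>)"

text \<open>The ring \<open>K[\<Delta>]\<close> as a module over the polynomial ring.\<close>

definition stanley_reisner_ring ::
    "'v set \<Rightarrow> 'v set set \<Rightarrow> (('v, 'k::field) mpoly, ('v, 'k) mpoly set) module" where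
  "stanley_reisner_ring V \<Delta> =
     quotient_module (polynomial_ring V) (stanley_reisner_ideal V \<Delta>)"

definition irrelevant_ideal :: "'v set \<Rightarrow> ('v, 'k::field) mpoly set" where
  "irrelevant_ideal V = genideal (polynomial_ring V) (var ` V)"

definition initially_cohen_macaulay ::
    "'k::field itself \<Rightarrow> 'v set \<Rightarrow> 'v set set \<Rightarrow> bool" where
  "initially_cohen_macaulay K V \<Delta> \<longleftrightarrow>
     module_depth (irrelevant_ideal V)
       (stanley_reisner_ring V \<Delta> :: (('v, 'k) mpoly, ('v, 'k) mpoly set) module) =
     module_indim (polynomial_ring V :: ('v, 'k) mpoly ring) (stanley_reisner_ring V \<Delta>)"

end

theory Submission
  imports Defs
begin

text \<open>The complex \<open>\<Delta>\<^sub>G\<close> is the clique complex of the chordal graph \<open>H\<close> complementary to \<open>G\<close>. Let \<open>d\<close> be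
  the smallest cardinality of a facet. The associated primes of \<open>K[\<Delta>\<^sub>G]\<close> are the monomial primes
  of the facets, so its initial dimension is \<open>d\<close>. On the other side, call \<open>H\<close> \<open>k\<close>-connected if it has
  at least \<open>k\<close> vertices and every separator has at least \<open>k - 1\<close> vertices. Weak connectedness of \<open>\<Delta>\<^sub>G\<close>
  and depth at least \<open>d\<close> are both equivalent to this property for \<open>k = d\<close>.

  By Dirac's theorem a chordal graph is either complete or glued from two smaller chordal graphs along
  a clique \<open>S\<close>. If \<open>H\<close> is \<open>k\<close>-connected, then the first \<open>k\<close> elementary symmetric polynomials form a
  regular sequence on \<open>K[\<Delta>\<^sub>G]\<close>: they do so on each face with at least \<open>k\<close> vertices, the first
  \<open>k - 1\<close> of them do so on \<open>S\<close>, and the depth lemma glues these statements. This choice works over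
  finite fields, where regular sequences of linear forms may not exist. Conversely, a separator \<open>S\<close> yields
  a nonzero Koszul cohomology class in degree \<open>card S + 1\<close>, so no regular sequence is longer than that.\<close>

section \<open>Regular sequences modulo ideals\<close>

text \<open>Depth and dimension are given by regular sequences and chains of primes, so the bounds
  need explicit sequences, Koszul classes and chains. The gluing step compares one sequence on both
  parts and on the separator, so it must not depend on the face: the symmetric polynomials use all
  variables of \<open>V\<close>. Modulo the prime of a face \<open>F\<close> the variables outside
  \<open>F\<close> vanish, which leaves the symmetric polynomials of \<open>F\<close>; the last of
  these is a product of variables, and this makes an induction on \<open>F\<close> possible. The
  number k - 1 for the separator is what the depth lemma demands of the third term of the exact
  sequence. On the combinatorial side, a facet other than the whole vertex set has more vertices
  than some separator (\<open>facet_separation\<close>), so the depth never exceeds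
  \<open>min_facet_card\<close> and equality is decided by separators alone. Polynomials in the
  variables of \<open>V\<close> form only a subset of their type. Ideals are therefore sets relative
  to a carrier \<open>C\<close>, and quotients are replaced by membership until the last section
  translates to cosets.\<close>

locale subring_carrier =
  fixes C :: "'a::comm_ring_1 set"
  assumes zero_C: "0 \<in> C" and one_C: "1 \<in> C"
    and add_C: "\<And>x y. x \<in> C \<Longrightarrow> y \<in> C \<Longrightarrow> x + y \<in> C"
    and uminus_C: "\<And>x. x \<in> C \<Longrightarrow> - x \<in> C"
    and mult_C: "\<And>x y. x \<in> C \<Longrightarrow> y \<in> C \<Longrightarrow> x * y \<in> C"
begin

lemma diff_C: "x \<in> C \<Longrightarrow> y \<in> C \<Longrightarrow> x - y \<in> C"
  using add_C[of x "- y"] uminus_C by simp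

lemma sum_C: "(\<And>i. i \<in> A \<Longrightarrow> f i \<in> C) \<Longrightarrow> sum f A \<in> C"
  by (induction A rule: infinite_finite_induct) (auto simp: zero_C add_C)

lemma prod_C: "(\<And>i. i \<in> A \<Longrightarrow> f i \<in> C) \<Longrightarrow> prod f A \<in> C"
  by (induction A rule: infinite_finite_induct) (auto simp: one_C mult_C)

definition ideal_in :: "'a set \<Rightarrow> bool" where
  "ideal_in J \<longleftrightarrow> J \<subseteq> C \<and> 0 \<in> J \<and> (\<forall>x\<in>J. \<forall>y\<in>J. x + y \<in> J) \<and> (\<forall>r\<in>C. \<forall>x\<in>J. r * x \<in> J)"

lemma ideal_inI:
  assumes "J \<subseteq> C" "0 \<in> J" "\<And>x y. x \<in> J \<Longrightarrow> y \<in> J \<Longrightarrow> x + y \<in> J"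
    "\<And>r x. r \<in> C \<Longrightarrow> x \<in> J \<Longrightarrow> r * x \<in> J"
  shows "ideal_in J"
  using assms by (auto simp: ideal_in_def)

lemma ideal_subset: "ideal_in J \<Longrightarrow> x \<in> J \<Longrightarrow> x \<in> C"
  and ideal_zero: "ideal_in J \<Longrightarrow> 0 \<in> J"
  and ideal_add: "ideal_in J \<Longrightarrow> x \<in> J \<Longrightarrow> y \<in> J \<Longrightarrow> x + y \<in> J"
  and ideal_mult: "ideal_in J \<Longrightarrow> r \<in> C \<Longrightarrow> x \<in> J \<Longrightarrow> r * x \<in> J"
  by (auto simp: ideal_in_def)

lemma ideal_mult_right: "ideal_in J \<Longrightarrow> r \<in> C \<Longrightarrow> x \<in> J \<Longrightarrow> x * r \<in> J"
  using ideal_mult[of J r x] by (simp add: mult.commute)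

lemma ideal_uminus: "ideal_in J \<Longrightarrow> x \<in> J \<Longrightarrow> - x \<in> J"
  using ideal_mult[of J "- 1" x] uminus_C[OF one_C] by simp

lemma ideal_diff: "ideal_in J \<Longrightarrow> x \<in> J \<Longrightarrow> y \<in> J \<Longrightarrow> x - y \<in> J"
  using ideal_add[of J x "- y"] ideal_uminus by simp

lemma ideal_add_cancel: "ideal_in J \<Longrightarrow> x \<in> J \<Longrightarrow> x + y \<in> J \<longleftrightarrow> y \<in> J"
  using ideal_add ideal_diff by (metis add_diff_cancel_left')

lemma ideal_sum: "ideal_in J \<Longrightarrow> (\<And>i. i \<in> A \<Longrightarrow> f i \<in> J) \<Longrightarrow> sum f A \<in> J"
  by (induction A rule: infinite_finite_induct) (auto simp: ideal_zero ideal_add)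

definition ideal_plus :: "'a set \<Rightarrow> 'a set \<Rightarrow> 'a set" where
  "ideal_plus A B = {x + y | x y. x \<in> A \<and> y \<in> B}"

definition adjoin :: "'a set \<Rightarrow> 'a \<Rightarrow> 'a set" where
  "adjoin J a = {x + a * r | x r. x \<in> J \<and> r \<in> C}"

lemma adjoinI: "x \<in> J \<Longrightarrow> r \<in> C \<Longrightarrow> x + a * r \<in> adjoin J a"
  by (auto simp: adjoin_def)

lemma adjoinE:
  assumes "y \<in> adjoin J a"
  obtains x r where "y = x + a * r" "x \<in> J" "r \<in> C"
  using assms by (auto simp: adjoin_def)

lemma ideal_adjoin:
  assumes "ideal_in J" "a \<in> C"
  shows "ideal_in (adjoin J a)"
proof (rule ideal_inI)
  show "adjoin J a \<subseteq> C"
    using assms ideal_subset add_C mult_C by (fastforce simp: adjoin_def)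
  show "0 \<in> adjoin J a"
    using adjoinI[of 0 J 0 a] assms ideal_zero zero_C by simp
next
  fix x y assume "x \<in> adjoin J a" "y \<in> adjoin J a"
  then obtain u v u' v' where h: "x = u + a * v" "y = u' + a * v'" "u \<in> J" "u' \<in> J" "v \<in> C" "v' \<in> C"
    by (auto simp: adjoin_def)
  have "x + y = (u + u') + a * (v + v')" by (simp add: h algebra_simps)
  then show "x + y \<in> adjoin J a"
    using h assms adjoinI ideal_add add_C by metis
next
  fix r x assume r: "r \<in> C" and "x \<in> adjoin J a"
  then obtain u v where h: "x = u + a * v" "u \<in> J" "v \<in> C"
    by (auto simp: adjoin_def)
  have "r * x = r * u + a * (r * v)" by (simp add: h algebra_simps)
  then show "r * x \<in> adjoin J a"
    using h assms adjoinI ideal_mult mult_C r by metis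
qed

lemma subset_adjoin: "J \<subseteq> adjoin J a"
  using adjoinI[of _ J 0 a] zero_C by auto

lemma adjoin_commute: "adjoin (adjoin J a) b = adjoin (adjoin J b) a"
proof -
  have "adjoin (adjoin J a) b \<subseteq> adjoin (adjoin J b) a" for a b
  proof
    fix x assume "x \<in> adjoin (adjoin J a) b"
    then obtain u v w where "x = (u + a * v) + b * w" "u \<in> J" "v \<in> C" "w \<in> C"
      by (auto simp: adjoin_def)
    then show "x \<in> adjoin (adjoin J b) a"
      using adjoinI[OF adjoinI[of u J w b], of v a] by (simp add: algebra_simps)
  qed
  then show ?thesis by blast
qed

lemma ideal_foldl_adjoin:
  "ideal_in J \<Longrightarrow> set as \<subseteq> C \<Longrightarrow> ideal_in (foldl adjoin J as)"
  by (induction as arbitrary: J) (auto simp: ideal_adjoin)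

text \<open>Reconciles two recursions: \<open>foldl\<close> adjoins the head first, while
  \<open>sequence_submodule\<close> adds the multiples of the head last.\<close>

lemma foldl_adjoin_commute: "foldl adjoin (adjoin J a) as = adjoin (foldl adjoin J as) a"
  by (induction as arbitrary: J) (auto simp: adjoin_commute)

lemma subset_foldl_adjoin: "J \<subseteq> foldl adjoin J as"
proof (induction as arbitrary: J)
  case (Cons a as)
  then show ?case using subset_adjoin[of J a] by fastforce
qed simp

definition nonzerodivisor_mod :: "'a set \<Rightarrow> 'a \<Rightarrow> bool" where
  "nonzerodivisor_mod J a \<longleftrightarrow> (\<forall>x\<in>C. a * x \<in> J \<longrightarrow> x \<in> J)"

lemma nonzerodivisor_modD: "nonzerodivisor_mod J a \<Longrightarrow> x \<in> C \<Longrightarrow> a * x \<in> J \<Longrightarrow> x \<in> J"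
  by (auto simp: nonzerodivisor_mod_def)

text \<open>Records the nonzerodivisors only, so that sequences can be glued and cut without
  tracking properness, which enters separately in \<open>regular_sequence_iff\<close>.\<close>

primrec regular_mod :: "'a set \<Rightarrow> 'a list \<Rightarrow> bool" where
  "regular_mod J [] = True"
| "regular_mod J (a # as) = (nonzerodivisor_mod J a \<and> regular_mod (adjoin J a) as)"

lemma regular_mod_append:
  "regular_mod J (as @ bs) \<longleftrightarrow> regular_mod J as \<and> regular_mod (foldl adjoin J as) bs"
  by (induction as arbitrary: J) auto

lemma regular_mod_iff_nth:
  "regular_mod J as \<longleftrightarrow>
     (\<forall>i<length as. nonzerodivisor_mod (foldl adjoin J (take i as)) (as ! i))"
proof (induction as arbitrary: J)
  case (Cons a as)
  show ?case
    by (auto simp: Cons.IH All_less_Suc2)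
qed simp

text \<open>Two representations \<open>x + a * u = y + a * w\<close> of one element put
  \<open>a * (u - w)\<close> into the sum of the ideals. Cancelling \<open>a\<close> there lets
  \<open>u\<close> and \<open>w\<close> be corrected to a common coefficient. In homological terms,
  the exact sequence of the depth lemma stays exact modulo \<open>a\<close>.\<close>

lemma adjoin_inter:
  assumes A: "ideal_in A" and B: "ideal_in B" and a: "a \<in> C"
    and nz: "nonzerodivisor_mod (ideal_plus A B) a"
  shows "adjoin (A \<inter> B) a = adjoin A a \<inter> adjoin B a"
proof (intro equalityI subsetI)
  fix p assume "p \<in> adjoin A a \<inter> adjoin B a"
  then obtain x u y w where p: "p = x + a * u" "x \<in> A" "u \<in> C" "p = y + a * w" "y \<in> B" "w \<in> C"
    by (metis IntD1 IntD2 adjoinE)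
  have "a * (u - w) = y - x"
    using p by (simp add: algebra_simps)
  also have "\<dots> = - x + y" by simp
  also have "\<dots> \<in> ideal_plus A B"
    unfolding ideal_plus_def using p ideal_uminus[OF A] by blast
  finally have "u - w \<in> ideal_plus A B"
    using nz p diff_C nonzerodivisor_modD by blast
  then obtain x' y' where xy: "u - w = x' + y'" "x' \<in> A" "y' \<in> B"
    by (auto simp: ideal_plus_def)
  \<comment> \<open>Shifting \<open>u\<close> by the \<open>A\<close>-part of the difference and
    \<open>w\<close> by its \<open>B\<close>-part gives the same element, so
    \<open>p - a * t\<close> lies in both ideals.\<close>
  define t where "t = u - x'"
  have t: "t = w + y'" "t \<in> C"
    using xy p ideal_subset[OF A] diff_C unfolding t_def by (simp add: algebra_simps, blast)
  have "p - a * t = x + a * x'"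
    by (simp add: p(1) t_def algebra_simps)
  moreover have "p - a * t = y - a * y'"
    by (simp add: p(4) t(1) algebra_simps)
  moreover have "x + a * x' \<in> A" "y - a * y' \<in> B"
    using p xy a A B ideal_add ideal_mult ideal_diff by auto
  ultimately have "p - a * t \<in> A \<inter> B" by auto
  from adjoinI[OF this t(2), of a] show "p \<in> adjoin (A \<inter> B) a"
    by simp
qed (auto simp: adjoin_def)

lemma adjoin_ideal_plus:
  "ideal_plus (adjoin A a) (adjoin B a) = adjoin (ideal_plus A B) a" if "a \<in> C"
proof (intro equalityI subsetI)
  fix p assume "p \<in> ideal_plus (adjoin A a) (adjoin B a)"
  then obtain x u y w where p: "p = (x + a * u) + (y + a * w)" "x \<in> A" "u \<in> C" "y \<in> B" "w \<in> C"
    by (auto simp: adjoin_def ideal_plus_def)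
  have "p = (x + y) + a * (u + w)"
    by (simp add: p algebra_simps)
  moreover have "x + y \<in> ideal_plus A B"
    using p by (auto simp: ideal_plus_def)
  ultimately show "p \<in> adjoin (ideal_plus A B) a"
    using p add_C adjoinI by metis
next
  fix p assume "p \<in> adjoin (ideal_plus A B) a"
  then obtain x y u where p: "p = (x + y) + a * u" "x \<in> A" "u \<in> C" "y \<in> B"
    by (auto simp: adjoin_def ideal_plus_def)
  then have "p = (x + a * u) + (y + a * 0)"
    by (simp add: algebra_simps)
  then show "p \<in> ideal_plus (adjoin A a) (adjoin B a)"
    unfolding ideal_plus_def using p adjoinI zero_C by blast
qed

text \<open>This is the depth lemma for the exact sequence
  \<open>0 \<rightarrow> R/(A \<inter> B) \<rightarrow> R/A \<oplus> R/B \<rightarrow> R/(A + B) \<rightarrow> 0\<close>.\<close>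

lemma regular_mod_inter:
  assumes "ideal_in A" "ideal_in B" "set as \<subseteq> C"
    and "regular_mod A as" "regular_mod B as" "regular_mod (ideal_plus A B) (butlast as)"
  shows "regular_mod (A \<inter> B) as"
  using assms
proof (induction as arbitrary: A B)
  case (Cons a as)
  have nz: "nonzerodivisor_mod (A \<inter> B) a"
    using Cons.prems by (auto simp: nonzerodivisor_mod_def)
  show ?case
  \<comment> \<open>\<open>butlast\<close> keeps \<open>a\<close> only if something follows it, and
    only then does \<open>adjoin (A \<inter> B) a\<close> have to be compared with the two separate
    enlargements.\<close>
  proof (cases "as = []")
    case False
    then have h: "nonzerodivisor_mod (ideal_plus A B) a"
        "regular_mod (adjoin (ideal_plus A B) a) (butlast as)"
      using Cons.prems by auto
    have "regular_mod (adjoin A a \<inter> adjoin B a) as"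
      using Cons.prems h by (intro Cons.IH) (auto simp: ideal_adjoin adjoin_ideal_plus)
    then show ?thesis
      using nz adjoin_inter[of A B a] Cons.prems h by simp
  qed (use nz in simp)
qed simp

text \<open>The hypothesis \<open>sep\<close> is Krull's intersection property, which makes regular sequences
  permutable.\<close>

lemma nonzerodivisor_swap:
  assumes J: "ideal_in J" and a: "a \<in> C" and b: "b \<in> C"
    and na: "nonzerodivisor_mod J a" and nb: "nonzerodivisor_mod (adjoin J a) b"
    and sep: "\<And>g. g \<in> C \<Longrightarrow> (\<And>r. g \<in> adjoin J (a ^ r)) \<Longrightarrow> g \<in> J"
  shows "nonzerodivisor_mod J b" and "nonzerodivisor_mod (adjoin J b) a"
proof -
  \<comment> \<open>An element \<open>g\<close> killed by \<open>b\<close> modulo \<open>J\<close>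
    is, up to \<open>J\<close>, \<open>a\<close> times another such element. Iterating gives
    arbitrarily high powers of \<open>a\<close>, which \<open>sep\<close> turns into membership in
    \<open>J\<close>.\<close>
  have step: "\<exists>q g'. q \<in> J \<and> g' \<in> C \<and> g = q + a * g' \<and> b * g' \<in> J"
    if g: "g \<in> C" "b * g \<in> J" for g
  proof -
    have "g \<in> adjoin J a"
      using nb g subset_adjoin[of J a] nonzerodivisor_modD by blast
    then obtain q g' where h: "g = q + a * g'" "q \<in> J" "g' \<in> C"
      by (rule adjoinE)
    have "a * (b * g') = b * g - b * q"
      by (simp add: h algebra_simps)
    also have "\<dots> \<in> J"
      using J g h b ideal_diff ideal_mult by blast
    finally have "b * g' \<in> J"
      using na b h mult_C nonzerodivisor_modD by blast
    then show ?thesis using h by blast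
  qed
  have "g \<in> adjoin J (a ^ r)" if "g \<in> C" "b * g \<in> J" for g r
    using that
  proof (induction r arbitrary: g)
    case 0
    show ?case
      using adjoinI[of 0 J g 1] J 0 ideal_zero by simp
  next
    case (Suc r)
    obtain q g' where h: "q \<in> J" "g' \<in> C" "g = q + a * g'" "b * g' \<in> J"
      using step[OF Suc.prems] by blast
    obtain x s where xs: "g' = x + a ^ r * s" "x \<in> J" "s \<in> C"
      using Suc.IH[OF h(2,4)] by (rule adjoinE)
    have "g = (q + a * x) + a ^ Suc r * s"
      by (simp add: h xs algebra_simps)
    then show ?case
      using adjoinI h xs a J ideal_add ideal_mult by metis
  qed
  then show nbJ: "nonzerodivisor_mod J b"
    using sep by (auto simp: nonzerodivisor_mod_def)
  show "nonzerodivisor_mod (adjoin J b) a"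
    unfolding nonzerodivisor_mod_def
  proof (intro ballI impI)
    fix g assume g: "g \<in> C" "a * g \<in> adjoin J b"
    then obtain q g' where h: "a * g = q + b * g'" "q \<in> J" "g' \<in> C"
      by (auto elim: adjoinE)
    have "b * g' = - q + a * g"
      by (simp add: h)
    also have "\<dots> \<in> adjoin J a"
      using adjoinI ideal_uminus[OF J] h g by blast
    finally have "g' \<in> adjoin J a"
      using nb h nonzerodivisor_modD by blast
    then obtain q' g'' where h': "g' = q' + a * g''" "q' \<in> J" "g'' \<in> C"
      by (rule adjoinE)
    have "a * (g - b * g'') = q + b * q'"
      using h by (simp add: h' algebra_simps)
    also have "\<dots> \<in> J"
      using J h h' b ideal_add ideal_mult by blast
    finally have "g - b * g'' \<in> J"
      using na g h' b mult_C diff_C nonzerodivisor_modD by blast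
    from adjoinI[OF this h'(3), of b] show "g \<in> adjoin J b"
      by simp
  qed
qed


section \<open>Koszul cohomology\<close>

text \<open>A Koszul cochain assigns a coefficient to every set of variables, encoded by its indicator
  list. Recursion on the variables takes care of the signs.\<close>

fun koszul :: "'a list \<Rightarrow> (bool list \<Rightarrow> 'a) \<Rightarrow> bool list \<Rightarrow> 'a" where
  "koszul (x # xs) f (True # bs) = x * f (False # bs) - koszul xs (\<lambda>cs. f (True # cs)) bs"
| "koszul (x # xs) f (False # bs) = koszul xs (\<lambda>cs. f (False # cs)) bs"
| "koszul _ f _ = 0"

text \<open>The interior product with the functional that sends the i-th basis vector to the i-th
  entry of \<open>cs\<close>. The minus sign comes from passing the first basis vector, as in
  \<open>koszul\<close>.\<close>

fun contract :: "'a list \<Rightarrow> (bool list \<Rightarrow> 'a) \<Rightarrow> bool list \<Rightarrow> 'a" where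
  "contract (c # cs) f (True # bs) = - contract cs (\<lambda>ds. f (True # ds)) bs"
| "contract (c # cs) f (False # bs) = c * f (True # bs) + contract cs (\<lambda>ds. f (False # ds)) bs"
| "contract _ f _ = 0"

lemma koszul_0 [simp]: "koszul xs (\<lambda>_. 0) bs = 0"
  by (induction xs "\<lambda>_::bool list. 0::'a" bs rule: koszul.induct) auto

lemma koszul_add: "koszul xs (\<lambda>bs. f bs + g bs) bs = koszul xs f bs + koszul xs g bs"
proof (induction xs arbitrary: f g bs)
  case (Cons x xs)
  show ?case
    by (cases "(x # xs, f, bs)" rule: koszul.cases) (auto simp: Cons.IH algebra_simps)
qed simp

lemma koszul_scale: "koszul xs (\<lambda>bs. a * f bs) bs = a * koszul xs f bs"
proof (induction xs arbitrary: f bs)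
  case (Cons x xs)
  show ?case
    by (cases "(x # xs, f, bs)" rule: koszul.cases) (auto simp: Cons.IH algebra_simps)
qed simp

lemma koszul_uminus: "koszul xs (\<lambda>bs. - f bs) bs = - koszul xs f bs"
  using koszul_scale[of xs "-1" f bs] by simp

lemma koszul_diff: "koszul xs (\<lambda>bs. f bs - g bs) bs = koszul xs f bs - koszul xs g bs"
  using koszul_add[of xs f "\<lambda>bs. - g bs" bs] by (simp add: koszul_uminus)

lemma koszul_square: "koszul xs (koszul xs f) bs = 0"
proof (induction xs arbitrary: f bs)
  case (Cons x xs)
  show ?case
    by (cases "(x # xs, f, bs)" rule: koszul.cases)
      (auto simp: Cons.IH koszul_diff koszul_scale)
qed simp

lemma koszul_mem:
  assumes "ideal_in J" "set xs \<subseteq> C" "\<And>cs. length cs = length bs \<Longrightarrow> f cs \<in> J"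
  shows "koszul xs f bs \<in> J"
  using assms(2,3)
proof (induction xs arbitrary: f bs)
  case (Cons x xs)
  show ?case
    using Cons.prems
    by (cases "(x # xs, f, bs)" rule: koszul.cases)
      (auto intro!: ideal_diff[OF assms(1)] ideal_mult[OF assms(1)] Cons.IH ideal_zero[OF assms(1)])
qed (simp add: ideal_zero[OF assms(1)])

lemma ideal_C: "ideal_in C"
  by (auto simp: ideal_in_def zero_C add_C mult_C)

lemma contract_mem:
  assumes "ideal_in J" "set xs \<subseteq> C" "\<And>cs. length cs = length bs \<Longrightarrow> f cs \<in> J"
  shows "contract xs f bs \<in> J"
  using assms(2,3)
proof (induction xs arbitrary: f bs)
  case (Cons x xs)
  show ?case
    using Cons.prems
    by (cases "(x # xs, f, bs)" rule: contract.cases)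
      (auto intro!: ideal_add[OF assms(1)] ideal_uminus[OF assms(1)] ideal_mult[OF assms(1)]
        Cons.IH ideal_zero[OF assms(1)])
qed (simp add: ideal_zero[OF assms(1)])

lemma contract_add: "contract xs (\<lambda>bs. f bs + g bs) bs = contract xs f bs + contract xs g bs"
proof (induction xs arbitrary: f g bs)
  case (Cons x xs)
  show ?case
    by (cases "(x # xs, f, bs)" rule: contract.cases) (auto simp: Cons.IH algebra_simps)
qed simp

lemma contract_scale: "contract xs (\<lambda>bs. a * f bs) bs = a * contract xs f bs"
proof (induction xs arbitrary: f bs)
  case (Cons x xs)
  show ?case
    by (cases "(x # xs, f, bs)" rule: contract.cases) (auto simp: Cons.IH algebra_simps)
qed simp

lemma contract_diff: "contract xs (\<lambda>bs. f bs - g bs) bs = contract xs f bs - contract xs g bs"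
  using contract_add[of xs f "\<lambda>bs. - 1 * g bs" bs] contract_scale[of xs "- 1" g bs] by simp

text \<open>Cartan's formula. It makes multiplication by any combination of the \<open>xs\<close>
  null-homotopic, so such an element annihilates cohomology.\<close>

lemma koszul_homotopy:
  assumes "length xs = length cs" "length bs = length cs"
  shows "koszul xs (contract cs f) bs + contract cs (koszul xs f) bs =
    (\<Sum>(c, x) \<leftarrow> zip cs xs. c * x) * f bs"
  using assms
proof (induction xs cs arbitrary: f bs rule: list_induct2)
  case (Cons x xs c cs)
  then obtain b bs' where bs: "bs = b # bs'" "length bs' = length cs"
    by (cases bs) auto
  show ?case
    using Cons.IH[of bs' "\<lambda>ds. f (b # ds)"] bs
    by (cases b) (auto simp: koszul_add koszul_diff koszul_scale koszul_uminus contract_add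
        contract_diff contract_scale algebra_simps)
qed simp

text \<open>With \<open>Suc\<close> on the left, \<open>p = 0\<close> leaves no nonzero value: the
  contraction of a 0-cochain vanishes.\<close>

lemma contract_degree:
  assumes "\<And>bs. f bs \<noteq> 0 \<Longrightarrow> count_list bs True = p" and "contract cs f bs \<noteq> 0"
  shows "Suc (count_list bs True) = p"
  using assms
proof (induction cs arbitrary: f bs p)
  case (Cons c cs)
  show ?case
  proof (cases "(c # cs, f, bs)" rule: contract.cases)
    case (1 c' cs' f' bs')
    then have *: "contract cs (\<lambda>ds. f (True # ds)) bs' \<noteq> 0" using Cons.prems by simp
    then obtain p' where p: "p = Suc p'"
      using Cons.prems(1)[of "True # _"] Cons.IH[of "\<lambda>ds. f (True # ds)" "p - 1" bs']
      by (cases p) (auto simp: fun_eq_iff)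
    show ?thesis
      using Cons.IH[OF _ *, of p'] Cons.prems(1)[of "True # _"] 1 p by fastforce
  next
    case (2 c' cs' f' bs')
    show ?thesis
    proof (cases "f (True # bs') = 0")
      case True
      then show ?thesis
        using Cons.IH[of "\<lambda>ds. f (False # ds)" p bs'] Cons.prems(1)[of "False # _"] Cons.prems(2) 2
        by fastforce
    next
      case False
      then show ?thesis
        using Cons.prems(1)[of "True # bs'"] 2 by simp
    qed
  qed (use Cons.prems in auto)
qed simp

text \<open>Cohomology vanishes below the length of a regular sequence \<open>as\<close> in the ideal generated
  by \<open>xs\<close>: contraction shows that a cocycle \<open>z\<close> satisfies \<open>a z = d y\<close>, where \<open>y\<close> is a cocycle
  modulo \<open>a\<close> of smaller degree.\<close>

lemma koszul_vanishing:
  assumes "ideal_in J" "regular_mod J as" "set xs \<subseteq> C"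
    and "\<And>a. a \<in> set as \<Longrightarrow> \<exists>cs. length cs = length xs \<and> set cs \<subseteq> C \<and>
           a = (\<Sum>(c, x) \<leftarrow> zip cs xs. c * x)"
    and "\<And>bs. z bs \<in> C" "\<And>bs. z bs \<noteq> 0 \<Longrightarrow> count_list bs True = p" "p < length as"
    and "\<And>bs. length bs = length xs \<Longrightarrow> koszul xs z bs \<in> J"
  shows "\<exists>w. (\<forall>bs. w bs \<in> C) \<and> (\<forall>bs. length bs = length xs \<longrightarrow> z bs - koszul xs w bs \<in> J)"
  using assms
proof (induction as arbitrary: J z p)
  case (Cons a as)
  note J = Cons.prems(1) and xs = Cons.prems(3) and zC = Cons.prems(5) and zd = Cons.prems(6)
  obtain cs where cs: "length cs = length xs" "set cs \<subseteq> C" "a = (\<Sum>(c, x) \<leftarrow> zip cs xs. c * x)"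
    using Cons.prems(4)[of a] by auto
  have "(\<Sum>(c, x) \<leftarrow> zip cs xs. c * x) \<in> C"
    using cs(1)[symmetric] cs(2) xs
    by (induction xs cs rule: list_induct2) (auto simp: zero_C add_C mult_C)
  then have aC: "a \<in> C" using cs by simp
  have na: "nonzerodivisor_mod J a" and reg: "regular_mod (adjoin J a) as"
    using Cons.prems by auto
  define y where "y = contract cs z"
  have yC: "y bs \<in> C" for bs
    unfolding y_def using contract_mem[OF ideal_C cs(2)] zC by blast
  have hom: "koszul xs y bs + contract cs (koszul xs z) bs = a * z bs" if "length bs = length xs" for bs
    unfolding y_def using koszul_homotopy[of xs cs bs z] that cs by simp
  have hJ: "contract cs (koszul xs z) bs \<in> J" if "length bs = length xs" for bs
    using that by (intro contract_mem[OF J cs(2)] Cons.prems(8)) simp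
  \<comment> \<open>It suffices to find a primitive after multiplication by \<open>a\<close>,
    because \<open>a\<close> can be cancelled modulo \<open>J\<close>.\<close>
  have "\<exists>v. (\<forall>bs. v bs \<in> C) \<and> (\<forall>bs. length bs = length xs \<longrightarrow> a * z bs - a * koszul xs v bs \<in> J)"
  proof (cases p)
    case 0
    have "y bs = 0" for bs
      using contract_degree[OF zd, where cs = cs] 0 unfolding y_def by blast
    then have "y = (\<lambda>_. 0)" by auto
    then have "a * z bs \<in> J" if "length bs = length xs" for bs
      using hom[OF that] hJ[OF that] by simp
    then show ?thesis
      by (intro exI[of _ "\<lambda>_. 0"]) (simp add: zero_C)
  next
    case (Suc p')
    have "\<exists>w. (\<forall>bs. w bs \<in> C) \<and>
        (\<forall>bs. length bs = length xs \<longrightarrow> y bs - koszul xs w bs \<in> adjoin J a)"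
    proof (rule Cons.IH)
      show "\<And>bs. y bs \<noteq> 0 \<Longrightarrow> count_list bs True = p'"
        using contract_degree[OF zd, where cs = cs] Suc unfolding y_def by fastforce
      show "p' < length as" using Cons.prems(7) Suc by simp
      show "koszul xs y bs \<in> adjoin J a" if "length bs = length xs" for bs
      proof -
        have "koszul xs y bs = - contract cs (koszul xs z) bs + a * z bs"
          using hom[OF that] by (simp add: algebra_simps)
        then show ?thesis
          using adjoinI ideal_uminus[OF J hJ[OF that]] zC by metis
      qed
    qed (use Cons.prems reg aC ideal_adjoin yC in auto)
    then obtain w where w: "\<And>bs. w bs \<in> C"
        "\<And>bs. length bs = length xs \<Longrightarrow> y bs - koszul xs w bs \<in> adjoin J a"
      by blast
    \<comment> \<open>The coefficient \<open>v\<close> of \<open>a\<close> in the error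
      \<open>y - d w\<close> is the desired primitive: applying \<open>d\<close> removes
      \<open>w\<close> and leaves \<open>a * d v\<close> up to \<open>J\<close>.\<close>
    then have "\<exists>j r. r \<in> C \<and> (length bs = length xs \<longrightarrow> j \<in> J \<and> y bs - koszul xs w bs = j + a * r)" for bs
      using zero_C by (cases "length bs = length xs") (blast elim: adjoinE)+
    then obtain j v where jv: "\<And>bs. v bs \<in> C"
        "\<And>bs. length bs = length xs \<Longrightarrow> j bs \<in> J"
        "\<And>bs. length bs = length xs \<Longrightarrow> y bs - koszul xs w bs = j bs + a * v bs"
      by metis
    have "a * z bs - a * koszul xs v bs \<in> J" if len: "length bs = length xs" for bs
    proof -
      \<comment> \<open>For the zero ideal, \<open>koszul_mem\<close> says that a coboundary depends
        only on the values at lists of the right length, which is all that \<open>jv\<close>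
        controls.\<close>
      have "koszul xs (\<lambda>bs. y bs - koszul xs w bs - (j bs + a * v bs)) bs = 0"
        using koszul_mem[of "{0}" xs bs "\<lambda>bs. y bs - koszul xs w bs - (j bs + a * v bs)"] jv(3) xs len
        by (auto simp: ideal_in_def zero_C)
      then have "koszul xs y bs = koszul xs j bs + a * koszul xs v bs"
        by (simp add: koszul_diff koszul_add koszul_scale koszul_square)
      then have "a * z bs - a * koszul xs v bs = contract cs (koszul xs z) bs + koszul xs j bs"
        using hom[OF len] by (simp add: algebra_simps)
      moreover have "koszul xs j bs \<in> J"
        using koszul_mem[OF J xs] jv(2) len by simp
      ultimately show ?thesis
        using hJ[OF len] ideal_add[OF J] by simp
    qed
    then show ?thesis using jv(1) by blast
  qed
  then obtain v where v: "\<And>bs. v bs \<in> C"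
      "\<And>bs. length bs = length xs \<Longrightarrow> a * z bs - a * koszul xs v bs \<in> J"
    by blast
  have "z bs - koszul xs v bs \<in> J" if "length bs = length xs" for bs
    using na v(2)[OF that] diff_C zC koszul_mem[OF ideal_C xs] v(1)
    by (auto simp: nonzerodivisor_mod_def right_diff_distrib)
  then show ?case using v(1) by blast
qed simp

text \<open>Every term of a coboundary is a product of some \<open>x\<close> with a value of
  \<open>f\<close>. This serves where the products, rather than the values, are known to lie in
  \<open>J\<close>.\<close>

lemma koszul_mem_products:
  assumes J: "ideal_in J" and "\<And>x cs. x \<in> set xs \<Longrightarrow> x * f cs \<in> J"
  shows "koszul xs f bs \<in> J"
  using assms(2)
proof (induction xs arbitrary: f bs)
  case (Cons x xs)
  show ?case
    using Cons.prems
    by (cases "(x # xs, f, bs)" rule: koszul.cases)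
      (auto intro!: ideal_diff[OF J] Cons.IH ideal_zero[OF J])
qed (simp add: ideal_zero[OF J])

lemma koszul_degree:
  assumes "\<And>bs. f bs \<noteq> 0 \<Longrightarrow> count_list bs True = p" and "koszul xs f bs \<noteq> 0"
  shows "count_list bs True = Suc p"
  using assms
proof (induction xs arbitrary: f bs p)
  case (Cons x xs)
  show ?case
  proof (cases "(x # xs, f, bs)" rule: koszul.cases)
    case (1 x' xs' f' bs')
    show ?thesis
    proof (cases "f (False # bs') = 0")
      case True
      then have *: "koszul xs (\<lambda>ds. f (True # ds)) bs' \<noteq> 0" using Cons.prems 1 by simp
      then obtain cs where "f (True # cs) \<noteq> 0" by (metis koszul_0 ext)
      then obtain p' where p: "p = Suc p'"
        using Cons.prems(1)[of "True # cs"] by auto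
      have "count_list bs' True = Suc p'"
        using Cons.IH[OF _ *, of p'] Cons.prems(1)[of "True # _"] p by fastforce
      then show ?thesis using 1 p by simp
    next
      case False
      then show ?thesis using Cons.prems(1)[of "False # bs'"] 1 by simp
    qed
  next
    case (2 x' xs' f' bs')
    then show ?thesis
      using Cons.IH[of "\<lambda>ds. f (False # ds)" p bs'] Cons.prems(1)[of "False # _"] Cons.prems(2)
      by fastforce
  qed (use Cons.prems in auto)
qed simp

lemma koszul_map_add:
  "koszul (map (\<lambda>v. f v + g v) vs) h bs = koszul (map f vs) h bs + koszul (map g vs) h bs"
proof (induction vs arbitrary: h bs)
  case (Cons v vs)
  show ?case
    by (cases "(map f (v # vs), h, bs)" rule: koszul.cases) (auto simp: Cons.IH algebra_simps)
qed simp

lemma koszul_replicate_False: "koszul xs f (replicate n False) = 0"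
proof (induction xs arbitrary: f n)
  case (Cons x xs)
  then show ?case by (cases n) auto
qed simp

text \<open>Primitives from \<open>koszul_vanishing\<close> come without a degree. At a singleton a
  coboundary sees only the value at the empty set, so a comparison there is unaffected by the other
  components.\<close>

lemma koszul_one_hot:
  "i < length xs \<Longrightarrow> koszul xs f ((replicate (length xs) False)[i := True]) =
    xs ! i * f (replicate (length xs) False)"
proof (induction xs arbitrary: f i)
  case (Cons x xs)
  then show ?case by (cases i) (auto simp: koszul_replicate_False)
qed simp

text \<open>The exterior product with the top form of \<open>n\<close> variables placed in front,
  for a cochain \<open>f\<close> in the variables that follow.\<close>

primrec wedge_prefix :: "nat \<Rightarrow> (bool list \<Rightarrow> 'a) \<Rightarrow> bool list \<Rightarrow> 'a" where
  "wedge_prefix 0 f = f"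
| "wedge_prefix (Suc n) f = (\<lambda>bs. case bs of True # bs' \<Rightarrow> wedge_prefix n f bs' | _ \<Rightarrow> 0)"

lemma wedge_prefix_C: "(\<And>bs. f bs \<in> C) \<Longrightarrow> wedge_prefix n f bs \<in> C"
  by (induction n arbitrary: bs) (auto simp: zero_C split: list.split bool.split)

lemma wedge_prefix_degree:
  assumes "\<And>bs. f bs \<noteq> 0 \<Longrightarrow> count_list bs True = p"
  shows "wedge_prefix n f bs \<noteq> 0 \<Longrightarrow> count_list bs True = n + p"
  by (induction n arbitrary: bs) (auto simp: assms split: list.splits bool.splits)

lemma koszul_wedge_prefix:
  assumes J: "ideal_in J" and "\<And>bs. length bs = length ys \<Longrightarrow> koszul ys f bs \<in> J"
    and "length bs = length (xs @ ys)"
  shows "koszul (xs @ ys) (wedge_prefix (length xs) f) bs \<in> J"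
  using assms(3)
proof (induction xs arbitrary: bs)
  case (Cons x xs)
  then obtain b bs' where "bs = b # bs'" "length bs' = length (xs @ ys)" by (cases bs) auto
  then show ?case using Cons.IH[of bs'] by (cases b) (auto simp: ideal_uminus[OF J] ideal_zero[OF J])
qed (use assms in simp)

text \<open>At lists that start with \<open>True\<close>, the coboundary of \<open>w\<close> is that
  of \<open>\<lambda>cs. - w (True # cs)\<close> up to a multiple of \<open>x\<close>. Stripping the
  prefix thus costs one generator per variable, and a primitive survives modulo the variables
  stripped.\<close>

lemma koszul_remove_prefix:
  assumes "\<And>bs. length bs = length (xs @ ys) \<Longrightarrow>
      wedge_prefix (length xs) f bs - koszul (xs @ ys) w bs \<in> J"
    and "ideal_in J" "set xs \<subseteq> C" "\<And>bs. w bs \<in> C"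
  shows "\<exists>w'. (\<forall>bs. w' bs \<in> C) \<and>
    (\<forall>bs. length bs = length ys \<longrightarrow> f bs - koszul ys w' bs \<in> foldl adjoin J xs)"
  using assms
proof (induction xs arbitrary: w J)
  case (Cons x xs)
  have "wedge_prefix (length xs) f bs - koszul (xs @ ys) (\<lambda>cs. - w (True # cs)) bs \<in> adjoin J x"
    if "length bs = length (xs @ ys)" for bs
  proof -
    have "wedge_prefix (length xs) f bs - koszul (xs @ ys) (\<lambda>cs. - w (True # cs)) bs =
        (wedge_prefix (length (x # xs)) f (True # bs) - koszul ((x # xs) @ ys) w (True # bs)) +
          x * w (False # bs)"
      by (simp add: koszul_uminus)
    also have "\<dots> \<in> adjoin J x"
      using Cons.prems(1)[of "True # bs"] Cons.prems(4) that by (intro adjoinI) auto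
    finally show ?thesis .
  qed
  then show ?case
    using Cons.IH[of "\<lambda>cs. - w (True # cs)" "adjoin J x"] Cons.prems ideal_adjoin uminus_C by simp
qed auto

end

section \<open>Clique separations of chordal graphs\<close>

locale sym_relation =
  fixes E :: "'v \<Rightarrow> 'v \<Rightarrow> bool"
  assumes sym: "E u v \<Longrightarrow> E v u" and irrefl: "\<not> E u u"
begin

definition clique :: "'v set \<Rightarrow> bool" where
  "clique K \<longleftrightarrow> (\<forall>u\<in>K. \<forall>v\<in>K. u \<noteq> v \<longrightarrow> E u v)"

text \<open>\<open>S\<close> may be empty, so a disconnected \<open>W\<close> is separated by no
  vertices; \<open>A\<close> and \<open>B\<close> may be unions of several components of
  \<open>W - S\<close>.\<close>

definition separation :: "'v set \<Rightarrow> 'v set \<Rightarrow> 'v set \<Rightarrow> 'v set \<Rightarrow> bool" where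
  "separation W S A B \<longleftrightarrow> W = S \<union> A \<union> B \<and> S \<inter> A = {} \<and> S \<inter> B = {} \<and> A \<inter> B = {} \<and>
     A \<noteq> {} \<and> B \<noteq> {} \<and> (\<forall>a\<in>A. \<forall>b\<in>B. \<not> E a b)"

definition chordal_on :: "'v set \<Rightarrow> bool" where
  "chordal_on W \<longleftrightarrow> (\<forall>k\<ge>4. \<not> (\<exists>c. inj_on c {..<k} \<and> c ` {..<k} \<subseteq> W \<and>
     (\<forall>i<k. \<forall>j<k. E (c i) (c j) \<longleftrightarrow> j = Suc i mod k \<or> i = Suc j mod k)))"

definition walk :: "'v set \<Rightarrow> 'v \<Rightarrow> 'v \<Rightarrow> nat \<Rightarrow> (nat \<Rightarrow> 'v) \<Rightarrow> bool" where
  "walk A s t l p \<longleftrightarrow> p 0 = s \<and> p l = t \<and> (\<forall>i<l. E (p i) (p (Suc i))) \<and> (\<forall>i. 0 < i \<and> i < l \<longrightarrow> p i \<in> A)"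

lemma clique_subset: "clique K \<Longrightarrow> K' \<subseteq> K \<Longrightarrow> clique K'"
  by (auto simp: clique_def)

lemma separation_commute: "separation W S A B \<Longrightarrow> separation W S B A"
  unfolding separation_def using sym by blast

lemma clique_in_part: "separation W S A B \<Longrightarrow> clique K \<Longrightarrow> K \<subseteq> W \<Longrightarrow> K \<subseteq> S \<union> A \<or> K \<subseteq> S \<union> B"
proof (rule ccontr)
  assume *: "separation W S A B" "clique K" "K \<subseteq> W" "\<not> (K \<subseteq> S \<union> A \<or> K \<subseteq> S \<union> B)"
  then obtain a b where ab: "a \<in> K" "b \<in> K" "a \<notin> S \<union> B" "b \<notin> S \<union> A"
    by blast
  moreover have "K \<subseteq> S \<union> A \<union> B" using * by (simp add: separation_def)
  ultimately have AB: "a \<in> A" "b \<in> B" by auto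
  then have "a \<noteq> b" using ab by auto
  then have "E a b" using *(2) ab by (simp add: clique_def)
  then show False using *(1) AB by (simp add: separation_def)
qed

lemma chordal_on_subset: "chordal_on W \<Longrightarrow> W' \<subseteq> W \<Longrightarrow> chordal_on W'"
  unfolding chordal_on_def by (meson order_trans)

section \<open>Shortest walks, induced cycles and Dirac's theorem\<close>

text \<open>Cuts out \<open>d\<close> steps, either a closed detour between equal vertices or the
  stretch bypassed by a chord.\<close>

lemma walk_shorten:
  assumes w: "walk A s t l p" and ij: "i < j" "j \<le> l" and d: "0 < d"
    and e: "j = i + d \<and> p i = p j \<or> j = i + Suc d \<and> E (p i) (p j)"
  shows "\<exists>p'. walk A s t (l - d) p'"
proof -
  define p' where "p' n = (if n \<le> i then p n else p (n + d))" for n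
  have pj: "p' n = p (n + d)" if "n \<ge> i" "p i = p j" "j = i + d" for n
    using that by (cases "n = i") (auto simp: p'_def)
  have "walk A s t (l - d) p'"
    unfolding walk_def
  proof (intro conjI allI impI)
    show "p' 0 = s" using w by (simp add: p'_def walk_def)
    show "p' (l - d) = t"
      using e
    proof
      assume "j = i + d \<and> p i = p j"
      then show ?thesis using pj[of "l - d"] ij w by (auto simp: walk_def)
    next
      assume "j = i + Suc d \<and> E (p i) (p j)"
      then show ?thesis using ij w by (auto simp: walk_def p'_def)
    qed
  next
    fix n assume n: "n < l - d"
    consider "n < i" | "n = i" | "n > i" by linarith
    then show "E (p' n) (p' (Suc n))"
    proof cases
      case 2
      from e show ?thesis
      proof
        assume *: "j = i + d \<and> p i = p j"
        then show ?thesis using pj[of n] pj[of "Suc n"] 2 n w by (auto simp: walk_def)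
      next
        assume "j = i + Suc d \<and> E (p i) (p j)"
        then show ?thesis using 2 by (auto simp: p'_def)
      qed
    qed (use n w in \<open>auto simp: walk_def p'_def\<close>)
  next
    fix n assume "0 < n \<and> n < l - d"
    then show "p' n \<in> A" using w by (auto simp: walk_def p'_def)
  qed
  then show ?thesis by blast
qed

text \<open>A shortest walk has neither repetitions nor chords, by \<open>walk_shorten\<close>. Its
  length is at least 2 because its ends are distinct and nonadjacent.\<close>

lemma induced_walk:
  assumes "walk A s t l0 p0" "s \<noteq> t" "\<not> E s t"
  obtains l p where "walk A s t l p" "inj_on p {..l}" "2 \<le> l"
    "\<And>i j. i \<le> l \<Longrightarrow> j \<le> l \<Longrightarrow> E (p i) (p j) \<longleftrightarrow> j = Suc i \<or> i = Suc j"
proof -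
  define l where "l = (LEAST l. \<exists>p. walk A s t l p)"
  obtain p where w: "walk A s t l p"
    using LeastI_ex[of "\<lambda>l. \<exists>p. walk A s t l p"] assms(1) unfolding l_def by blast
  have short: False if "walk A s t l' p'" "l' < l" for l' p'
    using not_less_Least[of l' "\<lambda>l. \<exists>p. walk A s t l p"] that unfolding l_def by blast
  have no: False if "i < j" "j \<le> l" "0 < d" "j = i + d \<and> p i = p j \<or> j = i + Suc d \<and> E (p i) (p j)" for i j d
    using walk_shorten[OF w that] short[of "l - d"] that by auto
  have neq: "p i \<noteq> p j" if "i < j" "j \<le> l" for i j
    using no[of i j "j - i"] that by auto
  have adj: "E (p i) (p j) \<longleftrightarrow> j = Suc i" if "i < j" "j \<le> l" for i j
  proof
    assume "E (p i) (p j)"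
    then show "j = Suc i" using no[of i j "j - Suc i"] that by (cases "j = Suc i") auto
  next
    assume "j = Suc i"
    then show "E (p i) (p j)" using w that by (simp add: walk_def)
  qed
  show thesis
  proof (rule that[OF w])
    show "inj_on p {..l}"
      using neq by (auto intro!: linorder_inj_onI)
    show "2 \<le> l"
    proof (rule ccontr)
      assume "\<not> 2 \<le> l"
      then have "l = 0 \<or> l = 1" by auto
      then show False using w assms(2,3) by (auto simp: walk_def)
    qed
    show "E (p i) (p j) \<longleftrightarrow> j = Suc i \<or> i = Suc j" if "i \<le> l" "j \<le> l" for i j
    proof (cases i j rule: linorder_cases)
      case less
      then show ?thesis using adj that by simp
    next
      case equal
      then show ?thesis using irrefl by simp
    next
      case greater
      then show ?thesis using adj[of j i] that sym[of "p i" "p j"] sym[of "p j" "p i"] by auto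
    qed
  qed
qed

text \<open>The two walks close up to a cycle of length \<open>l + m\<close>, which is at least 4.
  Chords within one walk are excluded by assumption, and chords between the interiors because no
  edge joins \<open>A\<close> and \<open>B\<close>.\<close>

lemma induced_cycle_from_walks:
  assumes p: "walk A s t l p" "inj_on p {..l}" "2 \<le> l"
      "\<And>i j. i \<le> l \<Longrightarrow> j \<le> l \<Longrightarrow> E (p i) (p j) \<longleftrightarrow> j = Suc i \<or> i = Suc j"
    and q: "walk B s t m q" "inj_on q {..m}" "2 \<le> m"
      "\<And>i j. i \<le> m \<Longrightarrow> j \<le> m \<Longrightarrow> E (q i) (q j) \<longleftrightarrow> j = Suc i \<or> i = Suc j"
    and sep: "separation W S A B" and st: "s \<in> S" "t \<in> S"
  shows "\<not> chordal_on W"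
proof -
  define k where "k = l + m"
  \<comment> \<open>Forward along \<open>p\<close> from \<open>s\<close> to \<open>t\<close>, then
    backward along \<open>q\<close>; index \<open>k\<close> would be \<open>q 0 = s\<close> again,
    so \<open>{..<k}\<close> counts every vertex once.\<close>
  define c where "c i = (if i \<le> l then p i else q (k - i))" for i
  have pA: "p i \<in> A" if "0 < i" "i < l" for i using p(1) that by (auto simp: walk_def)
  have qB: "q i \<in> B" if "0 < i" "i < m" for i using q(1) that by (auto simp: walk_def)
  have ends: "p 0 = s" "p l = t" "q 0 = s" "q m = t" using p q by (auto simp: walk_def)
  have c2: "c i = q (k - i)" if "l \<le> i" for i
    using that ends by (cases "i = l") (auto simp: c_def k_def)
  have key: "(c i \<noteq> c j) \<and> (E (c i) (c j) \<longleftrightarrow> j = Suc i mod k \<or> i = Suc j mod k)"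
    if ij: "i < j" "j < k" for i j
  proof -
    have Si: "Suc i mod k = Suc i" using ij by simp
    have Sj: "Suc j mod k = (if Suc j = k then 0 else Suc j)" using ij by auto
    consider "j \<le> l" | "l \<le> i" | "i < l" "l < j" by linarith
    then show ?thesis
    proof cases
      case 1
      then have "c i = p i" "c j = p j" using ij by (auto simp: c_def)
      moreover have "p i \<noteq> p j" using inj_onD[OF p(2), of i j] 1 ij by auto
      moreover have "Suc j \<noteq> k" using 1 q(3) by (auto simp: k_def)
      ultimately show ?thesis using p(4)[of i j] 1 ij by (auto simp: Sj Si)
    next
      case 2
      then have "c i = q (k - i)" "c j = q (k - j)" using ij c2 by auto
      moreover have "k - i \<le> m" "k - j \<le> m" "k - i \<noteq> k - j" using 2 ij by (auto simp: k_def)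
      moreover have "q (k - i) \<noteq> q (k - j)"
        using inj_onD[OF q(2), of "k - i" "k - j"] calculation by auto
      moreover have "i \<noteq> 0" using 2 p(3) by auto
      moreover have "k - j = Suc (k - i) \<or> k - i = Suc (k - j) \<longleftrightarrow> j = Suc i" using ij by auto
      ultimately show ?thesis using q(4)[of "k - i" "k - j"] ij by (auto simp: Sj Si)
    next
      case 3
      have cj: "c j = q (k - j)" "0 < k - j" "k - j < m" using 3 ij by (auto simp: c_def k_def)
      then have cB: "c j \<in> B" using qB by simp
      show ?thesis
      proof (cases "i = 0")
        case True
        have "c i = q 0" using True ends by (simp add: c_def)
        moreover have "q 0 \<noteq> q (k - j)" using inj_onD[OF q(2), of 0 "k - j"] cj by auto
        moreover have "j \<noteq> 1" using 3 by auto
        moreover have "k - j = 1 \<longleftrightarrow> Suc j = k" using ij by auto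
        ultimately show ?thesis using q(4)[of 0 "k - j"] cj True by (auto simp: Sj Si)
      next
        case False
        have "c i \<in> A" using pA 3 False by (simp add: c_def)
        then show ?thesis using cB sep 3 False ij by (auto simp: separation_def Sj Si)
      qed
    qed
  qed
  have "inj_on c {..<k}"
    using key by (metis inj_onI lessThan_iff linorder_cases)
  moreover have "c ` {..<k} \<subseteq> W"
  proof -
    have "p i \<in> W" if "i \<le> l" for i
      using that pA[of i] ends st sep by (cases "i = 0 \<or> i = l") (auto simp: separation_def)
    moreover have "q i \<in> W" if "i \<le> m" for i
      using that qB[of i] ends st sep by (cases "i = 0 \<or> i = m") (auto simp: separation_def)
    ultimately show ?thesis by (auto simp: c_def k_def)
  qed
  moreover have "E (c i) (c j) \<longleftrightarrow> j = Suc i mod k \<or> i = Suc j mod k" if "i < k" "j < k" for i j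
  proof (cases i j rule: linorder_cases)
    case less
    then show ?thesis using key that by blast
  next
    case equal
    have "Suc i mod k \<noteq> i" using that p(3) by (cases "Suc i = k") (auto simp: k_def)
    then show ?thesis using equal irrefl by auto
  next
    case greater
    then show ?thesis using key[of j i] that sym[of "c i" "c j"] sym[of "c j" "c i"] by blast
  qed
  moreover have "4 \<le> k" using p(3) q(3) by (simp add: k_def)
  ultimately show ?thesis unfolding chordal_on_def by blast
qed

inductive reach :: "'v set \<Rightarrow> 'v \<Rightarrow> 'v \<Rightarrow> bool" for A s where
  start: "E s x \<Longrightarrow> x \<in> A \<Longrightarrow> reach A s x"
| step: "reach A s x \<Longrightarrow> E x y \<Longrightarrow> y \<in> A \<Longrightarrow> reach A s y"

lemma reach_mem: "reach A s x \<Longrightarrow> x \<in> A"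
  by (induction rule: reach.induct) auto

lemma reach_walk:
  "reach A s x \<Longrightarrow> E x t \<Longrightarrow> \<exists>l p. walk A s t l p"
proof (induction arbitrary: t rule: reach.induct)
  case (start x)
  then have "walk A s t 2 (\<lambda>i. if i = 0 then s else if i = 1 then x else t)"
    by (auto simp: walk_def less_2_cases_iff)
  then show ?case by blast
next
  case (step x y)
  then obtain l p where w: "walk A s y l p" by blast
  have "walk A s t (Suc l) (p(Suc l := t))"
    using w step by (auto simp: walk_def less_Suc_eq)
  then show ?case by blast
qed

text \<open>A separator of minimum size is minimal, so both of its vertices see a common part of \<open>A\<close>.\<close>

lemma minimum_separation_walk:
  assumes sep: "separation W S A B" and fin: "finite W"
    and min: "\<And>S' A' B'. separation W S' A' B' \<Longrightarrow> card S \<le> card S'"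
    and st: "s \<in> S" "t \<in> S" "s \<noteq> t"
  shows "\<exists>l p. walk A s t l p"
proof -
  define D where "D = {x. reach A s x}"
  have DA: "D \<subseteq> A" using reach_mem by (auto simp: D_def)
  have closed: "y \<in> D" if "x \<in> D" "E x y" "y \<in> A" for x y
    using that reach.step by (auto simp: D_def)
  have fS: "finite S" using sep fin by (auto simp: separation_def)
  have smaller: False if "separation W (S - {u}) A' B'" "u \<in> S" for u A' B'
    using min[OF that(1)] that(2) card_Diff1_less[OF fS that(2)] by simp
  have "\<exists>x\<in>D. E x t"
  proof (rule ccontr)
    assume no: "\<not> (\<exists>x\<in>D. E x t)"
    show False
    proof (cases "D = {}")
      case True
      \<comment> \<open>Without a neighbour in \<open>A\<close>, the vertex \<open>s\<close> can
        move to the side of \<open>B\<close>, which leaves a smaller separator.\<close>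
      then have "\<not> E x s" if "x \<in> A" for x
        using that reach.start[of s x A] sym[of x s] by (auto simp: D_def)
      then have "separation W (S - {s}) A (B \<union> {s})"
        using sep st by (auto simp: separation_def)
      then show False using smaller st by blast
    next
      case False
      \<comment> \<open>If \<open>t\<close> has no neighbour in the part \<open>D\<close> of
        \<open>A\<close> reachable from \<open>s\<close>, it can join the side opposite to
        \<open>D\<close>.\<close>
      have "separation W (S - {t}) D ((A - D) \<union> B \<union> {t})"
        unfolding separation_def
      proof (intro conjI ballI)
        fix a b assume a: "a \<in> D" and "b \<in> (A - D) \<union> B \<union> {t}"
        then show "\<not> E a b"
          using no closed[OF a] DA sep by (auto simp: separation_def)
      qed (use False DA sep st in \<open>auto simp: separation_def\<close>)
      then show False using smaller st by blast
    qed
  qed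
  then obtain x where "reach A s x" "E x t" by (auto simp: D_def)
  then show ?thesis using reach_walk by blast
qed

text \<open>A separator of minimum size is a clique: nonadjacent \<open>s\<close> and
  \<open>t\<close> in it would be joined by induced walks through \<open>A\<close> and through
  \<open>B\<close>, and these form a chordless cycle.\<close>

lemma chordal_clique_separation:
  assumes fin: "finite W" and ch: "chordal_on W" and "\<not> clique W"
  obtains S A B where "separation W S A B" "clique S"
proof -
  obtain u v where uv: "u \<in> W" "v \<in> W" "u \<noteq> v" "\<not> E u v"
    using assms(3) by (auto simp: clique_def)
  \<comment> \<open>Two nonadjacent vertices are separated by all the others, so a separator of
    minimum size exists.\<close>
  then have "separation W (W - {u, v}) {u} {v}"
    by (auto simp: separation_def)
  then have ex: "\<exists>n S A B. separation W S A B \<and> card S = n" by blast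
  define n where "n = (LEAST n. \<exists>S A B. separation W S A B \<and> card S = n)"
  obtain S A B where sep: "separation W S A B" and n: "card S = n"
    using LeastI_ex[OF ex] unfolding n_def by blast
  have min: "card S \<le> card S'" if "separation W S' A' B'" for S' A' B'
    unfolding n unfolding n_def using that by (intro Least_le) blast
  have "clique S"
    unfolding clique_def
  proof (intro ballI impI, rule ccontr)
    fix s t assume st: "s \<in> S" "t \<in> S" "s \<noteq> t" "\<not> E s t"
    have "\<exists>l p. walk A s t l p"
      by (rule minimum_separation_walk[OF sep fin min st(1-3)])
    then obtain l p where p: "walk A s t l p" "inj_on p {..l}" "2 \<le> l"
      "\<And>i j. i \<le> l \<Longrightarrow> j \<le> l \<Longrightarrow> E (p i) (p j) \<longleftrightarrow> j = Suc i \<or> i = Suc j"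
      using st induced_walk by metis
    have "\<exists>m q. walk B s t m q"
      by (rule minimum_separation_walk[OF separation_commute[OF sep] fin min st(1-3)])
    then obtain m q where q: "walk B s t m q" "inj_on q {..m}" "2 \<le> m"
      "\<And>i j. i \<le> m \<Longrightarrow> j \<le> m \<Longrightarrow> E (q i) (q j) \<longleftrightarrow> j = Suc i \<or> i = Suc j"
      using st induced_walk by metis
    show False
      using induced_cycle_from_walks[OF p q sep st(1,2)] ch by blast
  qed
  then show thesis using sep that by blast
qed

text \<open>The trace of chordality over which all later inductions run.\<close>

inductive decomposable :: "'v set \<Rightarrow> bool" where
  clique: "clique W \<Longrightarrow> decomposable W"
| glue: "separation W S A B \<Longrightarrow> clique S \<Longrightarrow> decomposable (S \<union> A) \<Longrightarrow> decomposable (S \<union> B) \<Longrightarrow>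
    decomposable W"

lemma chordal_decomposable: "finite W \<Longrightarrow> chordal_on W \<Longrightarrow> decomposable W"
proof (induction W rule: finite_psubset_induct)
  case (psubset W)
  show ?case
  proof (cases "clique W")
    case False
    then obtain S A B where sep: "separation W S A B" "clique S"
      using chordal_clique_separation psubset by metis
    then have sub: "S \<union> A \<subset> W" "S \<union> B \<subset> W" by (auto simp: separation_def)
    show ?thesis
      by (rule decomposable.glue[OF sep])
        (use sub psubset chordal_on_subset in blast)+
  qed (rule decomposable.clique)
qed

section \<open>Connectivity of the clique complex\<close>

definition clique_complex :: "'v set \<Rightarrow> 'v set set" where
  "clique_complex W = {K. K \<subseteq> W \<and> clique K}"

definition connectivity_ge :: "nat \<Rightarrow> 'v set \<Rightarrow> bool" where
  "connectivity_ge k W \<longleftrightarrow> k \<le> card W \<and> (\<forall>S A B. separation W S A B \<longrightarrow> k \<le> Suc (card S))"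

lemma separationD:
  assumes "separation W S A B"
  shows "W = S \<union> A \<union> B" "S \<inter> A = {}" "S \<inter> B = {}" "A \<inter> B = {}" "A \<noteq> {}" "B \<noteq> {}"
    "\<And>a b. a \<in> A \<Longrightarrow> b \<in> B \<Longrightarrow> \<not> E a b"
  using assms unfolding separation_def by simp_all

text \<open>The clique \<open>S\<close> meets at most one side of a separation of
  \<open>S \<union> A\<close>. Since \<open>B\<close> has no neighbours in \<open>A\<close>, it can
  be added to that side.\<close>

lemma separation_lift:
  assumes "separation W S A B" "clique S" "separation (S \<union> A) S' A' B'"
  shows "\<exists>A'' B''. separation W S' A'' B''"
proof -
  have main: "separation W S' (A' \<union> B) B'"
    if sep': "separation (S \<union> A) S' A' B'" and S: "S \<subseteq> S' \<union> A'" for A' B'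
  proof -
    have eq: "S \<union> A = S' \<union> A' \<union> B'" and W: "W = S \<union> A \<union> B"
      using separationD(1) assms(1) sep' by blast+
    note dis = separationD(2-6)[OF assms(1)] and dis' = separationD(2-6)[OF sep']
    have "B' \<subseteq> S \<union> A" unfolding eq by blast
    moreover have "S \<inter> B' = {}" using S dis' by blast
    ultimately have B'A: "B' \<subseteq> A" by blast
    have S'B: "(S' \<union> A' \<union> B') \<inter> B = {}" unfolding eq[symmetric] using dis by blast
    have edge: "\<not> E b a" if "a \<in> A" "b \<in> B" for a b
      using separationD(7)[OF assms(1) that] sym[of b a] by blast
    show ?thesis
      unfolding separation_def
    proof (intro conjI ballI)
      show "W = S' \<union> (A' \<union> B) \<union> B'" unfolding W eq by blast
      show "\<not> E a b" if "a \<in> A' \<union> B" "b \<in> B'" for a b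
        using that edge separationD(7)[OF sep'] B'A by blast
    qed (use dis' S'B in blast)+
  qed
  have "S \<subseteq> S' \<union> A' \<or> S \<subseteq> S' \<union> B'"
    using clique_in_part[OF assms(3,2)] by auto
  then show ?thesis
    using main[OF assms(3)] main[OF separation_commute[OF assms(3)]] by blast
qed

text \<open>Separators of the part lift to separators of \<open>W\<close>. The size condition
  follows from \<open>k \<le> Suc (card S)\<close>, because \<open>A\<close> is nonempty.\<close>

lemma connectivity_ge_part:
  assumes sep: "separation W S A B" and "clique S" "finite W" "connectivity_ge k W"
  shows "connectivity_ge k (S \<union> A)"
proof -
  have "Suc (card S) \<le> card (S \<union> A)"
  proof -
    have "S \<subset> S \<union> A" "finite (S \<union> A)" using sep assms(3) by (auto simp: separation_def)
    then show ?thesis using psubset_card_mono by (metis Suc_leI)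
  qed
  moreover have "k \<le> Suc (card S)" using assms(4) sep by (auto simp: connectivity_ge_def)
  ultimately have card: "k \<le> card (S \<union> A)" by linarith
  show ?thesis
    unfolding connectivity_ge_def
  proof (intro conjI allI impI)
    show "k \<le> card (S \<union> A)"
      by (rule card)
    fix S' A' B' assume "separation (S \<union> A) S' A' B'"
    then show "k \<le> Suc (card S')"
      using separation_lift[OF sep assms(2)] assms(4) unfolding connectivity_ge_def by blast
  qed
qed

lemma finite_clique_complex: "finite W \<Longrightarrow> finite (clique_complex W)"
  by (rule finite_subset[of _ "Pow W"]) (auto simp: clique_complex_def)

lemma facet_extend:
  assumes "finite \<Delta>" "F \<in> \<Delta>"
  obtains M where "M \<in> facets \<Delta>" "F \<subseteq> M"
proof -
  obtain M where "M \<in> \<Delta>" "F \<subseteq> M" "\<forall>F'\<in>\<Delta>. M \<le> F' \<longrightarrow> M = F'"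
    using finite_has_maximal2[OF assms] by metis
  then show thesis using that[of M] by (auto simp: facets_def)
qed

text \<open>A facet lies in one part. If it fills that part, it strictly contains \<open>S\<close>;
  otherwise the separator found inside the part lifts to \<open>W\<close>.\<close>

lemma facet_separation:
  assumes "decomposable W" "finite W" "M \<in> facets (clique_complex W)"
  shows "M = W \<or> (\<exists>S A B. separation W S A B \<and> card S < card M)"
  using assms
proof (induction arbitrary: M rule: decomposable.induct)
  case (clique W)
  then show ?case by (auto simp: facets_def clique_complex_def)
next
  case (glue W S A B)
  have main: "\<exists>S A B. separation W S A B \<and> card S < card M"
    if sep: "separation W S A B" and sub: "M \<subseteq> S \<union> A"
      and IH: "\<And>M. finite (S \<union> A) \<Longrightarrow> M \<in> facets (clique_complex (S \<union> A)) \<Longrightarrow>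
        M = S \<union> A \<or> (\<exists>S' A' B'. separation (S \<union> A) S' A' B' \<and> card S' < card M)" for A B
  proof -
    have SW: "S \<union> A \<subseteq> W" using sep by (auto simp: separation_def)
    have fin: "finite (S \<union> A)" using SW glue.prems(1) finite_subset by blast
    have "M \<in> facets (clique_complex (S \<union> A))"
      unfolding facets_def
    proof (intro CollectI conjI ballI impI)
      show "M \<in> clique_complex (S \<union> A)"
        using glue.prems(2) sub by (simp add: facets_def clique_complex_def)
      fix F' assume F': "F' \<in> clique_complex (S \<union> A)" "M \<subseteq> F'"
      then have "F' \<in> clique_complex W"
        using SW unfolding clique_complex_def by blast
      then show "F' = M" using glue.prems(2) F'(2) by (simp add: facets_def)
    qed
    from IH[OF fin this] show ?thesis
    proof
      assume M: "M = S \<union> A"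
      have "S \<subset> S \<union> A" using sep by (auto simp: separation_def)
      from psubset_card_mono[OF fin this] have "card S < card M" by (simp add: M)
      then show ?thesis using sep by blast
    next
      assume "\<exists>S' A' B'. separation (S \<union> A) S' A' B' \<and> card S' < card M"
      then obtain S' A' B' where "separation (S \<union> A) S' A' B'" "card S' < card M" by blast
      moreover from separation_lift[OF sep glue.hyps(2) this(1)]
      obtain A'' B'' where "separation W S' A'' B''" by blast
      ultimately show ?thesis by blast
    qed
  qed
  have "M \<subseteq> W" "clique M"
    using glue.prems(2) by (auto simp: facets_def clique_complex_def)
  then consider "M \<subseteq> S \<union> A" | "M \<subseteq> S \<union> B"
    using clique_in_part[OF glue.hyps(1)] by blast
  then show ?case
  proof cases
    case 1
    from main[OF glue.hyps(1) 1 glue.IH(1)] show ?thesis by simp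
  next
    case 2
    from main[OF separation_commute[OF glue.hyps(1)] 2 glue.IH(2)] show ?thesis by simp
  qed
qed

lemma connectivity_le_facet:
  assumes "decomposable W" "finite W" "connectivity_ge k W" "M \<in> facets (clique_complex W)"
  shows "k \<le> card M"
  using facet_separation[OF assms(1,2,4)]
proof
  assume "\<exists>S A B. separation W S A B \<and> card S < card M"
  then obtain S A B where "separation W S A B" "card S < card M" by blast
  then have "k \<le> Suc (card S)" "Suc (card S) \<le> card M"
    using assms(3) by (auto simp: connectivity_ge_def)
  then show ?thesis by linarith
qed (use assms(3) in \<open>auto simp: connectivity_ge_def\<close>)

section \<open>Paths of cliques of fixed size\<close>

text \<open>Stated with \<open>Suc\<close> so that for \<open>k = 0\<close> no pair is adjacent, in
  accordance with dimension -1, where no intersection has the required size.\<close>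

definition adjacent_cliques :: "nat \<Rightarrow> 'v set \<Rightarrow> 'v set \<Rightarrow> 'v set \<Rightarrow> bool" where
  "adjacent_cliques k W F F' \<longleftrightarrow> F \<in> clique_complex W \<and> F' \<in> clique_complex W \<and>
     card F = k \<and> card F' = k \<and> Suc (card (F \<inter> F')) = k"

lemma adjacent_cliques_mono:
  assumes "W \<subseteq> W'" "(adjacent_cliques k W)\<^sup>*\<^sup>* F F'"
  shows "(adjacent_cliques k W')\<^sup>*\<^sup>* F F'"
proof -
  have "clique_complex W \<subseteq> clique_complex W'"
    using assms(1) by (auto simp: clique_complex_def)
  then have "adjacent_cliques k W \<le> adjacent_cliques k W'"
    by (auto simp: adjacent_cliques_def)
  then show ?thesis
    using assms(2) by (rule rtranclp_mono[THEN predicate2D])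
qed

lemma adjacent_cliques_sym:
  "(adjacent_cliques k W)\<^sup>*\<^sup>* F F' \<Longrightarrow> (adjacent_cliques k W)\<^sup>*\<^sup>* F' F"
  by (rule sympD[OF symp_rtranclp]) (auto intro!: sympI simp: adjacent_cliques_def Int_commute)

lemma clique_subsets_connected:
  assumes "clique W" "finite W" "F \<subseteq> W" "F' \<subseteq> W" "card F = k" "card F' = k"
  shows "(adjacent_cliques k W)\<^sup>*\<^sup>* F F'"
  using assms
proof (induction "card (F - F')" arbitrary: F rule: less_induct)
  case less
  have fin: "finite F" "finite F'" using less.prems finite_subset by auto
  show ?case
  proof (cases "F = F'")
    case False
    then have "\<not> F \<subseteq> F'" "\<not> F' \<subseteq> F"
      using card_subset_eq[OF fin(2)] card_subset_eq[OF fin(1)] less.prems by auto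
    then obtain x y where xy: "x \<in> F" "x \<notin> F'" "y \<in> F'" "y \<notin> F" by blast
    \<comment> \<open>Exchanging one vertex of \<open>F\<close> for one of \<open>F'\<close> keeps
      the size and brings \<open>F\<close> closer to \<open>F'\<close>.\<close>
    define D where "D = insert y (F - {x})"
    have "0 < k" using xy fin less.prems card_gt_0_iff by blast
    then have k: "Suc (k - Suc 0) = k" by simp
    have cD: "card D = k"
      using xy fin less.prems k by (simp add: D_def)
    have "F \<inter> D = F - {x}" using xy by (auto simp: D_def)
    then have "Suc (card (F \<inter> D)) = k"
      using xy fin less.prems k by simp
    moreover have "D \<subseteq> W" using less.prems xy by (auto simp: D_def)
    ultimately have "adjacent_cliques k W F D"
      unfolding adjacent_cliques_def clique_complex_def
      using less.prems(3,5) cD clique_subset[OF less.prems(1)] by blast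
    moreover have "(adjacent_cliques k W)\<^sup>*\<^sup>* D F'"
    proof (rule less.hyps)
      have "D - F' \<subset> F - F'" using xy by (auto simp: D_def)
      then show "card (D - F') < card (F - F')"
        using fin by (intro psubset_card_mono) simp_all
    qed (fact less.prems \<open>D \<subseteq> W\<close> cD)+
    ultimately show ?thesis by (rule converse_rtranclp_into_rtranclp)
  qed simp
qed

text \<open>Each part is connected by induction, so one path from some \<open>X\<close> to some
  \<open>Y\<close> across the separator is enough. If \<open>k \<le> card S\<close> it is constant
  inside \<open>S\<close>; otherwise \<open>k = Suc (card S)\<close> and \<open>S\<close> is
  extended by one vertex on either side.\<close>

lemma cliques_connected:
  assumes "decomposable W" "finite W" "connectivity_ge k W"
    and "F \<in> clique_complex W" "F' \<in> clique_complex W" "card F = k" "card F' = k"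
  shows "(adjacent_cliques k W)\<^sup>*\<^sup>* F F'"
  using assms
proof (induction arbitrary: F F' rule: decomposable.induct)
  case (clique W)
  then show ?case using clique_subsets_connected by (auto simp: clique_complex_def)
next
  case (glue W S A B)
  note sep = glue.hyps(1) and clS = glue.hyps(2) and fin = glue.prems(1) and con = glue.prems(2)
  have fins: "finite S" "finite A" "finite B" using sep fin by (auto simp: separation_def)
  have subs: "S \<union> A \<subseteq> W" "S \<union> B \<subseteq> W" using sep by (auto simp: separation_def)
  have cA: "connectivity_ge k (S \<union> A)" by (rule connectivity_ge_part[OF sep clS fin con])
  have cB: "connectivity_ge k (S \<union> B)"
    by (rule connectivity_ge_part[OF separation_commute[OF sep] clS fin con])
  have IHA: "(adjacent_cliques k W)\<^sup>*\<^sup>* X Y"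
    if "X \<subseteq> S \<union> A" "Y \<subseteq> S \<union> A" "clique X" "clique Y" "card X = k" "card Y = k" for X Y
    using that glue.IH(1)[of X Y] fins cA
    by (intro adjacent_cliques_mono[OF subs(1)]) (auto simp: clique_complex_def)
  have IHB: "(adjacent_cliques k W)\<^sup>*\<^sup>* X Y"
    if "X \<subseteq> S \<union> B" "Y \<subseteq> S \<union> B" "clique X" "clique Y" "card X = k" "card Y = k" for X Y
    using that glue.IH(2)[of X Y] fins cB
    by (intro adjacent_cliques_mono[OF subs(2)]) (auto simp: clique_complex_def)
  \<comment> \<open>A facet of the part above \<open>S\<close> has at least \<open>k\<close>
    vertices, hence one outside \<open>S\<close>.\<close>
  have extend: "\<exists>a\<in>A. clique (insert a S)"
    if "connectivity_ge k (S \<union> A)" "decomposable (S \<union> A)" "finite A" "k = Suc (card S)" for A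
  proof -
    have fin': "finite (S \<union> A)" using that fins by simp
    have "S \<in> clique_complex (S \<union> A)" using clS by (auto simp: clique_complex_def)
    then obtain M where M: "M \<in> facets (clique_complex (S \<union> A))" "S \<subseteq> M"
      by (rule facet_extend[OF finite_clique_complex[OF fin']])
    have "card S < card M"
      using connectivity_le_facet[OF that(2) fin' that(1) M(1)] that(4) by simp
    then obtain a where a: "a \<in> M" "a \<notin> S" using M(2) by (metis order.irrefl subsetI subset_antisym)
    then have "a \<in> A" "clique (insert a S)"
      using M by (auto simp: facets_def clique_complex_def intro: clique_subset)
    then show ?thesis by blast
  qed
  obtain X Y where XY: "X \<subseteq> S \<union> A" "Y \<subseteq> S \<union> B" "clique X" "clique Y" "card X = k" "card Y = k"
      "(adjacent_cliques k W)\<^sup>*\<^sup>* X Y"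
  proof (cases "k \<le> card S")
    case True
    then obtain D where "D \<subseteq> S" "card D = k"
      by (meson obtain_subset_with_card_n)
    then show ?thesis using that[of D D] clique_subset[OF clS] by auto
  next
    case False
    then have k: "k = Suc (card S)"
      using con sep unfolding connectivity_ge_def by (metis le_SucE not_less_eq_eq)
    obtain a b where ab: "a \<in> A" "clique (insert a S)" "b \<in> B" "clique (insert b S)"
      using extend[OF cA glue.hyps(3) fins(2) k] extend[OF cB glue.hyps(4) fins(3) k] by blast
    have nin: "a \<notin> S" "b \<notin> S" "a \<noteq> b" using ab sep by (auto simp: separation_def)
    then have "insert a S \<inter> insert b S = S" by auto
    then have "adjacent_cliques k W (insert a S) (insert b S)"
      using ab nin k subs fins by (auto simp: adjacent_cliques_def clique_complex_def)
    then show ?thesis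
      using that[of "insert a S" "insert b S"] ab nin k fins by auto
  qed
  have F: "clique F" "clique F'" "F \<subseteq> W" "F' \<subseteq> W"
    using glue.prems by (auto simp: clique_complex_def)
  consider "F \<subseteq> S \<union> A" "F' \<subseteq> S \<union> A" | "F \<subseteq> S \<union> B" "F' \<subseteq> S \<union> B"
    | "F \<subseteq> S \<union> A" "F' \<subseteq> S \<union> B" | "F \<subseteq> S \<union> B" "F' \<subseteq> S \<union> A"
    using clique_in_part[OF sep F(1,3)] clique_in_part[OF sep F(2,4)] by blast
  then show ?case
  proof cases
    case 1
    then show ?thesis using IHA F glue.prems by blast
  next
    case 2
    then show ?thesis using IHB F glue.prems by blast
  next
    case 3
    have "(adjacent_cliques k W)\<^sup>*\<^sup>* F X" "(adjacent_cliques k W)\<^sup>*\<^sup>* Y F'"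
      using IHA IHB 3 F XY glue.prems by blast+
    then show ?thesis using XY(7) by (meson rtranclp_trans)
  next
    case 4
    have "(adjacent_cliques k W)\<^sup>*\<^sup>* F Y" "(adjacent_cliques k W)\<^sup>*\<^sup>* X F'"
      using IHA IHB 4 F XY glue.prems by blast+
    then show ?thesis using adjacent_cliques_sym[OF XY(7)] by (meson rtranclp_trans)
  qed
qed

text \<open>Consecutive cliques share \<open>k - 1\<close> vertices, more than \<open>S\<close>
  contains, so a path cannot step from one side to the other.\<close>

lemma adjacent_cliques_stay:
  assumes sep: "separation W S A B" and fin: "finite W" and k: "Suc (card S) < k"
    and path: "(adjacent_cliques k W)\<^sup>*\<^sup>* F F'" and "F \<subseteq> S \<union> A"
  shows "F' \<subseteq> S \<union> A"
  using path assms(5)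
proof (induction rule: rtranclp_induct)
  case (step F' F'')
  have adj: "F'' \<subseteq> W" "clique F''" "Suc (card (F' \<inter> F'')) = k"
    using step.hyps by (auto simp: adjacent_cliques_def clique_complex_def)
  show ?case
  proof (rule ccontr)
    assume "\<not> F'' \<subseteq> S \<union> A"
    then have "F'' \<subseteq> S \<union> B" using clique_in_part[OF sep adj(2,1)] by blast
    then have "F' \<inter> F'' \<subseteq> S" using step sep by (auto simp: separation_def)
    moreover have "finite S" using sep fin by (auto simp: separation_def)
    ultimately have "card (F' \<inter> F'') \<le> card S" by (intro card_mono)
    then show False using adj k by simp
  qed
qed

section \<open>The smallest facet and the skeleton of its dimension\<close>

definition min_facet_card :: "'v set \<Rightarrow> nat" where
  "min_facet_card W = Min (card ` facets (clique_complex W))"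

lemma facets_nonempty:
  assumes "finite W"
  shows "facets (clique_complex W) \<noteq> {}" "finite (facets (clique_complex W))"
proof -
  have "{} \<in> clique_complex W" by (auto simp: clique_complex_def clique_def)
  then show "facets (clique_complex W) \<noteq> {}"
    using facet_extend[OF finite_clique_complex[OF assms]] by blast
  show "finite (facets (clique_complex W))"
    using finite_clique_complex[OF assms] by (simp add: facets_def)
qed

lemma min_facet_card_le: "finite W \<Longrightarrow> M \<in> facets (clique_complex W) \<Longrightarrow> min_facet_card W \<le> card M"
  unfolding min_facet_card_def using facets_nonempty[of W] by simp

lemma min_facet_card_attained:
  assumes "finite W"
  obtains M where "M \<in> facets (clique_complex W)" "card M = min_facet_card W"
proof -
  have "Min (card ` facets (clique_complex W)) \<in> card ` facets (clique_complex W)"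
    using facets_nonempty[OF assms] by (intro Min_in) auto
  then show thesis using that unfolding min_facet_card_def by force
qed

lemma complex_indim_clique_complex:
  assumes "finite W"
  shows "complex_indim (clique_complex W) = int (min_facet_card W) - 1"
proof -
  obtain M where M: "M \<in> facets (clique_complex W)" "card M = min_facet_card W"
    using min_facet_card_attained[OF assms] .
  show ?thesis
    unfolding complex_indim_def
  proof (rule Min_eqI)
    show "int (min_facet_card W) - 1 \<in> face_dim ` facets (clique_complex W)"
      using M by (force simp: face_dim_def)
    show "int (min_facet_card W) - 1 \<le> y" if "y \<in> face_dim ` facets (clique_complex W)" for y
      using that min_facet_card_le[OF assms] by (force simp: face_dim_def)
  qed (use facets_nonempty[OF assms] in simp)
qed

lemma face_extend_card:
  assumes "finite W" "F \<in> clique_complex W" "card F \<le> min_facet_card W"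
  obtains D where "F \<subseteq> D" "D \<in> clique_complex W" "card D = min_facet_card W"
proof -
  obtain M where M: "M \<in> facets (clique_complex W)" "F \<subseteq> M"
    using facet_extend[OF finite_clique_complex[OF assms(1)] assms(2)] .
  then have MW: "M \<subseteq> W" "clique M" by (auto simp: facets_def clique_complex_def)
  then have "finite M" using assms(1) finite_subset by blast
  then obtain D where "F \<subseteq> D" "D \<subseteq> M" "card D = min_facet_card W"
    using exists_subset_between[OF assms(3) min_facet_card_le[OF assms(1) M(1)] M(2)] by blast
  then show thesis using that MW clique_subset by (auto simp: clique_complex_def)
qed

text \<open>Every facet has at least \<open>min_facet_card W\<close> vertices, so each smaller face
  extends to one of exactly that size and the skeleton is pure.\<close>

lemma skeleton_facets:
  assumes "finite W"
  defines "\<Gamma> \<equiv> skeleton (complex_indim (clique_complex W)) (clique_complex W)"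
  shows "facets \<Gamma> = {F \<in> clique_complex W. card F = min_facet_card W}"
    and "complex_dim \<Gamma> = int (min_facet_card W) - 1"
proof -
  have G: "\<Gamma> = {F \<in> clique_complex W. card F \<le> min_facet_card W}"
    by (auto simp: \<Gamma>_def skeleton_def complex_indim_clique_complex[OF assms(1)] face_dim_def)
  have finF: "finite F" if "F \<in> clique_complex W" for F
    using that assms(1) finite_subset by (auto simp: clique_complex_def)
  show "facets \<Gamma> = {F \<in> clique_complex W. card F = min_facet_card W}"
  proof (intro equalityI subsetI)
    fix F assume F: "F \<in> facets \<Gamma>"
    then have "F \<in> clique_complex W" "card F \<le> min_facet_card W" by (auto simp: facets_def G)
    then obtain D where "F \<subseteq> D" "D \<in> clique_complex W" "card D = min_facet_card W"
      using face_extend_card[OF assms(1)] by blast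
    then show "F \<in> {F \<in> clique_complex W. card F = min_facet_card W}"
      using F by (auto simp: facets_def G)
  next
    fix F assume "F \<in> {F \<in> clique_complex W. card F = min_facet_card W}"
    then show "F \<in> facets \<Gamma>"
      using card_seteq[OF finF, of _ F] by (auto simp: facets_def G)
  qed
  obtain M where M: "M \<in> facets (clique_complex W)" "card M = min_facet_card W"
    using min_facet_card_attained[OF assms(1)] .
  show "complex_dim \<Gamma> = int (min_facet_card W) - 1"
    unfolding complex_dim_def
  proof (rule Max_eqI)
    show "finite (face_dim ` \<Gamma>)"
      using finite_clique_complex[OF assms(1)] by (simp add: G)
    show "int (min_facet_card W) - 1 \<in> face_dim ` \<Gamma>"
      using M by (force simp: face_dim_def G facets_def)
  qed (auto simp: G face_dim_def)
qed

lemma weakly_connected_iff_paths: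
  assumes "finite W"
  shows "weakly_connected (clique_complex W) \<longleftrightarrow>
    (\<forall>F\<in>clique_complex W. \<forall>F'\<in>clique_complex W. card F = min_facet_card W \<longrightarrow>
       card F' = min_facet_card W \<longrightarrow> (adjacent_cliques (min_facet_card W) W)\<^sup>*\<^sup>* F F')"
proof -
  let ?d = "min_facet_card W"
  let ?P = "\<lambda>F. F \<in> clique_complex W \<and> card F = ?d"
  have "(\<exists>t p. p (0::nat) = F \<and> p t = F' \<and> (\<forall>i\<le>t. ?P (p i)) \<and>
          (\<forall>i<t. int (card (p i \<inter> p (Suc i))) = int ?d - 1)) \<longleftrightarrow>
        (adjacent_cliques ?d W)\<^sup>*\<^sup>* F F'" (is "?L \<longleftrightarrow> ?R") if F: "?P F" for F F'
  proof
    assume ?L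
    then obtain t p where p: "p 0 = F" "p t = F'" "\<forall>i\<le>t. ?P (p i)"
      "\<forall>i<t. int (card (p i \<inter> p (Suc i))) = int ?d - 1" by blast
    have "\<forall>i<t. adjacent_cliques ?d W (p i) (p (Suc i))"
      using p by (fastforce simp: adjacent_cliques_def)
    then show ?R
      using p(1,2) by (metis relpowp_fun_conv relpowp_imp_rtranclp)
  next
    assume ?R
    then obtain t p where p: "p 0 = F" "p t = F'" "\<forall>i<t. adjacent_cliques ?d W (p i) (p (Suc i))"
      by (metis relpowp_fun_conv rtranclp_imp_relpowp)
    have "?P (p i)" if "i \<le> t" for i
      using that p F by (cases i) (auto simp: adjacent_cliques_def)
    moreover have "int (card (p i \<inter> p (Suc i))) = int ?d - 1" if "i < t" for i
      using p(3) that by (force simp: adjacent_cliques_def)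
    ultimately show ?L using p(1,2) by blast
  qed
  then show ?thesis
    unfolding weakly_connected_def strongly_connected_complex_def skeleton_facets[OF assms]
    by auto
qed

lemma weakly_connected_iff_connectivity:
  assumes fin: "finite W" and dec: "decomposable W"
  shows "weakly_connected (clique_complex W) \<longleftrightarrow> connectivity_ge (min_facet_card W) W"
proof
  assume "connectivity_ge (min_facet_card W) W"
  then show "weakly_connected (clique_complex W)"
    using cliques_connected[OF dec fin] by (simp add: weakly_connected_iff_paths[OF fin])
next
  assume wc: "weakly_connected (clique_complex W)"
  let ?d = "min_facet_card W"
  obtain M where M: "M \<in> facets (clique_complex W)" "card M = ?d"
    using min_facet_card_attained[OF fin] .
  have dW: "?d \<le> card W"
    using M card_mono[OF fin, of M] by (auto simp: facets_def clique_complex_def)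
  show "connectivity_ge ?d W"
  proof (rule ccontr)
    assume "\<not> connectivity_ge ?d W"
    then obtain S A B where sep: "separation W S A B" and S: "Suc (card S) < ?d"
      using dW by (auto simp: connectivity_ge_def not_le)
    obtain a b where ab: "a \<in> A" "b \<in> B" using sep by (auto simp: separation_def)
    \<comment> \<open>Since \<open>?d\<close> is at least 1 here, every vertex lies in a clique of
      size \<open>?d\<close>; such cliques through \<open>a\<close> and through \<open>b\<close> lie
      on different sides.\<close>
    have ex: "\<exists>F. F \<in> clique_complex W \<and> card F = ?d \<and> v \<in> F" if "v \<in> W" for v
    proof -
      have "{v} \<in> clique_complex W" using that by (auto simp: clique_complex_def clique_def)
      then show ?thesis using face_extend_card[OF fin, of "{v}"] S by auto
    qed
    obtain F F' where F: "F \<in> clique_complex W" "card F = ?d" "a \<in> F"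
      and F': "F' \<in> clique_complex W" "card F' = ?d" "b \<in> F'"
      using ex[of a] ex[of b] ab sep by (auto simp: separation_def)
    have "a \<notin> S \<union> B" using ab sep by (auto simp: separation_def)
    then have "F \<subseteq> S \<union> A"
      using clique_in_part[OF sep, of F] F by (auto simp: clique_complex_def)
    moreover have "(adjacent_cliques ?d W)\<^sup>*\<^sup>* F F'"
      using wc F F' by (simp add: weakly_connected_iff_paths[OF fin])
    ultimately have "F' \<subseteq> S \<union> A" using adjacent_cliques_stay[OF sep fin S] by blast
    then show False using F' ab sep by (auto simp: separation_def)
  qed
qed

end

section \<open>Monomials and monomial ideals\<close>

lemma keys_plus_nat: "Poly_Mapping.keys (m + n) = Poly_Mapping.keys m \<union> Poly_Mapping.keys n"
  for m n :: "'v \<Rightarrow>\<^sub>0 nat"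
  by (auto simp: in_keys_iff lookup_add)

definition pm_filter :: "('a \<Rightarrow> bool) \<Rightarrow> ('a \<Rightarrow>\<^sub>0 'b::zero) \<Rightarrow> 'a \<Rightarrow>\<^sub>0 'b" where
  "pm_filter P p = Poly_Mapping.mapp (\<lambda>m c. if P m then c else 0) p"

lemma lookup_pm_filter: "Poly_Mapping.lookup (pm_filter P p) m = (if P m then Poly_Mapping.lookup p m else 0)"
  by (auto simp: pm_filter_def lookup_mapp when_def in_keys_iff)

lemma keys_pm_filter: "Poly_Mapping.keys (pm_filter P p) = {m \<in> Poly_Mapping.keys p. P m}"
  by (auto simp: in_keys_iff lookup_pm_filter split: if_splits)

lemma pm_filter_add: "pm_filter P (p + q) = pm_filter P p + pm_filter P (q :: _ \<Rightarrow>\<^sub>0 'b::monoid_add)"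
  by (rule poly_mapping_eqI) (simp add: lookup_pm_filter lookup_add)

lemma pm_filter_split: "p = pm_filter P p + pm_filter (\<lambda>m. \<not> P m) (p :: _ \<Rightarrow>\<^sub>0 'b::monoid_add)"
  by (rule poly_mapping_eqI) (simp add: lookup_pm_filter lookup_add)

lemma pm_filter_all: "(\<And>m. m \<in> Poly_Mapping.keys p \<Longrightarrow> P m) \<Longrightarrow> pm_filter P p = p"
  by (rule poly_mapping_eqI) (auto simp: lookup_pm_filter in_keys_iff)

lemma pm_filter_none: "(\<And>m. m \<in> Poly_Mapping.keys p \<Longrightarrow> \<not> P m) \<Longrightarrow> pm_filter P p = 0"
  by (rule poly_mapping_eqI) (auto simp: lookup_pm_filter in_keys_iff)

lemma keys_mult_mpoly:
  assumes "m \<in> Poly_Mapping.keys (p * q)"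
  obtains a b where "a \<in> Poly_Mapping.keys p" "b \<in> Poly_Mapping.keys q" "m = a + b"
  using keys_mult[of p q] assms by auto

text \<open>By the assumption on \<open>P\<close>, the kept monomials are closed under products and
  the discarded ones absorb factors. Filtering is then multiplicative, as when some variables are
  set to 0.\<close>

lemma pm_filter_mult:
  fixes p q :: "('v, 'k::field) mpoly"
  assumes "\<And>a b. P (a + b) \<longleftrightarrow> P a \<and> P b"
  shows "pm_filter P (p * q) = pm_filter P p * pm_filter P q"
proof -
  let ?N = "\<lambda>m. \<not> P m"
  have "p * q = (pm_filter P p + pm_filter ?N p) * (pm_filter P q + pm_filter ?N q)"
    using pm_filter_split[of p P] pm_filter_split[of q P] by simp
  also have "\<dots> = pm_filter P p * pm_filter P q +
      (pm_filter P p * pm_filter ?N q + pm_filter ?N p * (pm_filter P q + pm_filter ?N q))"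
    by (simp add: algebra_simps)
  finally have eq: "p * q = \<dots>" .
  have "pm_filter P (pm_filter P p * pm_filter P q) = pm_filter P p * pm_filter P q"
    by (rule pm_filter_all) (auto elim!: keys_mult_mpoly simp: keys_pm_filter assms)
  moreover have "pm_filter P (pm_filter P p * pm_filter ?N q) = 0"
    by (rule pm_filter_none) (auto elim!: keys_mult_mpoly simp: keys_pm_filter assms)
  moreover have "pm_filter P (pm_filter ?N p * (pm_filter P q + pm_filter ?N q)) = 0"
    by (rule pm_filter_none) (auto elim!: keys_mult_mpoly simp: keys_pm_filter assms)
  ultimately show ?thesis
    by (simp only: eq pm_filter_add) simp
qed

lemma sum_monomials: "(\<Sum>m\<in>Poly_Mapping.keys p. Poly_Mapping.single m (Poly_Mapping.lookup p m)) = p"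
proof (rule poly_mapping_eqI)
  fix k
  have "Poly_Mapping.lookup (\<Sum>m\<in>Poly_Mapping.keys p. Poly_Mapping.single m (Poly_Mapping.lookup p m)) k =
      (\<Sum>m\<in>Poly_Mapping.keys p. if m = k then Poly_Mapping.lookup p m else 0)"
    by (simp add: lookup_sum lookup_single when_def)
  also have "\<dots> = Poly_Mapping.lookup p k"
    by (simp add: in_keys_iff)
  finally show "Poly_Mapping.lookup (\<Sum>m\<in>Poly_Mapping.keys p. Poly_Mapping.single m (Poly_Mapping.lookup p m)) k = Poly_Mapping.lookup p k" .
qed

lemma lookup_single_mult:
  fixes p :: "('v, 'k::field) mpoly"
  shows "Poly_Mapping.lookup (Poly_Mapping.single m c * p) (m + n) = c * Poly_Mapping.lookup p n"
proof -
  have "Poly_Mapping.single m c * p =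
      (\<Sum>k\<in>Poly_Mapping.keys p. Poly_Mapping.single (m + k) (c * Poly_Mapping.lookup p k))"
    by (subst (1) sum_monomials[of p, symmetric]) (simp add: sum_distrib_left mult_single)
  then have "Poly_Mapping.lookup (Poly_Mapping.single m c * p) (m + n) =
      (\<Sum>k\<in>Poly_Mapping.keys p. if k = n then c * Poly_Mapping.lookup p k else 0)"
    by (simp add: lookup_sum lookup_single when_def)
  also have "\<dots> = c * Poly_Mapping.lookup p n"
    by (simp add: in_keys_iff)
  finally show ?thesis .
qed

lemma var_mult_keys:
  assumes "m \<in> Poly_Mapping.keys (var v * p)"
  shows "v \<in> Poly_Mapping.keys m"
  using assms by (auto elim!: keys_mult_mpoly simp: var_def keys_plus_nat split: if_splits)

lemma lookup_var_mult:
  fixes p :: "('v, 'k::field) mpoly"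
  shows "Poly_Mapping.lookup (var v * p) (Poly_Mapping.single v 1 + m) = Poly_Mapping.lookup p m"
  by (simp add: var_def lookup_single_mult)

lemma var_divides:
  fixes p :: "('v, 'k::field) mpoly"
  assumes "\<And>m. m \<in> Poly_Mapping.keys p \<Longrightarrow> v \<in> Poly_Mapping.keys m"
  obtains q where "p = var v * q"
    "\<And>m. m \<in> Poly_Mapping.keys q \<Longrightarrow> m + Poly_Mapping.single v 1 \<in> Poly_Mapping.keys p"
proof -
  define s :: "'v \<Rightarrow>\<^sub>0 nat" where "s = Poly_Mapping.single v 1"
  define q :: "('v, 'k) mpoly" where "q = (\<Sum>m\<in>Poly_Mapping.keys p. Poly_Mapping.single (m - s) (Poly_Mapping.lookup p m))"
  have ms: "s + (m - s) = m" if "m \<in> Poly_Mapping.keys p" for m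
    using assms[OF that]
    by (intro poly_mapping_eqI) (auto simp: s_def lookup_add lookup_minus lookup_single when_def in_keys_iff)
  have "var v * q = (\<Sum>m\<in>Poly_Mapping.keys p. Poly_Mapping.single (s + (m - s)) (Poly_Mapping.lookup p m))"
    by (simp add: q_def var_def s_def sum_distrib_left mult_single)
  also have "\<dots> = p"
    using ms by (simp add: sum_monomials)
  finally have eq: "p = var v * q" by simp
  have "m + s \<in> Poly_Mapping.keys p" if "m \<in> Poly_Mapping.keys q" for m
  proof -
    have "m \<in> (\<Union>k\<in>Poly_Mapping.keys p. Poly_Mapping.keys (Poly_Mapping.single (k - s) (Poly_Mapping.lookup p k)))"
      using that keys_sum[of "\<lambda>k. Poly_Mapping.single (k - s) (Poly_Mapping.lookup p k)" "Poly_Mapping.keys p"]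
      unfolding q_def by (rule subsetD[rotated])
    then obtain k where k: "k \<in> Poly_Mapping.keys p" "m = k - s"
      by (auto split: if_splits)
    then show ?thesis using ms[of k] by (simp add: add.commute)
  qed
  then show thesis using that[OF eq] by (simp add: s_def)
qed

locale poly_vars =
  fixes V :: "'v set" and K :: "'k::field itself"
  assumes finite_V: "finite V"
begin

definition polys :: "('v, 'k) mpoly set" where
  "polys = {p. \<forall>m\<in>Poly_Mapping.keys p. Poly_Mapping.keys m \<subseteq> V}"

sublocale subring_carrier polys
proof
  show "x * y \<in> polys" if "x \<in> polys" "y \<in> polys" for x y
    unfolding polys_def
  proof (intro CollectI ballI)
    fix m assume "m \<in> Poly_Mapping.keys (x * y)"
    then obtain a b where "a \<in> Poly_Mapping.keys x" "b \<in> Poly_Mapping.keys y" "m = a + b"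
      by (rule keys_mult_mpoly)
    then show "Poly_Mapping.keys m \<subseteq> V" using that by (simp add: polys_def keys_plus_nat)
  qed
  show "x + y \<in> polys" if "x \<in> polys" "y \<in> polys" for x y
    using that keys_add[of x y] by (auto simp: polys_def)
qed (auto simp: polys_def)

lemma single_C: "Poly_Mapping.keys m \<subseteq> V \<Longrightarrow> Poly_Mapping.single m c \<in> polys"
  by (simp add: polys_def)

lemma var_C: "v \<in> V \<Longrightarrow> var v \<in> polys"
  by (simp add: var_def single_C)

lemma pm_filter_C: "p \<in> polys \<Longrightarrow> pm_filter P p \<in> polys"
  by (auto simp: polys_def keys_pm_filter)

lemma var_divides_C:
  assumes "p \<in> polys" "\<And>m. m \<in> Poly_Mapping.keys p \<Longrightarrow> v \<in> Poly_Mapping.keys m"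
  obtains q where "p = var v * q" "q \<in> polys"
proof -
  obtain q where q: "p = var v * q"
      "\<And>m. m \<in> Poly_Mapping.keys q \<Longrightarrow> m + Poly_Mapping.single v 1 \<in> Poly_Mapping.keys p"
    using var_divides[OF assms(2)] by blast
  have "q \<in> polys"
    unfolding polys_def
  proof (intro CollectI ballI)
    fix m assume "m \<in> Poly_Mapping.keys q"
    then have "Poly_Mapping.keys (m + Poly_Mapping.single v 1) \<subseteq> V"
      using q(2) assms(1) by (simp add: polys_def)
    then show "Poly_Mapping.keys m \<subseteq> V" by (simp add: keys_plus_nat)
  qed
  then show thesis using that q by blast
qed

section \<open>Stanley-Reisner ideals by monomial support\<close>

text \<open>Membership is read off monomial by monomial, which makes sums and intersections
  transparent. For complexes, \<open>stanley_reisner_ideal_eq\<close> gives agreement with the ideal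
  generated by the minimal nonfaces.\<close>

definition sr_ideal :: "'v set set \<Rightarrow> ('v, 'k) mpoly set" where
  "sr_ideal \<Delta> = {p \<in> polys. \<forall>m\<in>Poly_Mapping.keys p. Poly_Mapping.keys m \<notin> \<Delta>}"

definition down_closed :: "'v set set \<Rightarrow> bool" where
  "down_closed \<Delta> \<longleftrightarrow> (\<forall>F\<in>\<Delta>. \<forall>F'. F' \<subseteq> F \<longrightarrow> F' \<in> \<Delta>)"

lemma down_closed_Pow: "down_closed (Pow F)"
  by (auto simp: down_closed_def)

lemma ideal_sr_ideal:
  assumes "down_closed \<Delta>"
  shows "ideal_in (sr_ideal \<Delta>)"
proof (rule ideal_inI)
  show "x + y \<in> sr_ideal \<Delta>" if "x \<in> sr_ideal \<Delta>" "y \<in> sr_ideal \<Delta>" for x y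
    using that keys_add[of x y] add_C by (auto simp: sr_ideal_def)
  show "r * x \<in> sr_ideal \<Delta>" if "r \<in> polys" "x \<in> sr_ideal \<Delta>" for r x
    using that assms mult_C
    by (auto simp: sr_ideal_def keys_plus_nat down_closed_def elim!: keys_mult_mpoly)
qed (auto simp: sr_ideal_def zero_C)

lemma sr_ideal_inter: "sr_ideal (\<Delta> \<union> \<Delta>') = sr_ideal \<Delta> \<inter> sr_ideal \<Delta>'"
  by (auto simp: sr_ideal_def)

lemma sr_ideal_plus: "ideal_plus (sr_ideal \<Delta>) (sr_ideal \<Delta>') = sr_ideal (\<Delta> \<inter> \<Delta>')"
proof (intro equalityI subsetI)
  fix p assume "p \<in> ideal_plus (sr_ideal \<Delta>) (sr_ideal \<Delta>')"
  then obtain x y where "p = x + y" "x \<in> sr_ideal \<Delta>" "y \<in> sr_ideal \<Delta>'"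
    by (auto simp: ideal_plus_def)
  then show "p \<in> sr_ideal (\<Delta> \<inter> \<Delta>')"
    using keys_add[of x y] add_C by (auto simp: sr_ideal_def)
next
  fix p assume p: "p \<in> sr_ideal (\<Delta> \<inter> \<Delta>')"
  let ?P = "\<lambda>m. Poly_Mapping.keys m \<notin> \<Delta>"
  have "pm_filter ?P p \<in> sr_ideal \<Delta>" "pm_filter (\<lambda>m. \<not> ?P m) p \<in> sr_ideal \<Delta>'"
    using p pm_filter_C by (auto simp: sr_ideal_def keys_pm_filter)
  then show "p \<in> ideal_plus (sr_ideal \<Delta>) (sr_ideal \<Delta>')"
    unfolding ideal_plus_def using pm_filter_split[of p ?P] by blast
qed

text \<open>Variables outside \<open>V\<close> are not counted, so this is the total degree on monomials in \<open>V\<close> only.\<close>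

definition mdeg :: "('v \<Rightarrow>\<^sub>0 nat) \<Rightarrow> nat" where
  "mdeg m = (\<Sum>v\<in>V. Poly_Mapping.lookup m v)"

lemma mdeg_add: "mdeg (a + b) = mdeg a + mdeg b"
  by (simp add: mdeg_def lookup_add sum.distrib)

definition homogeneous :: "nat \<Rightarrow> ('v, 'k) mpoly \<Rightarrow> bool" where
  "homogeneous e p \<longleftrightarrow> (\<forall>m\<in>Poly_Mapping.keys p. mdeg m = e)"

definition truncate :: "nat \<Rightarrow> ('v, 'k) mpoly \<Rightarrow> ('v, 'k) mpoly" where
  "truncate D = pm_filter (\<lambda>m. mdeg m \<le> D)"

text \<open>Truncations replace homogeneous components: a component is a difference of two
  truncations, so for ideals the two conditions agree.\<close>

definition homogeneous_ideal :: "('v, 'k) mpoly set \<Rightarrow> bool" where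
  "homogeneous_ideal J \<longleftrightarrow> (\<forall>p\<in>J. \<forall>D. truncate D p \<in> J)"

lemma homogeneous_mult: "homogeneous d p \<Longrightarrow> homogeneous e q \<Longrightarrow> homogeneous (d + e) (p * q)"
  by (auto simp: homogeneous_def mdeg_add elim!: keys_mult_mpoly)

lemma homogeneous_power: "homogeneous d p \<Longrightarrow> homogeneous (n * d) (p ^ n)"
proof (induction n)
  case 0
  show ?case by (simp add: homogeneous_def mdeg_def)
qed (auto intro: homogeneous_mult)

lemma homogeneous_var: "v \<in> V \<Longrightarrow> homogeneous 1 (var v)"
  using finite_V by (simp add: homogeneous_def var_def mdeg_def lookup_single when_def)

lemma truncate_homogeneous_mult:
  assumes "homogeneous e a"
  shows "truncate D (a * r) = (if e \<le> D then a * truncate (D - e) r else 0)"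
proof (cases "e \<le> D")
  case True
  let ?P = "\<lambda>m. mdeg m \<le> D - e"
  have "a * r = a * pm_filter ?P r + a * pm_filter (\<lambda>m. \<not> ?P m) r"
    using pm_filter_split[of r ?P] by (metis distrib_left)
  moreover have "truncate D (a * pm_filter ?P r) = a * pm_filter ?P r"
    unfolding truncate_def
    by (rule pm_filter_all)
      (use assms True in \<open>auto elim!: keys_mult_mpoly simp: keys_pm_filter homogeneous_def mdeg_add\<close>)
  moreover have "truncate D (a * pm_filter (\<lambda>m. \<not> ?P m) r) = 0"
    unfolding truncate_def
    by (rule pm_filter_none)
      (use assms True in \<open>auto elim!: keys_mult_mpoly simp: keys_pm_filter homogeneous_def mdeg_add\<close>)
  ultimately show ?thesis
    using True by (simp add: truncate_def pm_filter_add)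
next
  case False
  then show ?thesis
    unfolding truncate_def
    by (auto intro!: pm_filter_none elim!: keys_mult_mpoly
        simp: homogeneous_def[THEN iffD1, OF assms, rule_format] mdeg_add)
qed

lemma homogeneous_ideal_adjoin:
  assumes "homogeneous_ideal J" "homogeneous e a"
  shows "homogeneous_ideal (adjoin J a)"
  unfolding homogeneous_ideal_def
proof (intro ballI allI)
  fix p D assume "p \<in> adjoin J a"
  then obtain x r where p: "p = x + a * r" "x \<in> J" "r \<in> polys" by (rule adjoinE)
  have "truncate D p = truncate D x + truncate D (a * r)"
    by (simp add: p truncate_def pm_filter_add)
  also have "\<dots> = truncate D x + a * (if e \<le> D then truncate (D - e) r else 0)"
    using truncate_homogeneous_mult[OF assms(2)] by simp
  also have "\<dots> \<in> adjoin J a"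
    using assms(1) p pm_filter_C zero_C by (intro adjoinI) (auto simp: homogeneous_ideal_def truncate_def)
  finally show "truncate D p \<in> adjoin J a" .
qed

lemma homogeneous_sr_ideal: "homogeneous_ideal (sr_ideal \<Delta>)"
  by (auto simp: homogeneous_ideal_def truncate_def sr_ideal_def pm_filter_C keys_pm_filter)

lemma homogeneous_separated:
  assumes "homogeneous_ideal J" "homogeneous 1 a" "\<And>r. g \<in> adjoin J (a ^ r)"
  shows "g \<in> J"
proof -
  \<comment> \<open>The exponent \<open>Suc D\<close> exceeds every degree in \<open>g\<close>, so
    truncation at \<open>D\<close> keeps \<open>g\<close> and kills the multiple of that power of
    \<open>a\<close>.\<close>
  define D where "D = Max (insert 0 (mdeg ` Poly_Mapping.keys g))"
  obtain x h where g: "g = x + a ^ Suc D * h" "x \<in> J"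
    using assms(3)[of "Suc D"] by (rule adjoinE)
  have "truncate D g = g"
    unfolding truncate_def by (rule pm_filter_all) (simp add: D_def)
  moreover have "truncate D (a ^ Suc D * h) = 0"
    using truncate_homogeneous_mult[OF homogeneous_power[OF assms(2), of "Suc D"], of D h] by simp
  then have "truncate D g = truncate D x"
    by (simp add: g truncate_def pm_filter_add)
  ultimately show ?thesis
    using assms(1) g(2) by (metis homogeneous_ideal_def)
qed

text \<open>Moves a variable from the front of a regular sequence to its end, one
  \<open>nonzerodivisor_swap\<close> at a time. Homogeneity of the intermediate ideals supplies the
  intersection property.\<close>

lemma regular_mod_swap_var:
  assumes "ideal_in J" "homogeneous_ideal J" "v \<in> V" "nonzerodivisor_mod J (var v)"
    and "regular_mod (adjoin J (var v)) as" "set as \<subseteq> polys" "\<And>a. a \<in> set as \<Longrightarrow> \<exists>e. homogeneous e a"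
  shows "regular_mod J as \<and> nonzerodivisor_mod (foldl adjoin J as) (var v)"
  using assms
proof (induction as arbitrary: J)
  case (Cons a as)
  have sep: "g \<in> J" if "\<And>r. g \<in> adjoin J (var v ^ r)" for g
    using homogeneous_separated[OF Cons.prems(2) homogeneous_var[OF Cons.prems(3)] that] .
  have swap: "nonzerodivisor_mod J a" "nonzerodivisor_mod (adjoin J a) (var v)"
    using nonzerodivisor_swap[OF Cons.prems(1) var_C[OF Cons.prems(3)] _ Cons.prems(4) _ sep, of a]
      Cons.prems(5,6) by auto
  obtain e where "homogeneous e a" using Cons.prems(7) by auto
  then have "homogeneous_ideal (adjoin J a)"
    using homogeneous_ideal_adjoin Cons.prems(2) by blast
  then have "regular_mod (adjoin J a) as \<and> nonzerodivisor_mod (foldl adjoin (adjoin J a) as) (var v)"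
    using Cons.prems swap adjoin_commute[of J a "var v"] by (intro Cons.IH) (auto simp: ideal_adjoin)
  then show ?case using swap by simp
qed simp

section \<open>Monomial primes\<close>

text \<open>The leading term of a product is the product of the leading terms. The variable type
  carries no order, so exponent vectors over \<open>V\<close> are renamed to vectors over the
  naturals, whose order is compatible with addition.\<close>

lemma polys_no_zero_divisors:
  assumes "p \<in> polys" "q \<in> polys" "p * q = 0"
  shows "p = 0 \<or> q = 0"
proof (rule ccontr)
  assume nz: "\<not> (p = 0 \<or> q = 0)"
  obtain i :: "'v \<Rightarrow> nat" where inj: "inj_on i V"
    using finite_imp_inj_to_nat_seg[OF finite_V] by blast
  define f :: "('v \<Rightarrow>\<^sub>0 nat) \<Rightarrow> (nat \<Rightarrow>\<^sub>0 nat)"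
    where "f m = (\<Sum>v\<in>V. Poly_Mapping.single (i v) (Poly_Mapping.lookup m v))" for m
  have f_add: "f (a + b) = f a + f b" for a b
    by (simp add: f_def lookup_add single_add sum.distrib)
  have lookup_f: "Poly_Mapping.lookup (f m) (i v) = Poly_Mapping.lookup m v" if "v \<in> V" for m v
  proof -
    have "Poly_Mapping.lookup (f m) (i v) = (\<Sum>u\<in>V. if u = v then Poly_Mapping.lookup m u else 0)"
      using inj that by (auto simp: f_def lookup_sum lookup_single when_def inj_on_eq_iff intro!: sum.cong)
    then show ?thesis using that finite_V by simp
  qed
  have f_inj: "a = b" if "f a = f b" "Poly_Mapping.keys a \<subseteq> V" "Poly_Mapping.keys b \<subseteq> V" for a b
  proof (rule poly_mapping_eqI)
    fix v
    show "Poly_Mapping.lookup a v = Poly_Mapping.lookup b v"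
    proof (cases "v \<in> V")
      case True
      then show ?thesis using lookup_f[of v a] lookup_f[of v b] that(1) by simp
    next
      case False
      then show ?thesis using that(2,3) by (metis in_keys_iff subsetD)
    qed
  qed
  have lead: "\<exists>a\<in>Poly_Mapping.keys r. \<forall>b\<in>Poly_Mapping.keys r. b \<noteq> a \<longrightarrow> f b < f a"
    if "r \<in> polys" "r \<noteq> 0" for r
  proof -
    have ne: "Poly_Mapping.keys r \<noteq> {}" using that by simp
    define M where "M = Max (f ` Poly_Mapping.keys r)"
    have "M \<in> f ` Poly_Mapping.keys r" unfolding M_def using ne by (intro Max_in) auto
    then obtain a where a: "a \<in> Poly_Mapping.keys r" "f a = M" by auto
    have "f b < f a" if "b \<in> Poly_Mapping.keys r" "b \<noteq> a" for b
    proof -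
      have "f b \<le> f a" unfolding a(2) M_def using that by simp
      moreover have "f b \<noteq> f a"
        using f_inj[of b a] that a \<open>r \<in> polys\<close> by (auto simp: polys_def)
      ultimately show ?thesis by simp
    qed
    then show ?thesis using a by blast
  qed
  obtain a where a: "a \<in> Poly_Mapping.keys p" "\<And>b. b \<in> Poly_Mapping.keys p \<Longrightarrow> b \<noteq> a \<Longrightarrow> f b < f a"
    using lead[of p] assms nz by blast
  obtain b where b: "b \<in> Poly_Mapping.keys q" "\<And>c. c \<in> Poly_Mapping.keys q \<Longrightarrow> c \<noteq> b \<Longrightarrow> f c < f b"
    using lead[of q] assms nz by blast
  define sa where "sa = Poly_Mapping.single a (Poly_Mapping.lookup p a)"
  define p' where "p' = pm_filter (\<lambda>m. m \<noteq> a) p"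
  have p: "p = sa + p'"
    by (rule poly_mapping_eqI) (auto simp: sa_def p'_def lookup_add lookup_pm_filter lookup_single when_def)
  have le: "f c \<le> f b" if "c \<in> Poly_Mapping.keys q" for c
    using b(2)[OF that] by (cases "c = b") auto
  \<comment> \<open>Only the pair of leading monomials contributes to the coefficient at
    \<open>a + b\<close>.\<close>
  have "Poly_Mapping.lookup (p' * q) (a + b) = 0"
  proof (rule ccontr)
    assume "Poly_Mapping.lookup (p' * q) (a + b) \<noteq> 0"
    then have "a + b \<in> Poly_Mapping.keys (p' * q)" by (simp add: in_keys_iff)
    then obtain c d where cd: "c \<in> Poly_Mapping.keys p'" "d \<in> Poly_Mapping.keys q" "a + b = c + d"
      by (rule keys_mult_mpoly)
    then have "f c < f a" using a(2) by (auto simp: p'_def keys_pm_filter)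
    then have "f c + f d < f a + f b" using le[OF cd(2)] by (rule add_less_le_mono)
    then show False using arg_cong[OF cd(3), of f] by (simp add: f_add)
  qed
  moreover have "Poly_Mapping.lookup (sa * q) (a + b) = Poly_Mapping.lookup p a * Poly_Mapping.lookup q b"
    by (simp add: sa_def lookup_single_mult)
  moreover have "p * q = sa * q + p' * q"
    by (subst p) (simp add: algebra_simps)
  ultimately have "Poly_Mapping.lookup (p * q) (a + b) = Poly_Mapping.lookup p a * Poly_Mapping.lookup q b"
    by (simp add: lookup_add)
  then show False using assms(3) a(1) b(1) by (simp add: in_keys_iff)
qed

definition prime_in :: "('v, 'k) mpoly set \<Rightarrow> bool" where
  "prime_in P \<longleftrightarrow> ideal_in P \<and> 1 \<notin> P \<and> (\<forall>a\<in>polys. \<forall>b\<in>polys. a * b \<in> P \<longrightarrow> a \<in> P \<or> b \<in> P)"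

lemma mem_sr_ideal_Pow:
  "p \<in> sr_ideal (Pow F) \<longleftrightarrow> p \<in> polys \<and> pm_filter (\<lambda>m. Poly_Mapping.keys m \<subseteq> F) p = 0"
  by (auto simp: sr_ideal_def simp flip: keys_eq_empty simp: keys_pm_filter)

text \<open>The ideal is the kernel of setting the variables outside \<open>F\<close> to 0, a
  homomorphism by \<open>pm_filter_mult\<close> whose image has no zero divisors.\<close>

lemma prime_sr_ideal_Pow: "prime_in (sr_ideal (Pow F))"
  unfolding prime_in_def
proof (intro conjI ballI impI)
  fix a b assume ab: "a \<in> polys" "b \<in> polys" "a * b \<in> sr_ideal (Pow F)"
  let ?\<rho> = "pm_filter (\<lambda>m. Poly_Mapping.keys m \<subseteq> F) :: ('v, 'k) mpoly \<Rightarrow> _"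
  have "?\<rho> (a * b) = ?\<rho> a * ?\<rho> b"
    by (rule pm_filter_mult) (simp add: keys_plus_nat)
  then have "?\<rho> a = 0 \<or> ?\<rho> b = 0"
    using ab by (intro polys_no_zero_divisors) (auto simp: mem_sr_ideal_Pow pm_filter_C)
  then show "a \<in> sr_ideal (Pow F) \<or> b \<in> sr_ideal (Pow F)"
    using ab by (simp add: mem_sr_ideal_Pow)
qed (auto simp: ideal_sr_ideal down_closed_Pow, auto simp: sr_ideal_def)

lemma prime_nonzerodivisor: "prime_in P \<Longrightarrow> a \<in> polys \<Longrightarrow> a \<notin> P \<Longrightarrow> nonzerodivisor_mod P a"
  by (auto simp: prime_in_def nonzerodivisor_mod_def)

lemma var_notin_sr_ideal: "{v} \<in> \<Delta> \<Longrightarrow> var v \<notin> sr_ideal \<Delta>"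
  by (simp add: sr_ideal_def var_def)

lemma adjoin_sr_ideal_Pow:
  assumes "v \<in> V" "v \<in> F"
  shows "adjoin (sr_ideal (Pow F)) (var v) = sr_ideal (Pow (F - {v}))"
proof (intro equalityI subsetI)
  fix p assume "p \<in> adjoin (sr_ideal (Pow F)) (var v)"
  then obtain x r where p: "p = x + var v * r" "x \<in> sr_ideal (Pow F)" "r \<in> polys" by (rule adjoinE)
  have "x \<in> sr_ideal (Pow (F - {v}))" using p(2) by (auto simp: sr_ideal_def)
  moreover have "var v * r \<in> sr_ideal (Pow (F - {v}))"
    using var_mult_keys p(3) assms mult_C var_C by (fastforce simp: sr_ideal_def)
  ultimately show "p \<in> sr_ideal (Pow (F - {v}))"
    using p ideal_add ideal_sr_ideal down_closed_Pow by blast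
next
  fix p assume p: "p \<in> sr_ideal (Pow (F - {v}))"
  let ?P = "\<lambda>m. v \<notin> Poly_Mapping.keys m"
  have pC: "p \<in> polys" using p by (simp add: sr_ideal_def)
  have 1: "pm_filter ?P p \<in> sr_ideal (Pow F)"
    using p pm_filter_C by (fastforce simp: sr_ideal_def keys_pm_filter)
  obtain q where q: "pm_filter (\<lambda>m. \<not> ?P m) p = var v * q" "q \<in> polys"
    by (rule var_divides_C[OF pm_filter_C[OF pC], of "\<lambda>m. \<not> ?P m" v]) (auto simp: keys_pm_filter)
  show "p \<in> adjoin (sr_ideal (Pow F)) (var v)"
    using adjoinI[OF 1 q(2), of "var v"] pm_filter_split[of p ?P] q(1) by simp
qed

section \<open>Elementary symmetric polynomials\<close>

definition esym :: "nat \<Rightarrow> ('v, 'k) mpoly" where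
  "esym k = (\<Sum>F\<in>{F. F \<subseteq> V \<and> card F = k}. \<Prod>v\<in>F. var v)"

definition esyms :: "nat \<Rightarrow> ('v, 'k) mpoly list" where
  "esyms k = map (\<lambda>i. esym (Suc i)) [0..<k]"

lemma esyms_Suc: "esyms (Suc k) = esyms k @ [esym (Suc k)]"
  by (simp add: esyms_def)

lemma length_esyms [simp]: "length (esyms k) = k"
  by (simp add: esyms_def)

lemma prod_var: "finite F \<Longrightarrow> (\<Prod>v\<in>F. var v) = Poly_Mapping.single (\<Sum>v\<in>F. Poly_Mapping.single v 1) (1::'k)"
  by (induction F rule: finite_induct) (auto simp: var_def mult_single)

lemma keys_square_free: "finite F \<Longrightarrow> Poly_Mapping.keys (\<Sum>v\<in>F. Poly_Mapping.single v (1::nat)) = F"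
  by (induction F rule: finite_induct) (auto simp: keys_plus_nat)

lemma mdeg_square_free: "F \<subseteq> V \<Longrightarrow> mdeg (\<Sum>v\<in>F. Poly_Mapping.single v 1) = card F"
proof -
  assume F: "F \<subseteq> V"
  then have "finite F" using finite_V finite_subset by blast
  then have "mdeg (\<Sum>v\<in>F. Poly_Mapping.single v 1) = (\<Sum>u\<in>V. if u \<in> F then 1 else 0)"
    by (auto simp: mdeg_def lookup_sum lookup_single when_def intro!: sum.cong)
  then show ?thesis using F finite_V by (simp add: sum.If_cases Int_absorb1)
qed

lemma prod_var_C: "F \<subseteq> V \<Longrightarrow> (\<Prod>v\<in>F. var v) \<in> polys"
  by (intro prod_C var_C) auto

lemma esym_C: "esym k \<in> polys"
  unfolding esym_def by (intro sum_C prod_var_C) auto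

lemma esyms_C: "set (esyms k) \<subseteq> polys"
  by (auto simp: esyms_def esym_C)

lemma homogeneous_esym: "homogeneous k (esym k)"
  unfolding homogeneous_def
proof
  fix m assume "m \<in> Poly_Mapping.keys (esym k)"
  then obtain F where F: "F \<subseteq> V" "card F = k" "m \<in> Poly_Mapping.keys (\<Prod>v\<in>F. var v :: ('v, 'k) mpoly)"
    using keys_sum[of "\<lambda>F. \<Prod>v\<in>F. var v :: ('v, 'k) mpoly" "{F. F \<subseteq> V \<and> card F = k}"]
    unfolding esym_def by auto
  then have "finite F" using finite_V finite_subset by blast
  then have "m = (\<Sum>v\<in>F. Poly_Mapping.single v 1)"
    using F by (simp add: prod_var split: if_splits)
  then show "mdeg m = k" using mdeg_square_free F by simp
qed

lemma prod_var_mem_sr_ideal: "F \<subseteq> V \<Longrightarrow> F \<notin> \<Delta> \<Longrightarrow> (\<Prod>v\<in>F. var v) \<in> sr_ideal \<Delta>"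
  using prod_var_C[of F] finite_subset[OF _ finite_V, of F]
  by (auto simp: sr_ideal_def prod_var keys_square_free simp del: One_nat_def)

lemma nonzerodivisor_prod:
  assumes "\<And>v. v \<in> F \<Longrightarrow> f v \<in> polys \<and> nonzerodivisor_mod J (f v)"
  shows "nonzerodivisor_mod J (prod f F)"
  using assms
proof (induction F rule: infinite_finite_induct)
  case (insert v F)
  have F: "prod f F \<in> polys" using insert.prems by (intro prod_C) auto
  have nz: "nonzerodivisor_mod J (prod f F)" "nonzerodivisor_mod J (f v)"
    using insert.IH insert.prems by blast+
  show ?case
    unfolding nonzerodivisor_mod_def prod.insert[OF insert.hyps] mult.assoc
    using nonzerodivisor_modD[OF nz(1)] nonzerodivisor_modD[OF nz(2)] mult_C[OF F] by blast
qed (auto simp: nonzerodivisor_mod_def)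

lemma nonzerodivisor_cong:
  assumes "ideal_in J" "nonzerodivisor_mod J a" "b - a \<in> J"
  shows "nonzerodivisor_mod J b"
  unfolding nonzerodivisor_mod_def
proof (intro ballI impI)
  fix x assume x: "x \<in> polys" "b * x \<in> J"
  have "a * x = b * x - (b - a) * x" by (simp add: algebra_simps)
  also have "\<dots> \<in> J" using assms x ideal_diff ideal_mult_right by blast
  finally show "x \<in> J" using assms(2) x nonzerodivisor_modD by blast
qed

text \<open>Modulo the prime of the face \<open>F\<close>, the last element is the product of the variables in \<open>F\<close>,
  and each of these can be moved to the front of the sequence, where it reduces \<open>F\<close> to a smaller
  face.\<close>

lemma regular_mod_esyms_face:
  assumes "F \<subseteq> V"
  shows "regular_mod (sr_ideal (Pow F)) (esyms (card F))"
  using assms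
proof (induction "card F" arbitrary: F)
  case 0
  then show ?case by (simp add: esyms_def)
next
  case (Suc n)
  let ?J = "sr_ideal (Pow F)"
  have finF: "finite F" using Suc.prems finite_V finite_subset by blast
  have J: "ideal_in ?J" by (simp add: ideal_sr_ideal down_closed_Pow)
  have swap: "regular_mod ?J (esyms n) \<and> nonzerodivisor_mod (foldl adjoin ?J (esyms n)) (var v)"
    if v: "v \<in> F" for v
  proof (rule regular_mod_swap_var)
    show "nonzerodivisor_mod ?J (var v)"
      using v Suc.prems var_notin_sr_ideal var_C by (intro prime_nonzerodivisor prime_sr_ideal_Pow) auto
    have "card (F - {v}) = n" using Suc.hyps(2) v finF by simp
    then have "regular_mod (sr_ideal (Pow (F - {v}))) (esyms n)"
      using Suc.hyps(1)[of "F - {v}"] Suc.prems by auto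
    then show "regular_mod (adjoin ?J (var v)) (esyms n)"
      using adjoin_sr_ideal_Pow[of v F] v Suc.prems by auto
  qed (use v Suc.prems J in \<open>auto simp: homogeneous_sr_ideal esyms_def esym_C intro: homogeneous_esym\<close>)
  have ne: "F \<noteq> {}" using Suc.hyps(2) by auto
  define J' where "J' = foldl adjoin ?J (esyms n)"
  have J': "ideal_in J'" unfolding J'_def by (rule ideal_foldl_adjoin[OF J esyms_C])
  have sub: "?J \<subseteq> J'" unfolding J'_def by (rule subset_foldl_adjoin)
  let ?S = "{F'. F' \<subseteq> V \<and> card F' = Suc n}"
  \<comment> \<open>Any other \<open>F'\<close> of the same size is not contained in
    \<open>F\<close>, so its monomial already lies in the ideal of \<open>F\<close>.\<close>
  have "esym (Suc n) - (\<Prod>v\<in>F. var v) = (\<Sum>F'\<in>?S - {F}. \<Prod>v\<in>F'. var v)"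
    unfolding esym_def using Suc finite_V by (subst sum.remove[of _ F]) auto
  also have "\<dots> \<in> ?J"
  proof (rule ideal_sum[OF J])
    fix F' assume F': "F' \<in> ?S - {F}"
    then have "\<not> F' \<subseteq> F" using card_subset_eq[OF finF, of F'] Suc.hyps(2) by auto
    then show "(\<Prod>v\<in>F'. var v) \<in> ?J" using prod_var_mem_sr_ideal[of F' "Pow F"] F' by auto
  qed
  finally have "esym (Suc n) - (\<Prod>v\<in>F. var v) \<in> J'" using sub by blast
  moreover have "nonzerodivisor_mod J' (\<Prod>v\<in>F. var v)"
    using swap Suc.prems var_C by (intro nonzerodivisor_prod) (auto simp: J'_def)
  ultimately have "nonzerodivisor_mod J' (esym (Suc n))"
    using nonzerodivisor_cong[OF J'] by blast
  then show ?case
    using swap ne unfolding Suc.hyps(2)[symmetric] esyms_Suc regular_mod_append J'_def by auto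
qed

lemma regular_mod_esyms_face_le:
  assumes "F \<subseteq> V" "k \<le> card F"
  shows "regular_mod (sr_ideal (Pow F)) (esyms k)"
proof -
  have "esyms (card F) = esyms k @ map (\<lambda>i. esym (Suc i)) [k..<card F]"
    using upt_add_eq_append[of 0 k "card F - k"] assms(2) by (simp add: esyms_def)
  then show ?thesis
    using regular_mod_esyms_face[OF assms(1)] by (simp add: regular_mod_append)
qed

end

section \<open>Depth of a chordal clique complex\<close>

context poly_vars
begin

section \<open>The irrelevant ideal and upper bounds from Koszul classes\<close>

definition irrelevant :: "('v, 'k) mpoly set" where
  "irrelevant = {p \<in> polys. Poly_Mapping.lookup p 0 = 0}"

text \<open>Each monomial is charged to the first variable of \<open>vs\<close> that divides it. The
  coefficients obtained are those that \<open>koszul_vanishing\<close> asks for.\<close>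

lemma irrelevant_combination:
  assumes "p \<in> polys" and "\<And>m. m \<in> Poly_Mapping.keys p \<Longrightarrow> Poly_Mapping.keys m \<inter> set vs \<noteq> {}"
  shows "\<exists>cs. length cs = length vs \<and> set cs \<subseteq> polys \<and>
    p = (\<Sum>(c, x) \<leftarrow> zip cs (map var vs). c * x)"
  using assms
proof (induction vs arbitrary: p)
  case Nil
  have "m \<notin> Poly_Mapping.keys p" for m using Nil.prems(2)[of m] by auto
  then have "Poly_Mapping.keys p = {}" by blast
  then show ?case by simp
next
  case (Cons v vs)
  let ?P = "\<lambda>m. v \<in> Poly_Mapping.keys m"
  obtain q where q: "pm_filter ?P p = var v * q" "q \<in> polys"
    by (rule var_divides_C[OF pm_filter_C[OF Cons.prems(1)], of ?P v]) (auto simp: keys_pm_filter)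
  have "\<exists>cs. length cs = length vs \<and> set cs \<subseteq> polys \<and>
      pm_filter (\<lambda>m. \<not> ?P m) p = (\<Sum>(c, x) \<leftarrow> zip cs (map var vs). c * x)"
  proof (rule Cons.IH)
    fix m assume "m \<in> Poly_Mapping.keys (pm_filter (\<lambda>m. \<not> ?P m) p)"
    then have "m \<in> Poly_Mapping.keys p" "v \<notin> Poly_Mapping.keys m" by (auto simp: keys_pm_filter)
    then show "Poly_Mapping.keys m \<inter> set vs \<noteq> {}" using Cons.prems(2)[of m] by auto
  qed (rule pm_filter_C[OF Cons.prems(1)])
  then obtain cs where cs: "length cs = length vs" "set cs \<subseteq> polys"
    "pm_filter (\<lambda>m. \<not> ?P m) p = (\<Sum>(c, x) \<leftarrow> zip cs (map var vs). c * x)" by blast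
  have "p = q * var v + (\<Sum>(c, x) \<leftarrow> zip cs (map var vs). c * x)"
    using pm_filter_split[of p ?P] q(1) cs(3) by (simp add: mult.commute)
  then show ?case
    using cs(1,2) q(2) by (intro exI[of _ "q # cs"]) simp
qed

lemma irrelevant_combination_all:
  assumes "p \<in> irrelevant" "set vs = V"
  shows "\<exists>cs. length cs = length vs \<and> set cs \<subseteq> polys \<and>
    p = (\<Sum>(c, x) \<leftarrow> zip cs (map var vs). c * x)"
proof (rule irrelevant_combination)
  fix m assume m: "m \<in> Poly_Mapping.keys p"
  then have "m \<noteq> 0" using assms(1) by (auto simp: irrelevant_def in_keys_iff)
  then have "Poly_Mapping.keys m \<noteq> {}" by simp
  moreover have "Poly_Mapping.keys m \<subseteq> V" using m assms(1) by (auto simp: irrelevant_def polys_def)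
  ultimately show "Poly_Mapping.keys m \<inter> set vs \<noteq> {}" using assms(2) by blast
qed (use assms in \<open>simp add: irrelevant_def\<close>)

lemma koszul_vanishing_vars:
  assumes "ideal_in J" "regular_mod J as" "set as \<subseteq> irrelevant" "set vs = V"
    and "\<And>bs. z bs \<in> polys" "\<And>bs. z bs \<noteq> 0 \<Longrightarrow> count_list bs True = p" "p < length as"
    and "\<And>bs. length bs = length vs \<Longrightarrow> koszul (map var vs) z bs \<in> J"
  shows "\<exists>w. (\<forall>bs. w bs \<in> polys) \<and>
    (\<forall>bs. length bs = length vs \<longrightarrow> z bs - koszul (map var vs) w bs \<in> J)"
proof -
  have "\<exists>cs. length cs = length (map var vs) \<and> set cs \<subseteq> polys \<and>
      a = (\<Sum>(c, x) \<leftarrow> zip cs (map var vs). c * x)" if "a \<in> set as" for a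
    using irrelevant_combination_all[of a vs] that assms(3,4) by auto
  moreover have "set (map var vs) \<subseteq> polys" using assms(4) var_C by auto
  ultimately show ?thesis
    using koszul_vanishing[OF assms(1,2), of "map var vs" z p] assms(5-8) by simp
qed

text \<open>A multiple of a variable that does not divide \<open>m\<close> has no term in
  \<open>m\<close>. The coefficient at \<open>m\<close> can therefore certify nonmembership.\<close>

lemma coefficient_adjoin_vars:
  assumes "\<And>p. p \<in> J \<Longrightarrow> Poly_Mapping.lookup p m = 0" "set vs \<inter> Poly_Mapping.keys m = {}"
    and "p \<in> foldl adjoin J (map var vs)"
  shows "Poly_Mapping.lookup p m = 0"
  using assms
proof (induction vs arbitrary: J)
  case (Cons v vs)
  have "Poly_Mapping.lookup p m = 0" if p: "p \<in> adjoin J (var v)" for p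
  proof -
    obtain x r where r: "p = x + var v * r" "x \<in> J" using p by (rule adjoinE)
    have "Poly_Mapping.lookup (var v * r) m = 0"
      using var_mult_keys[of m v r] Cons.prems(2) by (auto simp: in_keys_iff)
    then show ?thesis using Cons.prems(1) r by (simp add: lookup_add)
  qed
  then show ?case using Cons.IH[of "adjoin J (var v)"] Cons.prems by simp
qed simp

text \<open>The top form in all variables is a cocycle. A primitive would, by
  \<open>koszul_remove_prefix\<close>, put 1 into the ideal generated by
  \<open>sr_ideal \<Delta>\<close> and the variables, which its constant coefficient forbids. The
  bound serves the case where the smallest facet is all of \<open>V\<close>.\<close>

lemma regular_length_le_card:
  assumes \<Delta>: "down_closed \<Delta>" "{} \<in> \<Delta>" and reg: "regular_mod (sr_ideal \<Delta>) as" "set as \<subseteq> irrelevant"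
  shows "length as \<le> card V"
proof (rule ccontr)
  assume "\<not> length as \<le> card V"
  obtain vs where vs: "set vs = V" "distinct vs" using finite_distinct_list[OF finite_V] by blast
  then have len: "length vs < length as" using \<open>\<not> _\<close> distinct_card by fastforce
  define f :: "bool list \<Rightarrow> ('v, 'k) mpoly" where "f bs = (if bs = [] then 1 else 0)" for bs
  have fdeg: "count_list bs True = 0" if "f bs \<noteq> 0" for bs
    using that by (simp add: f_def split: if_splits)
  have J: "ideal_in (sr_ideal \<Delta>)" by (rule ideal_sr_ideal[OF \<Delta>(1)])
  have "\<exists>w. (\<forall>bs. w bs \<in> polys) \<and> (\<forall>bs. length bs = length vs \<longrightarrow>
      wedge_prefix (length vs) f bs - koszul (map var vs) w bs \<in> sr_ideal \<Delta>)"
  proof (rule koszul_vanishing_vars[OF J reg vs(1) _ _ len])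
    show "wedge_prefix (length vs) f bs \<in> polys" for bs
      by (rule wedge_prefix_C) (simp add: f_def zero_C one_C)
    show "count_list bs True = length vs" if "wedge_prefix (length vs) f bs \<noteq> 0" for bs
      using wedge_prefix_degree[of f 0, OF fdeg that] by simp
    show "koszul (map var vs) (wedge_prefix (length vs) f) bs \<in> sr_ideal \<Delta>"
      if "length bs = length vs" for bs
      using koszul_wedge_prefix[OF J, of "[]" f bs "map var vs"] that ideal_zero[OF J] by simp
  qed
  then obtain w where w: "\<And>bs. w bs \<in> polys"
    "\<And>bs. length bs = length vs \<Longrightarrow>
      wedge_prefix (length vs) f bs - koszul (map var vs) w bs \<in> sr_ideal \<Delta>" by blast
  have "set (map var vs) \<subseteq> polys" using vs var_C by auto
  then obtain w' where "f [] - koszul [] w' [] \<in> foldl adjoin (sr_ideal \<Delta>) (map var vs)"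
    using koszul_remove_prefix[of "map var vs" "[]" f w "sr_ideal \<Delta>"] w J by auto
  then have "1 \<in> foldl adjoin (sr_ideal \<Delta>) (map var vs)" by (simp add: f_def)
  moreover have "Poly_Mapping.lookup p 0 = 0" if "p \<in> sr_ideal \<Delta>" for p
    using that \<Delta>(2) by (force simp: sr_ideal_def in_keys_iff)
  ultimately have "Poly_Mapping.lookup (1 :: ('v, 'k) mpoly) 0 = 0"
    by (rule coefficient_adjoin_vars[rotated 2]) simp_all
  then show False by simp
qed

lemma ideal_irrelevant: "ideal_in irrelevant"
proof (rule ideal_inI)
  fix r x :: "('v, 'k) mpoly" assume rx: "r \<in> polys" "x \<in> irrelevant"
  have "Poly_Mapping.lookup (r * x) 0 = 0"
  proof (rule ccontr)
    assume "Poly_Mapping.lookup (r * x) 0 \<noteq> 0"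
    then have "0 \<in> Poly_Mapping.keys (r * x)" by (simp add: in_keys_iff)
    then obtain a b where ab: "a \<in> Poly_Mapping.keys r" "b \<in> Poly_Mapping.keys x" "0 = a + b"
      by (rule keys_mult_mpoly)
    have "Poly_Mapping.keys (a + b) = {}" by (simp flip: ab(3))
    then have "b = 0" unfolding keys_plus_nat by simp
    then show False using ab(2) rx(2) by (simp add: irrelevant_def in_keys_iff)
  qed
  then show "r * x \<in> irrelevant" using rx mult_C by (simp add: irrelevant_def)
qed (auto simp: irrelevant_def zero_C add_C lookup_add)

lemma esyms_irrelevant: "set (esyms k) \<subseteq> irrelevant"
proof
  fix p assume "p \<in> set (esyms k)"
  then obtain i where i: "p = esym (Suc i)" by (auto simp: esyms_def)
  have "mdeg 0 = 0" by (simp add: mdeg_def)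
  then have "0 \<notin> Poly_Mapping.keys (esym (Suc i))"
    using homogeneous_esym[of "Suc i"] by (metis homogeneous_def nat.distinct(1))
  then show "p \<in> irrelevant" using i esym_C by (simp add: irrelevant_def in_keys_iff)
qed

end

locale poly_graph = poly_vars V K + sym_relation E
  for V :: "'v set" and K :: "'k::field itself" and E :: "'v \<Rightarrow> 'v \<Rightarrow> bool"
begin

lemma down_closed_clique_complex: "down_closed (clique_complex W)"
  using clique_subset by (auto simp: down_closed_def clique_complex_def)

lemma ideal_clique_complex: "ideal_in (sr_ideal (clique_complex W))"
  by (rule ideal_sr_ideal[OF down_closed_clique_complex])

lemma clique_complex_clique: "clique W \<Longrightarrow> clique_complex W = Pow W"
  using clique_subset by (auto simp: clique_complex_def)

lemma clique_complex_glue: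
  assumes "separation W S A B" "clique S"
  shows "clique_complex W = clique_complex (S \<union> A) \<union> clique_complex (S \<union> B)"
    and "clique_complex (S \<union> A) \<inter> clique_complex (S \<union> B) = Pow S"
proof -
  note sep = separationD[OF assms(1)]
  show "clique_complex W = clique_complex (S \<union> A) \<union> clique_complex (S \<union> B)"
  proof (intro equalityI subsetI)
    fix K assume "K \<in> clique_complex W"
    then show "K \<in> clique_complex (S \<union> A) \<union> clique_complex (S \<union> B)"
      using clique_in_part[OF assms(1), of K] by (simp add: clique_complex_def)
  qed (auto simp: clique_complex_def sep(1))
  have "(S \<union> A) \<inter> (S \<union> B) = S" using sep(4) by blast
  then show "clique_complex (S \<union> A) \<inter> clique_complex (S \<union> B) = Pow S"
    using clique_subset[OF assms(2)] unfolding clique_complex_def by blast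
qed

lemma regular_mod_esyms:
  assumes "decomposable W" "W \<subseteq> V" "connectivity_ge k W"
  shows "regular_mod (sr_ideal (clique_complex W)) (esyms k)"
  using assms
proof (induction rule: decomposable.induct)
  case (clique W)
  then show ?case
    using regular_mod_esyms_face_le by (simp add: clique_complex_clique connectivity_ge_def)
next
  case (glue W S A B)
  note sep = glue.hyps(1) and clS = glue.hyps(2)
  have fin: "finite W" using glue.prems(1) finite_V finite_subset by blast
  have sub: "S \<subseteq> V" "S \<union> A \<subseteq> V" "S \<union> B \<subseteq> V"
    using separationD(1)[OF sep] glue.prems(1) by blast+
  have "regular_mod (sr_ideal (clique_complex (S \<union> A)) \<inter> sr_ideal (clique_complex (S \<union> B))) (esyms k)"
  proof (rule regular_mod_inter)
    show "regular_mod (sr_ideal (clique_complex (S \<union> A))) (esyms k)"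
      using glue.IH(1) sub connectivity_ge_part[OF sep clS fin glue.prems(2)] by blast
    show "regular_mod (sr_ideal (clique_complex (S \<union> B))) (esyms k)"
      using glue.IH(2) sub connectivity_ge_part[OF separation_commute[OF sep] clS fin glue.prems(2)]
      by blast
    have "k \<le> Suc (card S)" using glue.prems(2) sep by (auto simp: connectivity_ge_def)
    then have "k - 1 \<le> card S" by simp
    moreover have "butlast (esyms k) = esyms (k - 1)"
      by (cases k) (simp_all add: esyms_Suc, simp add: esyms_def)
    ultimately show "regular_mod (ideal_plus (sr_ideal (clique_complex (S \<union> A)))
        (sr_ideal (clique_complex (S \<union> B)))) (butlast (esyms k))"
      unfolding sr_ideal_plus clique_complex_glue(2)[OF sep clS]
      using regular_mod_esyms_face_le[OF sub(1)] by simp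
  qed (simp_all add: ideal_clique_complex esyms_C)
  then show ?case by (simp add: clique_complex_glue(1)[OF sep clS] sr_ideal_inter)
qed

text \<open>The Koszul class \<open>e_S \<and> (\<Sum>\<^sub>a\<^sub>\<in>\<^sub>A x\<^sub>a e\<^sub>a)\<close>, where \<open>S\<close> separates \<open>A\<close> from \<open>B\<close>, is nonzero in
  degree \<open>card S + 1\<close>: a primitive would have constant coefficient \<open>1\<close> by comparison at \<open>A\<close>, and \<open>0\<close>
  by comparison at \<open>B\<close>.\<close>

lemma regular_length_le_separation:
  assumes sep: "separation V S A B"
    and reg: "regular_mod (sr_ideal (clique_complex V)) as" "set as \<subseteq> irrelevant"
  shows "length as \<le> Suc (card S)"
proof (rule ccontr)
  assume neg: "\<not> length as \<le> Suc (card S)"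
  note V = separationD[OF sep]
  have sub: "S \<subseteq> V" "A \<subseteq> V" "B \<subseteq> V" using V(1) by blast+
  let ?J = "sr_ideal (clique_complex V)"
  have J: "ideal_in ?J" by (rule ideal_clique_complex)
  have fins: "finite S" "finite (A \<union> B)" using sub finite_V by (auto intro: finite_subset)
  obtain ss where ss: "set ss = S" "distinct ss" using finite_distinct_list[OF fins(1)] by blast
  obtain us where us: "set us = A \<union> B" using finite_list[OF fins(2)] by blast
  have vs: "set (ss @ us) = V" using ss us V(1) by auto
  have len: "Suc (length ss) < length as" using neg ss distinct_card[of ss] by simp
  \<comment> \<open>Splitting each variable into its \<open>A\<close>-part and the rest splits the
    differential into a sum; \<open>f\<close> is the coboundary of the constant 1 for the
    \<open>A\<close>-part alone.\<close>
  define ya :: "'v \<Rightarrow> ('v, 'k) mpoly" where "ya v = (if v \<in> A then var v else 0)" for v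
  define yb :: "'v \<Rightarrow> ('v, 'k) mpoly" where "yb v = (if v \<in> A then 0 else var v)" for v
  define \<delta> :: "bool list \<Rightarrow> ('v, 'k) mpoly" where "\<delta> bs = (if True \<in> set bs then 0 else 1)" for bs
  define f where "f = koszul (map ya us) \<delta>"
  have ysum: "map var us = map (\<lambda>v. ya v + yb v) us" by (simp add: ya_def yb_def)
  have yaC: "set (map ya us) \<subseteq> polys" using us sub by (auto simp: ya_def zero_C intro: var_C)
  have fC: "f bs \<in> polys" for bs
    unfolding f_def using yaC
    by (intro koszul_mem[OF ideal_C]) (auto simp: \<delta>_def zero_C one_C)
  have fdeg: "count_list bs True = Suc 0" if "f bs \<noteq> 0" for bs
    using that unfolding f_def
    by (rule koszul_degree[rotated]) (auto simp: \<delta>_def count_list_0_iff split: if_splits)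
  have prod: "yb v * f cs \<in> ?J" if v: "v \<in> set us" for v cs
  proof (cases "v \<in> A")
    case False
    then have vB: "v \<in> B" using v us by blast
    \<comment> \<open>The colon ideal of \<open>?J\<close> by a variable of \<open>B\<close>. It
      contains the variables of \<open>A\<close>, because no \<open>{v, u}\<close> with
      \<open>u\<close> in \<open>A\<close> is a clique.\<close>
    define Q where "Q = {p \<in> polys. var v * p \<in> ?J}"
    have vC: "var v \<in> polys" using vB sub by (auto intro: var_C)
    have Q: "ideal_in Q"
      using J by (intro ideal_inI)
        (auto simp: Q_def zero_C add_C mult_C ideal_zero distrib_left ideal_add mult.left_commute ideal_mult)
    have "var u * \<delta> ds \<in> Q" if u: "u \<in> A" for u ds
    proof -
      have uv: "{v, u} \<subseteq> V" "{v, u} \<notin> clique_complex V" "u \<noteq> v"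
        using u vB sub V(4) V(7)[OF u vB] by (auto simp: clique_complex_def clique_def)
      have "var v * var u \<in> ?J"
        using prod_var_mem_sr_ideal[OF uv(1,2)] uv(3) by simp
      moreover have "var u \<in> polys" using u sub by (auto intro: var_C)
      ultimately show ?thesis by (auto simp: Q_def \<delta>_def zero_C ideal_zero[OF J])
    qed
    then have "f cs \<in> Q"
      unfolding f_def using us by (intro koszul_mem_products[OF Q]) (auto simp: ya_def ideal_zero[OF Q])
    then show ?thesis using False by (simp add: Q_def yb_def)
  qed (simp add: yb_def ideal_zero[OF J])
  \<comment> \<open>The \<open>A\<close>-part of the differential, applied twice, gives 0; the other
    part lands in \<open>?J\<close> by \<open>prod\<close>.\<close>
  have cocycle: "koszul (map var us) f bs \<in> ?J" for bs
  proof -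
    have "koszul (map var us) f bs = koszul (map yb us) f bs"
      unfolding ysum koszul_map_add by (simp add: f_def koszul_square)
    also have "\<dots> \<in> ?J" using prod by (intro koszul_mem_products[OF J]) auto
    finally show ?thesis .
  qed
  have "\<exists>w. (\<forall>bs. w bs \<in> polys) \<and> (\<forall>bs. length bs = length (ss @ us) \<longrightarrow>
      wedge_prefix (length ss) f bs - koszul (map var (ss @ us)) w bs \<in> ?J)"
  proof (rule koszul_vanishing_vars[OF J reg vs _ _ len])
    show "wedge_prefix (length ss) f bs \<in> polys" for bs
      by (rule wedge_prefix_C[OF fC])
    show "count_list bs True = Suc (length ss)" if "wedge_prefix (length ss) f bs \<noteq> 0" for bs
      using wedge_prefix_degree[of f "Suc 0", OF fdeg that] by simp
    show "koszul (map var (ss @ us)) (wedge_prefix (length ss) f) bs \<in> ?J"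
      if "length bs = length (ss @ us)" for bs
      using koszul_wedge_prefix[OF J, of "map var us" f bs "map var ss"] cocycle that by simp
  qed
  then obtain w where w: "\<And>bs. w bs \<in> polys"
    "\<And>bs. length bs = length (ss @ us) \<Longrightarrow>
      wedge_prefix (length ss) f bs - koszul (map var (ss @ us)) w bs \<in> ?J" by blast
  define J' where "J' = foldl adjoin ?J (map var ss)"
  have "set (map var ss) \<subseteq> polys" using vs var_C by auto
  then obtain w' where w':
    "\<And>bs. length bs = length us \<Longrightarrow> f bs - koszul (map var us) w' bs \<in> J'"
    using koszul_remove_prefix[of "map var ss" "map var us" f w ?J] w J unfolding J'_def by auto
  define g where "g = w' (replicate (length us) False)"
  \<comment> \<open>A single vertex is a face, and \<open>v\<close> lies outside \<open>S\<close>,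
    so the coefficient of this variable is still well defined modulo the variables of
    \<open>S\<close>.\<close>
  have J'0: "Poly_Mapping.lookup p (Poly_Mapping.single v 1) = 0" if v: "v \<in> A \<union> B" and p: "p \<in> J'" for v p
  proof (rule coefficient_adjoin_vars[OF _ _ p[unfolded J'_def]])
    have "{v} \<in> clique_complex V" using v sub by (auto simp: clique_complex_def clique_def)
    then show "Poly_Mapping.lookup p (Poly_Mapping.single v 1) = 0" if "p \<in> ?J" for p
      using that by (force simp: sr_ideal_def in_keys_iff)
    show "set ss \<inter> Poly_Mapping.keys (Poly_Mapping.single v (1::nat)) = {}"
      using ss v V(2,3) by auto
  qed
  have key: "Poly_Mapping.lookup (ya v - var v * g) (Poly_Mapping.single v 1) = 0" if v: "v \<in> A \<union> B" for v
  proof -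
    obtain i where i: "i < length us" "us ! i = v" using v us by (metis in_set_conv_nth)
    let ?bs = "(replicate (length us) False)[i := True]"
    have "f ?bs = ya v"
      using koszul_one_hot[of i "map ya us" \<delta>] i by (simp add: f_def \<delta>_def)
    moreover have "koszul (map var us) w' ?bs = var v * g"
      using koszul_one_hot[of i "map var us" w'] i by (simp add: g_def)
    ultimately show ?thesis using w'[of ?bs] J'0[OF v] by simp
  qed
  obtain a b where ab: "a \<in> A" "b \<in> B" using V(5,6) by blast
  have "b \<notin> A" using ab V(4) by blast
  have coef: "Poly_Mapping.lookup (var v * g) (Poly_Mapping.single v 1) = Poly_Mapping.lookup g 0" for v
    using lookup_var_mult[of v g 0] by simp
  have "Poly_Mapping.lookup g 0 = 1"
    using key[of a] ab coef[of a] by (simp add: ya_def lookup_minus var_def)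
  moreover have "Poly_Mapping.lookup g 0 = 0"
    using key[of b] ab(2) \<open>b \<notin> A\<close> coef[of b] by (simp add: ya_def lookup_minus)
  ultimately show False by simp
qed

end

section \<open>Krull dimension of polynomial rings\<close>

definition const :: "'k::field \<Rightarrow> ('v, 'k) mpoly" where
  "const c = Poly_Mapping.single 0 c"

fun power_product :: "'a::comm_monoid_mult list \<Rightarrow> nat list \<Rightarrow> 'a" where
  "power_product (y # ys) (a # as) = y ^ a * power_product ys as"
| "power_product _ _ = 1"

interpretation mpoly_space: vector_space "\<lambda>(c::'k::field) (p::('v, 'k) mpoly). const c * p"
  by unfold_locales (auto simp: const_def algebra_simps single_add mult_single)

lemma const_1: "const 1 = (1 :: ('v, 'k::field) mpoly)"
  by (simp add: const_def)

lemma const_uminus: "const (- c) = - (const c :: ('v, 'k::field) mpoly)"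
  by (simp add: const_def single_uminus)

section \<open>Algebraic dependence by counting monomials\<close>

text \<open>Bounds each exponent separately instead of the total degree, so that the monomials fill
  a box and are easily counted.\<close>

definition bounded_degrees :: "nat \<Rightarrow> ('v, 'k::field) mpoly \<Rightarrow> bool" where
  "bounded_degrees b p \<longleftrightarrow> (\<forall>m\<in>Poly_Mapping.keys p. \<forall>v. Poly_Mapping.lookup m v \<le> b)"

lemma bounded_degrees_mult:
  assumes "bounded_degrees a p" "bounded_degrees b q"
  shows "bounded_degrees (a + b) (p * q)"
  unfolding bounded_degrees_def
proof (intro ballI allI)
  fix m v assume "m \<in> Poly_Mapping.keys (p * q)"
  then obtain c d where "c \<in> Poly_Mapping.keys p" "d \<in> Poly_Mapping.keys q" "m = c + d"
    by (rule keys_mult_mpoly)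
  then show "Poly_Mapping.lookup m v \<le> a + b"
    using assms by (auto simp: bounded_degrees_def lookup_add intro!: add_mono)
qed

lemma bounded_degrees_1: "bounded_degrees 0 1"
  by (simp add: bounded_degrees_def)

lemma bounded_degrees_power: "bounded_degrees b p \<Longrightarrow> bounded_degrees (n * b) (p ^ n)"
  by (induction n) (auto simp: bounded_degrees_1 intro: bounded_degrees_mult)

lemma bounded_degrees_mono: "bounded_degrees a p \<Longrightarrow> a \<le> b \<Longrightarrow> bounded_degrees b p"
  unfolding bounded_degrees_def by (meson le_trans)

lemma bounded_degrees_power_product:
  assumes "\<And>y. y \<in> set ys \<Longrightarrow> bounded_degrees b y" "set as \<subseteq> {..<N}"
  shows "bounded_degrees (length ys * (N * b)) (power_product ys as)"
  using assms
proof (induction ys as rule: power_product.induct)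
  case (1 y ys a as)
  have "bounded_degrees (a * b) (y ^ a)" using 1 by (simp add: bounded_degrees_power)
  then have "bounded_degrees (N * b) (y ^ a)"
    using 1(3) by (auto intro: bounded_degrees_mono)
  then show ?case using 1 bounded_degrees_mult by fastforce
qed (auto intro: bounded_degrees_mono[OF bounded_degrees_1])

lemma exists_bounded_degrees: "\<exists>b. \<forall>y\<in>set ys. bounded_degrees b (y :: ('v, 'k::field) mpoly)"
proof (induction ys)
  case (Cons y ys)
  then obtain b where b: "\<forall>y\<in>set ys. bounded_degrees b y" by blast
  define M where "M = (\<Union>m\<in>Poly_Mapping.keys y. Poly_Mapping.range m)"
  have M: "finite M" by (simp add: M_def)
  define a where "a = Max (insert 0 M)"
  have "Poly_Mapping.lookup m v \<le> a" if "m \<in> Poly_Mapping.keys y" for m v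
  proof (cases "v \<in> Poly_Mapping.keys m")
    case True
    then have "Poly_Mapping.lookup m v \<in> M"
      unfolding M_def by (intro UN_I[OF that] in_keys_lookup_in_range)
    then show ?thesis using M by (simp add: a_def)
  qed (simp add: in_keys_iff)
  then have "bounded_degrees a y" by (simp add: bounded_degrees_def)
  then have "\<forall>y\<in>set (y # ys). bounded_degrees (max a b) y"
    using b by (auto intro: bounded_degrees_mono)
  then show ?case by blast
qed simp

definition bounded_monomials :: "'v set \<Rightarrow> nat \<Rightarrow> ('v \<Rightarrow>\<^sub>0 nat) set" where
  "bounded_monomials F b = {m. Poly_Mapping.keys m \<subseteq> F \<and> (\<forall>v. Poly_Mapping.lookup m v \<le> b)}"

lemma card_bounded_monomials:
  assumes "finite F"
  shows "finite (bounded_monomials F b)" "card (bounded_monomials F b) \<le> Suc b ^ card F"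
proof -
  let ?f = "\<lambda>m. restrict (Poly_Mapping.lookup m) F"
  let ?T = "PiE F (\<lambda>_. {..b})"
  have sub: "?f ` bounded_monomials F b \<subseteq> ?T"
    by (auto simp: bounded_monomials_def)
  have fin: "finite ?T" using assms by (intro finite_PiE) auto
  have inj: "inj_on ?f (bounded_monomials F b)"
  proof (rule inj_onI, rule poly_mapping_eqI)
    fix m n v
    assume mn: "m \<in> bounded_monomials F b" "n \<in> bounded_monomials F b" "?f m = ?f n"
    show "Poly_Mapping.lookup m v = Poly_Mapping.lookup n v"
    proof (cases "v \<in> F")
      case True
      then show ?thesis using fun_cong[OF mn(3), of v] by simp
    next
      case False
      then have "v \<notin> Poly_Mapping.keys m" "v \<notin> Poly_Mapping.keys n"
        using mn(1,2) by (auto simp: bounded_monomials_def)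
      then show ?thesis by (simp add: in_keys_iff)
    qed
  qed
  show "finite (bounded_monomials F b)"
    using inj_on_finite[OF inj sub fin] .
  have "card (bounded_monomials F b) \<le> card ?T"
    using card_inj_on_le[OF inj sub fin] .
  also have "\<dots> = Suc b ^ card F" using assms by (simp add: card_PiE)
  finally show "card (bounded_monomials F b) \<le> Suc b ^ card F" .
qed

lemma exists_counting_bound: "\<exists>N::nat. Suc (N * c) ^ m < N ^ Suc m"
proof -
  \<comment> \<open>As \<open>N\<close> is positive, \<open>Suc (N * c)\<close> is at most
    \<open>N * Suc c\<close>. The power of the latter is \<open>Suc c ^ m * N ^ m\<close>, and
    \<open>N\<close> is one more than the first factor.\<close>
  define N where "N = Suc (Suc c ^ m)"
  have "Suc (N * c) \<le> N * Suc c" by (simp add: N_def)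
  then have "Suc (N * c) ^ m \<le> (N * Suc c) ^ m" by (rule power_mono) simp
  also have "\<dots> = Suc c ^ m * N ^ m" by (simp only: power_mult_distrib mult.commute)
  also have "\<dots> < N * N ^ m" by (simp add: N_def)
  finally show ?thesis by auto
qed

text \<open>More than \<open>card F\<close> polynomials in the variables \<open>F\<close> are algebraically dependent: there are more
  products of bounded powers of them than monomials of the corresponding degrees.\<close>

lemma algebraically_dependent:
  fixes ys :: "('v, 'k::field) mpoly list"
  assumes fin: "finite F" and len: "card F < length ys"
    and ys: "\<And>y m. y \<in> set ys \<Longrightarrow> m \<in> Poly_Mapping.keys y \<Longrightarrow> Poly_Mapping.keys m \<subseteq> F"
  obtains X c where "finite X" "X \<noteq> {}" "\<forall>as\<in>X. length as = length ys \<and> c as \<noteq> 0"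
    "(\<Sum>as\<in>X. const (c as) * power_product ys as) = 0"
proof -
  obtain b where b: "\<And>y. y \<in> set ys \<Longrightarrow> bounded_degrees b y"
    using exists_bounded_degrees[of ys] by blast
  define r where "r = length ys"
  obtain N where N: "Suc (N * (r * b)) ^ card F < N ^ Suc (card F)"
    using exists_counting_bound by blast
  have Npos: "0 < N" using N by (cases N) auto
  define L where "L = {as :: nat list. set as \<subseteq> {..<N} \<and> length as = r}"
  have finL: "finite L" and cardL: "card L = N ^ r"
    unfolding L_def using finite_lists_length_eq[of "{..<N}" r] card_lists_length_eq[of "{..<N}" r] by auto
  show thesis
  \<comment> \<open>If two exponent lists give the same product, their difference is already a
    relation. Otherwise the products are distinct elements of a space spanned by fewer
    monomials.\<close>
  proof (cases "inj_on (power_product ys) L")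
    case False
    then obtain as bs where ab: "as \<in> L" "bs \<in> L" "as \<noteq> bs" "power_product ys as = power_product ys bs"
      by (auto simp: inj_on_def)
    show thesis
      by (rule that[of "{as, bs}" "\<lambda>cs. if cs = as then 1 else - 1"])
        (use ab in \<open>auto simp: L_def r_def const_1 const_uminus\<close>)
  next
    case True
    define T where "T = (\<lambda>m. Poly_Mapping.single m (1::'k)) ` bounded_monomials F (r * (N * b))"
    have finT: "finite T" using card_bounded_monomials(1)[OF fin] by (simp add: T_def)
    have "card T \<le> Suc (r * (N * b)) ^ card F"
      using card_bounded_monomials[OF fin, of "r * (N * b)"] card_image_le unfolding T_def
      by (metis le_trans)
    also have "\<dots> = Suc (N * (r * b)) ^ card F" by (simp add: ac_simps)
    also have "\<dots> < N ^ Suc (card F)" by (rule N)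
    also have "\<dots> \<le> N ^ r" using len Npos by (intro power_increasing) (auto simp: r_def)
    finally have less: "card T < card (power_product ys ` L)"
      using card_image[OF True] cardL by simp
    have keysF: "Poly_Mapping.keys m \<subseteq> F" if "m \<in> Poly_Mapping.keys (power_product ys as)" for m as
      using that ys
    proof (induction ys as arbitrary: m rule: power_product.induct)
      case (1 y ys a as)
      have "Poly_Mapping.keys m \<subseteq> F" if "m \<in> Poly_Mapping.keys (y ^ n)" for m n
        using that
      proof (induction n arbitrary: m)
        case (Suc n)
        then obtain c d where cd: "c \<in> Poly_Mapping.keys y" "d \<in> Poly_Mapping.keys (y ^ n)" "m = c + d"
          by (auto elim: keys_mult_mpoly)
        have "Poly_Mapping.keys c \<subseteq> F" using 1(3)[of y c] cd(1) by simp
        then show ?case using Suc.IH[OF cd(2)] cd(3) by (simp add: keys_plus_nat)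
      qed simp
      moreover obtain c d where cd: "c \<in> Poly_Mapping.keys (y ^ a)"
          "d \<in> Poly_Mapping.keys (power_product ys as)" "m = c + d"
        using 1(2) by (auto elim: keys_mult_mpoly)
      moreover have "Poly_Mapping.keys d \<subseteq> F"
        by (rule 1(1)[OF cd(2)], rule 1(3)) simp_all
      ultimately show ?case by (simp add: keys_plus_nat)
    qed auto
    have "power_product ys ` L \<subseteq> mpoly_space.span T"
    proof
      fix p assume "p \<in> power_product ys ` L"
      then obtain as where as: "as \<in> L" "p = power_product ys as" by blast
      have bd: "bounded_degrees (r * (N * b)) p"
        unfolding as(2) r_def using b as(1) by (intro bounded_degrees_power_product) (auto simp: L_def)
      have "p = (\<Sum>m\<in>Poly_Mapping.keys p. const (Poly_Mapping.lookup p m) * Poly_Mapping.single m 1)"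
        by (simp add: const_def mult_single sum_monomials)
      also have "\<dots> \<in> mpoly_space.span T"
      proof (intro mpoly_space.span_sum mpoly_space.span_scale mpoly_space.span_base)
        fix m assume m: "m \<in> Poly_Mapping.keys p"
        have "Poly_Mapping.keys m \<subseteq> F" using keysF[of m as] m as(2) by simp
        then have "m \<in> bounded_monomials F (r * (N * b))"
          using bd m by (simp add: bounded_monomials_def bounded_degrees_def)
        then show "Poly_Mapping.single m 1 \<in> T" by (simp add: T_def)
      qed
      finally show "p \<in> mpoly_space.span T" .
    qed
    from mpoly_space.independent_span_bound[OF finT _ this]
    have "mpoly_space.dependent (power_product ys ` L)"
      using less by linarith
    then have "\<exists>t u. finite t \<and> t \<subseteq> power_product ys ` L \<and> (\<Sum>v\<in>t. const (u v) * v) = 0 \<and>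
        (\<exists>v\<in>t. u v \<noteq> 0)"
      by (rule mpoly_space.dependent_explicit[THEN iffD1])
    then obtain t u where t: "finite t" "t \<subseteq> power_product ys ` L" "(\<Sum>v\<in>t. const (u v) * v) = 0"
      "\<exists>v\<in>t. u v \<noteq> 0"
      by (elim exE conjE)
    \<comment> \<open>The linear dependence is pulled back to exponent lists, and terms with
      coefficient 0 are dropped because every \<open>c as\<close> has to be nonzero.\<close>
    define X where "X = {as \<in> L. power_product ys as \<in> t \<and> u (power_product ys as) \<noteq> 0}"
    have img: "power_product ys ` X = {v \<in> t. u v \<noteq> 0}"
    proof (intro equalityI subsetI)
      fix v assume v: "v \<in> {v \<in> t. u v \<noteq> 0}"
      then obtain as where "as \<in> L" "v = power_product ys as" using t(2) by blast
      then show "v \<in> power_product ys ` X" using v unfolding X_def by blast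
    qed (auto simp: X_def)
    have "X \<subseteq> L" unfolding X_def by (rule Collect_restrict)
    then have inj: "inj_on (power_product ys) X" by (rule inj_on_subset[OF True])
    have "(\<Sum>as\<in>X. const (u (power_product ys as)) * power_product ys as) =
        (\<Sum>v\<in>power_product ys ` X. const (u v) * v)"
      by (simp add: sum.reindex[OF inj])
    also have "\<dots> = (\<Sum>v\<in>t. const (u v) * v)"
      unfolding img
    proof (rule sum.mono_neutral_left[OF t(1)])
      show "\<forall>v\<in>t - {v \<in> t. u v \<noteq> 0}. const (u v) * v = 0" by (simp add: const_def)
    qed (rule Collect_restrict)
    also have "\<dots> = 0" by (rule t(3))
    finally have sum0: "(\<Sum>as\<in>X. const (u (power_product ys as)) * power_product ys as) = 0" .
    show thesis
    proof (rule that[OF _ _ _ sum0])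
      show "finite X" using finL \<open>X \<subseteq> L\<close> finite_subset by blast
      obtain v where v: "v \<in> t" "u v \<noteq> 0" using t(4) by blast
      then have "v \<in> power_product ys ` X" unfolding img by simp
      then show "X \<noteq> {}" by (metis image_is_empty empty_iff)
      show "\<forall>as\<in>X. length as = length ys \<and> u (power_product ys as) \<noteq> 0"
        by (simp add: X_def L_def r_def)
    qed
  qed
qed

context poly_vars
begin

section \<open>Chains of prime ideals\<close>

lemma const_C: "const c \<in> polys"
  by (simp add: const_def single_C)

lemma power_C: "p \<in> polys \<Longrightarrow> p ^ n \<in> polys"
  by (induction n) (auto simp: one_C mult_C)

lemma power_product_C: "set ys \<subseteq> polys \<Longrightarrow> power_product ys as \<in> polys"
  by (induction ys as rule: power_product.induct) (auto simp: one_C mult_C power_C)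

lemma prime_ideal: "prime_in P \<Longrightarrow> ideal_in P"
  by (simp add: prime_in_def)

lemma prime_power: "prime_in P \<Longrightarrow> p \<in> polys \<Longrightarrow> p ^ n \<in> P \<Longrightarrow> p \<in> P"
proof (induction n)
  case (Suc n)
  then have "p \<in> P \<or> p ^ n \<in> P"
    using power_C[of p n] by (simp add: prime_in_def)
  then show ?case using Suc by blast
qed (simp add: prime_in_def)

text \<open>Elements \<open>y\<^sub>i \<in> Q\<^sub>i\<^sub>+\<^sub>1 - Q\<^sub>i\<close> along a chain of primes satisfy no polynomial relation modulo \<open>Q\<^sub>0\<close>:
  cancel the lowest power of \<open>y\<^sub>0\<close> occurring, and pass to \<open>Q\<^sub>1\<close>.\<close>

lemma prime_chain_independent:
  assumes "\<And>i. i \<le> length ys \<Longrightarrow> prime_in (Q i)" "\<And>i. i < length ys \<Longrightarrow> Q i \<subseteq> Q (Suc i)"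
    and "\<And>i. i < length ys \<Longrightarrow> ys ! i \<in> Q (Suc i) - Q i"
    and "finite X" "X \<noteq> {}" "\<And>as. as \<in> X \<Longrightarrow> length as = length ys \<and> c as \<noteq> 0"
  shows "(\<Sum>as\<in>X. const (c as) * power_product ys as) \<notin> Q 0"
  using assms
proof (induction ys arbitrary: Q X c)
  case Nil
  have X: "X = {[]}" using Nil.prems(5,6) by fastforce
  have Q: "ideal_in (Q 0)" "1 \<notin> Q 0" using Nil.prems(1)[of 0] by (auto simp: prime_in_def)
  have "const (inverse (c [])) * const (c []) = (1 :: ('v, 'k) mpoly)"
    using Nil.prems(6)[of "[]"] X by (simp add: const_def mult_single)
  then have "const (c []) \<notin> Q 0"
    using ideal_mult[OF Q(1) const_C, of "const (c [])" "inverse (c [])"] Q(2) by auto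
  then show ?case by (simp add: X)
next
  case (Cons y ys)
  have prime: "prime_in (Q 0)" "prime_in (Q 1)"
    using Cons.prems(1)[of 0] Cons.prems(1)[of 1] by auto
  note ideals = prime_ideal[OF prime(1)] prime_ideal[OF prime(2)]
  have y: "y \<in> Q 1" "y \<notin> Q 0" "Q 0 \<subseteq> Q 1"
    using Cons.prems(3)[of 0] Cons.prems(2)[of 0] by auto
  have yC: "y \<in> polys" using ideal_subset[OF ideals(2) y(1)] .
  have ysC: "set ys \<subseteq> polys"
  proof
    fix x assume "x \<in> set ys"
    then obtain i where "i < length ys" "x = ys ! i" by (auto simp: in_set_conv_nth)
    then show "x \<in> polys"
      using Cons.prems(3)[of "Suc i"] Cons.prems(1)[of "Suc (Suc i)"] ideal_subset prime_ideal by auto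
  qed
  have len: "as = hd as # tl as" "length (tl as) = length ys" "c as \<noteq> 0" if "as \<in> X" for as
    using Cons.prems(6)[OF that] by (cases as; simp)+
  define n where "n = Min (hd ` X)"
  have n_le: "n \<le> hd as" if "as \<in> X" for as using that Cons.prems(4) by (simp add: n_def)
  define X0 where "X0 = {as \<in> X. hd as = n}"
  have "n \<in> hd ` X" unfolding n_def using Cons.prems(4,5) by (intro Min_in) auto
  then have X0: "X0 \<noteq> {}" "X0 \<subseteq> X" "finite X0" using Cons.prems(4) by (auto simp: X0_def)
  define T where "T as = const (c as) * power_product ys (tl as)" for as
  have TC: "T as \<in> polys" for as using const_C power_product_C[OF ysC] by (simp add: T_def mult_C)
  define S where "S = (\<Sum>as\<in>X - X0. T as * y ^ (hd as - Suc n))"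
  have SC: "S \<in> polys" unfolding S_def using TC yC by (intro sum_C mult_C power_C)
  have term_eq: "const (c as) * power_product (y # ys) as = T as * y ^ hd as" if "as \<in> X" for as
    by (subst len(1)[OF that]) (simp add: T_def ac_simps)
  have "(\<Sum>as\<in>X. const (c as) * power_product (y # ys) as) = (\<Sum>as\<in>X. T as * y ^ hd as)"
    using term_eq by (rule sum.cong[OF refl])
  also have "\<dots> = (\<Sum>as\<in>X0. T as * y ^ hd as) + (\<Sum>as\<in>X - X0. T as * y ^ hd as)"
    using sum.subset_diff[OF X0(2) Cons.prems(4)] by (simp add: add.commute)
  also have "(\<Sum>as\<in>X0. T as * y ^ hd as) = y ^ n * (\<Sum>as\<in>X0. T as)"
    by (simp add: X0_def sum_distrib_left mult.commute)
  also have "(\<Sum>as\<in>X - X0. T as * y ^ hd as) = (\<Sum>as\<in>X - X0. y ^ n * (y * (T as * y ^ (hd as - Suc n))))"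
  proof (rule sum.cong[OF refl])
    fix as assume "as \<in> X - X0"
    then have "n < hd as" using n_le[of as] by (auto simp: X0_def)
    then have "y ^ hd as = y ^ n * (y * y ^ (hd as - Suc n))"
      by (metis Suc_diff_Suc power_Suc power_add le_add_diff_inverse less_imp_le)
    then show "T as * y ^ hd as = y ^ n * (y * (T as * y ^ (hd as - Suc n)))"
      by (simp add: ac_simps)
  qed
  also have "\<dots> = y ^ n * (y * S)" by (simp add: S_def sum_distrib_left)
  finally have eq: "(\<Sum>as\<in>X. const (c as) * power_product (y # ys) as) =
      y ^ n * ((\<Sum>as\<in>X0. T as) + y * S)" by (simp add: distrib_left)
  have sumC: "(\<Sum>as\<in>X0. T as) \<in> polys" using TC by (rule sum_C)
  \<comment> \<open>The terms with the lowest power of \<open>y\<close> form an expression in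
    \<open>ys\<close> alone. For these the chain starts at \<open>Q 1\<close>, and the induction
    hypothesis applies.\<close>
  have notin: "(\<Sum>as\<in>X0. T as) \<notin> Q 1"
  proof -
    have inj: "inj_on tl X0"
      using len(1) X0(2) by (auto simp: inj_on_def X0_def) metis
    have "(\<Sum>as\<in>tl ` X0. const (c (n # as)) * power_product ys as) \<notin> (Q \<circ> Suc) 0"
    proof (rule Cons.IH)
      fix as assume "as \<in> tl ` X0"
      then obtain bs where bs: "bs \<in> X" "hd bs = n" "as = tl bs" by (auto simp: X0_def)
      then have "n # as = bs" using len(1)[OF bs(1)] by simp
      then show "length as = length ys \<and> c (n # as) \<noteq> 0" using len[OF bs(1)] bs(3) by simp
    qed (use Cons.prems(1-3)[of "Suc _"] X0 in auto)
    also have "(\<Sum>as\<in>tl ` X0. const (c (n # as)) * power_product ys as) = (\<Sum>as\<in>X0. T as)"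
    proof (rule sum.reindex_cong[OF inj refl])
      fix as assume "as \<in> X0"
      then have "n # tl as = as" using len(1)[of as] by (auto simp: X0_def)
      then show "const (c (n # tl as)) * power_product ys (tl as) = T as" by (simp add: T_def)
    qed
    finally show ?thesis by simp
  qed
  show ?case
  proof
    assume "(\<Sum>as\<in>X. const (c as) * power_product (y # ys) as) \<in> Q 0"
    then have "y ^ n * ((\<Sum>as\<in>X0. T as) + y * S) \<in> Q 0" by (simp only: eq)
    moreover have "y ^ n \<notin> Q 0" using prime_power[OF prime(1) yC] y(2) by blast
    moreover have "(\<Sum>as\<in>X0. T as) + y * S \<in> polys"
      using sumC yC SC add_C mult_C by blast
    ultimately have "(\<Sum>as\<in>X0. T as) + y * S \<in> Q 0"
      using prime(1) power_C[OF yC, of n] unfolding prime_in_def by blast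
    then have "(\<Sum>as\<in>X0. T as) + y * S \<in> Q 1" using y(3) by blast
    moreover have "y * S \<in> Q 1" using ideal_mult_right[OF ideals(2) SC y(1)] .
    ultimately have "(\<Sum>as\<in>X0. T as) \<in> Q 1"
      using ideal_diff[OF ideals(2)] by (metis add_diff_cancel_right')
    then show False using notin by blast
  qed
qed

text \<open>A new element at each step can be chosen in the variables of \<open>F\<close>, since the
  discarded terms lie in every prime of the chain. More than \<open>card F\<close> such elements are
  algebraically dependent, which \<open>prime_chain_independent\<close> excludes.\<close>

lemma prime_chain_length_le:
  assumes F: "F \<subseteq> V" and P: "\<And>i. i \<le> n \<Longrightarrow> prime_in (P i)" "\<And>i. i < n \<Longrightarrow> P i \<subset> P (Suc i)"
    and sub: "sr_ideal (Pow F) \<subseteq> P 0"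
  shows "n \<le> card F"
proof (rule ccontr)
  assume "\<not> n \<le> card F"
  let ?\<rho> = "pm_filter (\<lambda>m. Poly_Mapping.keys m \<subseteq> F) :: ('v, 'k) mpoly \<Rightarrow> _"
  have base: "sr_ideal (Pow F) \<subseteq> P i" if "i \<le> n" for i
    using that
  proof (induction i)
    case (Suc i)
    then show ?case using P(2)[of i] by auto
  qed (rule sub)
  have "\<exists>y. y \<in> P (Suc i) - P i \<and> (\<forall>m\<in>Poly_Mapping.keys y. Poly_Mapping.keys m \<subseteq> F)" if i: "i < n" for i
  proof -
    obtain x where x: "x \<in> P (Suc i)" "x \<notin> P i" using P(2)[OF i] by blast
    have ideals: "ideal_in (P i)" "ideal_in (P (Suc i))" using P(1) i by (auto intro: prime_ideal)
    have xC: "x \<in> polys" using ideal_subset[OF ideals(2) x(1)] .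
    define z where "z = pm_filter (\<lambda>m. \<not> Poly_Mapping.keys m \<subseteq> F) x"
    have "z \<in> sr_ideal (Pow F)"
      using xC pm_filter_C by (auto simp: sr_ideal_def z_def keys_pm_filter)
    then have z: "z \<in> P i" "z \<in> P (Suc i)" using base[of i] base[of "Suc i"] i by auto
    have "x = ?\<rho> x + z" unfolding z_def by (rule pm_filter_split)
    then have "?\<rho> x \<in> P (Suc i) - P i"
      using ideal_diff[OF ideals(2) x(1) z(2)] ideal_add[OF ideals(1) _ z(1), of "?\<rho> x"] x(2)
      by (metis Diff_iff add_diff_cancel_right')
    then show ?thesis by (intro exI[of _ "?\<rho> x"]) (simp add: keys_pm_filter)
  qed
  then obtain y where y: "\<And>i. i < n \<Longrightarrow> y i \<in> P (Suc i) - P i"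
    "\<And>i m. i < n \<Longrightarrow> m \<in> Poly_Mapping.keys (y i) \<Longrightarrow> Poly_Mapping.keys m \<subseteq> F" by metis
  define ys where "ys = map y [0..<n]"
  have fin: "finite F" using F finite_V finite_subset by blast
  have len: "card F < length ys" using \<open>\<not> n \<le> card F\<close> by (simp add: ys_def)
  have keysF: "Poly_Mapping.keys m \<subseteq> F" if z: "z \<in> set ys" "m \<in> Poly_Mapping.keys z" for z m
  proof -
    obtain i where "i < n" "z = y i" using z(1) by (auto simp: ys_def)
    then show ?thesis using y(2) z(2) by blast
  qed
  obtain X c where X: "finite X" "X \<noteq> {}" "\<forall>as\<in>X. length as = length ys \<and> c as \<noteq> 0"
    "(\<Sum>as\<in>X. const (c as) * power_product ys as) = 0"
    by (rule algebraically_dependent[OF fin len keysF])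
  have "(\<Sum>as\<in>X. const (c as) * power_product ys as) \<notin> P 0"
    using P y(1) X(3) by (intro prime_chain_independent[OF _ _ _ X(1,2)]) (auto simp: ys_def)
  moreover have "0 \<in> P 0" using P(1)[of 0] by (auto intro: ideal_zero prime_ideal)
  ultimately show False using X(4) by simp
qed

text \<open>Removing the vertices of \<open>F\<close> one by one puts one variable after another
  into the prime.\<close>

lemma prime_chain_exists:
  assumes "F \<subseteq> V"
  obtains P where "P 0 = sr_ideal (Pow F)" "\<And>i. i \<le> card F \<Longrightarrow> prime_in (P i)"
    "\<And>i. i < card F \<Longrightarrow> P i \<subset> P (Suc i)"
proof -
  have "finite F" using assms finite_V finite_subset by blast
  then obtain vs where vs: "set vs = F" "distinct vs" using finite_distinct_list by blast
  then have len: "length vs = card F" using distinct_card by fastforce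
  define P where "P i = sr_ideal (Pow (set (drop i vs)))" for i
  have "P i \<subset> P (Suc i)" if i: "i < card F" for i
  proof -
    have d: "drop i vs = vs ! i # drop (Suc i) vs" using i len by (simp add: Cons_nth_drop_Suc)
    have "distinct (drop i vs)" using vs(2) by simp
    then have nin: "vs ! i \<notin> set (drop (Suc i) vs)" unfolding d by simp
    have "vs ! i \<in> V" using i len vs(1) assms by auto
    then have "var (vs ! i) \<in> P (Suc i)"
      using nin var_C by (auto simp: P_def sr_ideal_def var_def)
    moreover have "var (vs ! i) \<notin> P i" unfolding P_def by (rule var_notin_sr_ideal) (simp add: d)
    moreover have "P i \<subseteq> P (Suc i)" by (auto simp: P_def sr_ideal_def d)
    ultimately show ?thesis by blast
  qed
  then show thesis
    using that[of P] vs(1) prime_sr_ideal_Pow by (simp add: P_def)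
qed

end

section \<open>The ring-theoretic invariants of the Stanley--Reisner ring\<close>

context poly_vars
begin

section \<open>Dictionary with the ring and ideal notions of HOL-Algebra\<close>

abbreviation R :: "('v, 'k) mpoly ring" where
  "R \<equiv> polynomial_ring V"

lemma R_simps [simp]: "carrier R = polys" "monoid.mult R = (*)" "\<one>\<^bsub>R\<^esub> = 1" "\<zero>\<^bsub>R\<^esub> = 0" "ring.add R = (+)"
  by (simp_all add: polynomial_ring_def polys_def)

lemma cring_R: "cring R"
proof (rule cringI)
  show "abelian_group R"
  proof (rule abelian_groupI)
    show "\<exists>y\<in>carrier R. y \<oplus>\<^bsub>R\<^esub> x = \<zero>\<^bsub>R\<^esub>" if "x \<in> carrier R" for x
      using that uminus_C by (intro bexI[of _ "- x"]) auto
  qed (auto simp: add_C zero_C)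
  show "Group.comm_monoid R"
    by unfold_locales (auto simp: mult_C one_C)
qed (simp add: distrib_right)

lemma ring_R: "ring R"
  using cring_R by (rule cring.axioms)

lemma ideal_iff: "ideal J R \<longleftrightarrow> ideal_in J"
proof
  assume "ideal J R"
  then interpret ideal J R .
  show "ideal_in J"
    using a_subset I_l_closed additive_subgroup.zero_closed[OF additive_subgroup_axioms]
      additive_subgroup.a_closed[OF additive_subgroup_axioms]
    by (intro ideal_inI) auto
next
  assume J: "ideal_in J"
  show "ideal J R"
  proof (rule idealI[OF ring_R])
    show "subgroup J (add_monoid R)"
    proof (rule group.subgroupI)
      show "group (add_monoid R)"
        by (rule abelian_group.a_group[OF ring.is_abelian_group[OF ring_R]])
      fix a assume a: "a \<in> J"
      have "inv\<^bsub>add_monoid R\<^esub> a = - a"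
      proof (rule group.inv_equality)
        show "group (add_monoid R)"
          by (rule abelian_group.a_group[OF ring.is_abelian_group[OF ring_R]])
      qed (use a J uminus_C ideal_subset in auto)
      then show "inv\<^bsub>add_monoid R\<^esub> a \<in> J" using a J by (simp add: ideal_uminus)
    qed (use J in \<open>auto simp: ideal_subset ideal_add dest: ideal_zero\<close>)
  qed (use J in \<open>auto simp: ideal_mult ideal_mult_right\<close>)
qed

lemma prime_iff: "primeideal P R \<longleftrightarrow> prime_in P"
proof
  assume P: "primeideal P R"
  then interpret primeideal P R .
  have id: "ideal_in P" using ideal_axioms by (simp add: ideal_iff)
  moreover have "1 \<notin> P"
  proof
    assume "1 \<in> P"
    then have "polys \<subseteq> P" using ideal_mult[OF id, of _ 1] by auto
    then show False using I_notcarr id by (auto simp: ideal_in_def)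
  qed
  ultimately show "prime_in P"
    using I_prime by (auto simp: prime_in_def)
next
  assume P: "prime_in P"
  show "primeideal P R"
  proof (rule primeidealI[OF _ cring_R])
    show "ideal P R" using P by (simp add: ideal_iff prime_in_def)
    show "carrier R \<noteq> P" using P one_C by (auto simp: prime_in_def)
  qed (use P in \<open>auto simp: prime_in_def\<close>)
qed

section \<open>Quotient rings and their primes\<close>

definition coset :: "('v, 'k) mpoly set \<Rightarrow> ('v, 'k) mpoly \<Rightarrow> ('v, 'k) mpoly set" where
  "coset I x = I +>\<^bsub>R\<^esub> x"

lemma mem_coset: "z \<in> coset I y \<longleftrightarrow> z - y \<in> I"
proof
  assume "z - y \<in> I"
  then show "z \<in> coset I y"
    unfolding coset_def a_r_coset_def' by (auto intro!: exI[of _ "z - y"] bexI[of _ "z - y"])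
qed (auto simp: coset_def a_r_coset_def')

lemma coset_eq_iff:
  assumes I: "ideal_in I" and xy: "x \<in> polys" "y \<in> polys"
  shows "coset I x = coset I y \<longleftrightarrow> x - y \<in> I"
proof
  assume "coset I x = coset I y"
  moreover have "x \<in> coset I x"
    using ideal_zero[OF I] by (simp add: mem_coset)
  ultimately show "x - y \<in> I" by (simp add: mem_coset)
next
  assume d: "x - y \<in> I"
  have "z - y = (x - y) + (z - x)" for z by simp
  then have "z - y \<in> I \<longleftrightarrow> z - x \<in> I" for z
    using ideal_add_cancel[OF I d, of "z - x"] by simp
  then show "coset I x = coset I y" by (auto simp: mem_coset)
qed

lemma coset_eq_zero_iff:
  assumes I: "ideal_in I" and x: "x \<in> polys"
  shows "coset I x = coset I 0 \<longleftrightarrow> x \<in> I"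
  using coset_eq_iff[OF I x zero_C] by simp

lemma carrier_Quot: "carrier (R Quot I) = coset I ` polys"
  by (auto simp: FactRing_def A_RCOSETS_def' coset_def)

lemma Quot_ops:
  assumes I: "ideal_in I" and xy: "x \<in> polys" "y \<in> polys"
  shows "coset I x \<otimes>\<^bsub>R Quot I\<^esub> coset I y = coset I (x * y)"
    and "coset I x \<oplus>\<^bsub>R Quot I\<^esub> coset I y = coset I (x + y)"
proof -
  interpret ideal I R using I by (simp add: ideal_iff)
  show "coset I x \<otimes>\<^bsub>R Quot I\<^esub> coset I y = coset I (x * y)"
    using rcoset_mult_add[of x y] xy by (simp add: FactRing_def coset_def)
  show "coset I x \<oplus>\<^bsub>R Quot I\<^esub> coset I y = coset I (x + y)"
    using a_rcos_sum[of x y] xy by (simp add: FactRing_def coset_def)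
qed

lemma Quot_zero_one:
  assumes "ideal_in I"
  shows "\<zero>\<^bsub>R Quot I\<^esub> = coset I 0" "\<one>\<^bsub>R Quot I\<^esub> = coset I 1"
  by (auto simp: FactRing_def coset_def a_r_coset_def')

lemma Quot_cring: "ideal_in I \<Longrightarrow> cring (R Quot I)"
  using ideal.quotient_is_cring[OF _ cring_R] by (simp add: ideal_iff)

lemma prime_preimage:
  assumes I: "ideal_in I" and Q: "primeideal Q (R Quot I)"
  shows "prime_in {x \<in> polys. coset I x \<in> Q}" "I \<subseteq> {x \<in> polys. coset I x \<in> Q}"
proof -
  interpret primeideal Q "R Quot I" by (rule Q)
  have zero: "coset I 0 \<in> Q"
    using additive_subgroup.zero_closed[OF additive_subgroup_axioms] by (simp add: Quot_zero_one[OF I])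
  show "prime_in {x \<in> polys. coset I x \<in> Q}"
    unfolding prime_in_def
  proof (intro conjI ideal_inI ballI impI)
    fix x y assume "x \<in> {x \<in> polys. coset I x \<in> Q}" "y \<in> {x \<in> polys. coset I x \<in> Q}"
    then show "x + y \<in> {x \<in> polys. coset I x \<in> Q}"
      using additive_subgroup.a_closed[OF additive_subgroup_axioms, of "coset I x" "coset I y"] by (simp add: Quot_ops[OF I] add_C)
  next
    fix r x assume "r \<in> polys" "x \<in> {x \<in> polys. coset I x \<in> Q}"
    then show "r * x \<in> {x \<in> polys. coset I x \<in> Q}"
      using I_l_closed[of "coset I x" "coset I r"] by (simp add: Quot_ops[OF I] carrier_Quot mult_C)
  next
    show "1 \<notin> {x \<in> polys. coset I x \<in> Q}"
      using I_notcarr one_imp_carrier by (auto simp: Quot_zero_one[OF I])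
  next
    fix a b assume "a \<in> polys" "b \<in> polys" "a * b \<in> {x \<in> polys. coset I x \<in> Q}"
    then show "a \<in> {x \<in> polys. coset I x \<in> Q} \<or> b \<in> {x \<in> polys. coset I x \<in> Q}"
      using I_prime[of "coset I a" "coset I b"] by (simp add: Quot_ops[OF I] carrier_Quot)
  qed (use zero zero_C in auto)
  show "I \<subseteq> {x \<in> polys. coset I x \<in> Q}"
  proof
    fix x assume x: "x \<in> I"
    then have "x \<in> polys" by (rule ideal_subset[OF I])
    then show "x \<in> {x \<in> polys. coset I x \<in> Q}"
      using coset_eq_zero_iff[OF I, of x] x zero by simp
  qed
qed

lemma coset_image_mem:
  assumes I: "ideal_in I" and P: "ideal_in P" "I \<subseteq> P" and x: "x \<in> polys"
  shows "coset I x \<in> coset I ` P \<longleftrightarrow> x \<in> P"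
proof
  assume "coset I x \<in> coset I ` P"
  then obtain y where y: "y \<in> P" "coset I x = coset I y" by blast
  then have "x - y \<in> P" using coset_eq_iff[OF I x, of y] ideal_subset[OF P(1)] P(2) by blast
  then show "x \<in> P" using ideal_add[OF P(1) _ y(1), of "x - y"] by simp
qed blast

lemma prime_image:
  assumes I: "ideal_in I" and P: "prime_in P" "I \<subseteq> P"
  shows "primeideal (coset I ` P) (R Quot I)"
proof (rule primeidealI[OF _ Quot_cring[OF I]])
  have idP: "ideal_in P" using P(1) by (rule prime_ideal)
  note mem = coset_image_mem[OF I idP P(2)]
  show "ideal (coset I ` P) (R Quot I)"
    using ring.ring_ideal_imp_quot_ideal[OF ring_R, of I P] I idP
    by (simp add: ideal_iff coset_def[abs_def])
  show "carrier (R Quot I) \<noteq> coset I ` P"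
  proof -
    have "coset I 1 \<in> coset I ` polys" using one_C by blast
    moreover have "coset I 1 \<notin> coset I ` P" using mem[OF one_C] P(1) by (simp add: prime_in_def)
    ultimately show ?thesis unfolding carrier_Quot by metis
  qed
  fix a b assume ab: "a \<in> carrier (R Quot I)" "b \<in> carrier (R Quot I)"
    "a \<otimes>\<^bsub>R Quot I\<^esub> b \<in> coset I ` P"
  then obtain x y where xy: "x \<in> polys" "a = coset I x" "y \<in> polys" "b = coset I y"
    by (auto simp: carrier_Quot)
  then have "x * y \<in> P" using ab(3) mem[OF mult_C[OF xy(1,3)]] by (simp add: Quot_ops[OF I])
  then have "x \<in> P \<or> y \<in> P" using P(1) xy by (auto simp: prime_in_def)
  then show "a \<in> coset I ` P \<or> b \<in> coset I ` P" using xy by blast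
qed

lemma krull_dim_face:
  assumes F: "F \<subseteq> V"
  shows "krull_dim (R Quot sr_ideal (Pow F)) = enat (card F)"
proof (rule antisym)
  let ?I = "sr_ideal (Pow F)"
  have I: "ideal_in ?I" using prime_sr_ideal_Pow by (rule prime_ideal)
  show "krull_dim (R Quot ?I) \<le> enat (card F)"
    unfolding krull_dim_def
  proof (rule Sup_least, clarify)
    fix n P assume P: "\<forall>i\<le>n. primeideal (P i) (R Quot ?I)" "\<forall>i<n. P i \<subset> P (Suc i)"
    define P' where "P' i = {x \<in> polys. coset ?I x \<in> P i}" for i
    have "n \<le> card F"
    proof (rule prime_chain_length_le[OF F, of n P'])
      show "prime_in (P' i)" if "i \<le> n" for i
        using prime_preimage(1)[OF I] P(1) that by (simp add: P'_def)
      show "?I \<subseteq> P' 0" using prime_preimage(2)[OF I, of "P 0"] P(1) by (simp add: P'_def)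
      show "P' i \<subset> P' (Suc i)" if "i < n" for i
      proof -
        obtain q where q: "q \<in> P (Suc i)" "q \<notin> P i" using P(2) \<open>i < n\<close> by blast
        have "primeideal (P (Suc i)) (R Quot ?I)" using P(1) that by simp
        then have "P (Suc i) \<subseteq> carrier (R Quot ?I)"
          by (intro additive_subgroup.a_subset ideal.axioms(1) primeideal.axioms(1))
        then obtain x where "x \<in> polys" "q = coset ?I x" using q(1) by (auto simp: carrier_Quot)
        then have "x \<in> P' (Suc i)" "x \<notin> P' i" using q by (auto simp: P'_def)
        moreover have "P' i \<subseteq> P' (Suc i)" using P(2) that by (auto simp: P'_def)
        ultimately show ?thesis by blast
      qed
    qed
    then show "enat n \<le> enat (card F)" by simp
  qed
  obtain P where P: "P 0 = ?I" "\<And>i. i \<le> card F \<Longrightarrow> prime_in (P i)"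
      "\<And>i. i < card F \<Longrightarrow> P i \<subset> P (Suc i)"
    using prime_chain_exists[OF F] by blast
  have sub: "?I \<subseteq> P i" if "i \<le> card F" for i
    using that
  proof (induction i)
    case (Suc i)
    then show ?case using P(3)[of i] by auto
  qed (simp add: P(1))
  have "\<exists>Q. (\<forall>i\<le>card F. primeideal (Q i) (R Quot ?I)) \<and> (\<forall>i<card F. Q i \<subset> Q (Suc i))"
  proof (intro exI[of _ "\<lambda>i. coset ?I ` P i"] conjI allI impI)
    show "primeideal (coset ?I ` P i) (R Quot ?I)" if "i \<le> card F" for i
      using prime_image[OF I] P(2) sub that by blast
    show "coset ?I ` P i \<subset> coset ?I ` P (Suc i)" if i: "i < card F" for i
    proof -
      obtain x where x: "x \<in> P (Suc i)" "x \<notin> P i" using P(3)[OF i] by blast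
      have ideals: "ideal_in (P i)" "ideal_in (P (Suc i))" using P(2) i by (auto intro: prime_ideal)
      have "coset ?I x \<notin> coset ?I ` P i"
        using coset_image_mem[OF I ideals(1) sub ideal_subset[OF ideals(2) x(1)]] i x(2) by simp
      then show ?thesis using x(1) P(3)[OF i] by blast
    qed
  qed
  then show "enat (card F) \<le> krull_dim (R Quot ?I)"
    unfolding krull_dim_def by (intro Sup_upper) blast
qed

lemma irrelevant_ideal_eq: "irrelevant_ideal V = irrelevant"
proof
  show "irrelevant_ideal V \<subseteq> irrelevant"
    unfolding irrelevant_ideal_def
  proof (rule ring.genideal_minimal[OF ring_R])
    show "ideal irrelevant R" by (simp add: ideal_iff ideal_irrelevant)
    have "Poly_Mapping.lookup (var v :: ('v, 'k) mpoly) 0 = 0" for v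
    proof -
      have "Poly_Mapping.single v (1::nat) \<noteq> 0" by (metis lookup_single_eq lookup_zero zero_neq_one)
      then show ?thesis by (simp add: var_def lookup_single when_def)
    qed
    then show "var ` V \<subseteq> irrelevant" using var_C by (auto simp: irrelevant_def)
  qed
  have "var ` V \<subseteq> (polys :: ('v, 'k) mpoly set)" using var_C by auto
  then have I: "ideal_in (irrelevant_ideal V :: ('v, 'k) mpoly set)" "var ` V \<subseteq> (irrelevant_ideal V :: ('v, 'k) mpoly set)"
    using ring.genideal_ideal[OF ring_R, of "var ` V"] ring.genideal_self[OF ring_R, of "var ` V"]
    by (simp_all add: ideal_iff irrelevant_ideal_def)
  obtain vs where vs: "set vs = V" using finite_list[OF finite_V] by blast
  show "irrelevant \<subseteq> irrelevant_ideal V"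
  proof
    fix p assume "p \<in> irrelevant"
    then obtain cs where cs: "length cs = length vs" "set cs \<subseteq> polys"
      "p = (\<Sum>(c, x) \<leftarrow> zip cs (map var vs). c * x)"
      using irrelevant_combination_all[OF _ vs] by blast
    have "(\<Sum>(c, x) \<leftarrow> zip cs (map var vs). c * x) \<in> irrelevant_ideal V"
      using cs(1,2) equalityD1[OF vs]
      by (induction cs vs rule: list_induct2)
        (use I in \<open>auto intro!: ideal_add ideal_mult ideal_zero\<close>)
    then show "p \<in> irrelevant_ideal V" by (simp add: cs(3))
  qed
qed

text \<open>A monomial whose support is not a face is divisible by the product over some minimal
  nonface inside that support.\<close>

lemma stanley_reisner_ideal_eq:
  assumes \<Delta>: "down_closed \<Delta>"
  shows "stanley_reisner_ideal V \<Delta> = sr_ideal \<Delta>"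
proof
  let ?G = "(\<lambda>F. \<Prod>v\<in>F. var v) ` minimal_nonfaces V \<Delta> :: ('v, 'k) mpoly set"
  have GC: "?G \<subseteq> polys" by (auto simp: minimal_nonfaces_def intro: prod_var_C)
  show "stanley_reisner_ideal V \<Delta> \<subseteq> sr_ideal \<Delta>"
    unfolding stanley_reisner_ideal_def
  proof (rule ring.genideal_minimal[OF ring_R])
    show "ideal (sr_ideal \<Delta>) R" by (simp add: ideal_iff ideal_sr_ideal[OF \<Delta>])
    show "?G \<subseteq> sr_ideal \<Delta>"
      by (auto simp: minimal_nonfaces_def intro: prod_var_mem_sr_ideal)
  qed
  have I: "ideal_in (stanley_reisner_ideal V \<Delta>)"
    using ring.genideal_ideal[OF ring_R, of ?G] GC by (simp add: ideal_iff stanley_reisner_ideal_def)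
  show "sr_ideal \<Delta> \<subseteq> stanley_reisner_ideal V \<Delta>"
  proof
    fix p assume p: "p \<in> sr_ideal \<Delta>"
    have "(\<Sum>m\<in>Poly_Mapping.keys p. Poly_Mapping.single m (Poly_Mapping.lookup p m))
        \<in> stanley_reisner_ideal V \<Delta>"
    proof (rule ideal_sum[OF I])
      fix m assume m: "m \<in> Poly_Mapping.keys p"
      have mV: "Poly_Mapping.keys m \<subseteq> V" "Poly_Mapping.keys m \<notin> \<Delta>"
        using p m by (auto simp: sr_ideal_def polys_def)
      have "\<exists>F\<in>{F. F \<subseteq> Poly_Mapping.keys m \<and> F \<notin> \<Delta>}. \<forall>F'\<in>{F. F \<subseteq> Poly_Mapping.keys m \<and> F \<notin> \<Delta>}.
          F' \<subseteq> F \<longrightarrow> F = F'"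
        by (rule finite_has_minimal) (use mV in auto)
      then obtain F where F: "F \<subseteq> Poly_Mapping.keys m" "F \<notin> \<Delta>"
        "\<And>F'. F' \<subseteq> Poly_Mapping.keys m \<Longrightarrow> F' \<notin> \<Delta> \<Longrightarrow> F' \<subseteq> F \<Longrightarrow> F = F'" by auto
      have finF: "finite F" using F(1) finite_subset finite_keys by blast
      have "F \<in> minimal_nonfaces V \<Delta>"
        using F mV(1) unfolding minimal_nonfaces_def by blast
      then have x: "(\<Prod>v\<in>F. var v) \<in> (stanley_reisner_ideal V \<Delta> :: ('v, 'k) mpoly set)"
        unfolding stanley_reisner_ideal_def
        using ring.genideal_self[OF ring_R, of ?G] GC by auto
      \<comment> \<open>The exponent vector of the product over \<open>F\<close>. Since
        \<open>F\<close> lies in the support of \<open>m\<close>, the truncated subtraction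
        \<open>m - e\<close> loses nothing.\<close>
      define e where "e = (\<Sum>v\<in>F. Poly_Mapping.single v (1::nat))"
      have e: "Poly_Mapping.lookup e v = (if v \<in> F then 1 else 0)" for v
        using finF by (simp add: e_def lookup_sum lookup_single when_def)
      have "m - e + e = m"
      proof (rule poly_mapping_eqI)
        fix v
        show "Poly_Mapping.lookup (m - e + e) v = Poly_Mapping.lookup m v"
          using F(1) e[of v] by (auto simp: lookup_add lookup_minus in_keys_iff)
      qed
      then have "Poly_Mapping.single m (Poly_Mapping.lookup p m) =
          Poly_Mapping.single (m - e) (Poly_Mapping.lookup p m) * (\<Prod>v\<in>F. var v)"
        by (simp add: prod_var[OF finF] mult_single flip: e_def del: One_nat_def)
      moreover have "Poly_Mapping.keys (m - e) \<subseteq> V"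
        using mV(1) by (auto simp: in_keys_iff lookup_minus)
      ultimately show "Poly_Mapping.single m (Poly_Mapping.lookup p m) \<in> stanley_reisner_ideal V \<Delta>"
        using ideal_mult[OF I single_C x] by simp
    qed
    then show "p \<in> stanley_reisner_ideal V \<Delta>" by (simp add: sum_monomials)
  qed
qed

section \<open>Regular sequences and associated primes of the quotient module\<close>

lemma quotient_module_ops:
  assumes I: "ideal_in I"
  shows "carrier (quotient_module R I) = coset I ` polys"
    and "\<zero>\<^bsub>quotient_module R I\<^esub> = coset I 0"
    and "x \<in> polys \<Longrightarrow> y \<in> polys \<Longrightarrow>
      coset I x \<oplus>\<^bsub>quotient_module R I\<^esub> coset I y = coset I (x + y)"
    and "x \<in> polys \<Longrightarrow> y \<in> polys \<Longrightarrow> x \<odot>\<^bsub>quotient_module R I\<^esub> coset I y = coset I (x * y)"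
  using Quot_ops[OF I] Quot_zero_one[OF I] carrier_Quot[of I]
  by (simp_all add: quotient_module_def ring.defs flip: coset_def)

lemma sequence_submodule_eq:
  assumes I: "ideal_in I" and "set as \<subseteq> polys"
  shows "sequence_submodule (quotient_module R I) as = coset I ` foldl adjoin I as"
  using assms(2)
proof (induction as)
  case Nil
  have zero: "coset I x = coset I 0" if "x \<in> I" for x
    using coset_eq_zero_iff[OF I ideal_subset[OF I that]] that by simp
  have "coset I ` I = {coset I 0}"
  proof (intro equalityI subsetI)
    fix X assume "X \<in> coset I ` I"
    then obtain x where "x \<in> I" "X = coset I x" by (rule imageE)
    then show "X \<in> {coset I 0}" using zero by simp
  qed (use ideal_zero[OF I] in simp)
  then show ?case by (simp add: quotient_module_ops(2)[OF I])
next
  case (Cons a as)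
  let ?J = "foldl adjoin I as"
  have J: "ideal_in ?J" using ideal_foldl_adjoin[OF I] Cons.prems by simp
  have eq: "a \<odot>\<^bsub>quotient_module R I\<^esub> coset I r \<oplus>\<^bsub>quotient_module R I\<^esub> coset I y = coset I (y + a * r)"
    if "r \<in> polys" "y \<in> ?J" for r y
    using that Cons.prems ideal_subset[OF J that(2)] mult_C
    by (simp add: quotient_module_ops[OF I] add.commute)
  have IH: "sequence_submodule (quotient_module R I) as = coset I ` ?J"
    using Cons.IH Cons.prems by simp
  have "X \<in> sequence_submodule (quotient_module R I) (a # as) \<longleftrightarrow> X \<in> coset I ` adjoin ?J a" for X
  proof
    assume "X \<in> sequence_submodule (quotient_module R I) (a # as)"
    then obtain r y where ry: "r \<in> polys" "y \<in> ?J"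
      "X = a \<odot>\<^bsub>quotient_module R I\<^esub> coset I r \<oplus>\<^bsub>quotient_module R I\<^esub> coset I y"
      unfolding sequence_submodule.simps IH quotient_module_ops(1)[OF I] by blast
    then have "X = coset I (y + a * r)" by (simp only: eq)
    then show "X \<in> coset I ` adjoin ?J a" using adjoinI[OF ry(2,1)] by blast
  next
    assume "X \<in> coset I ` adjoin ?J a"
    then obtain r y where ry: "r \<in> polys" "y \<in> ?J" "X = coset I (y + a * r)"
      by (auto elim: adjoinE)
    then have "X = a \<odot>\<^bsub>quotient_module R I\<^esub> coset I r \<oplus>\<^bsub>quotient_module R I\<^esub> coset I y"
      by (simp only: eq)
    then show "X \<in> sequence_submodule (quotient_module R I) (a # as)"
      unfolding sequence_submodule.simps IH quotient_module_ops(1)[OF I] using ry(1,2) by blast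
  qed
  then show ?case by (auto simp: foldl_adjoin_commute)
qed

text \<open>The submodules in the definition are images of ideals that contain \<open>I\<close>, so
  membership of a coset is membership of any representative.\<close>

lemma regular_sequence_iff:
  assumes I: "ideal_in I" and as: "set as \<subseteq> polys"
  shows "regular_sequence (quotient_module R I) as \<longleftrightarrow>
    regular_mod I as \<and> foldl adjoin I as \<noteq> polys"
proof -
  let ?N = "quotient_module R I"
  have mem: "coset I x \<in> sequence_submodule ?N (take i as) \<longleftrightarrow> x \<in> foldl adjoin I (take i as)"
    if "x \<in> polys" for i x
  proof -
    have sub: "set (take i as) \<subseteq> polys" by (rule order_trans[OF set_take_subset as])
    show ?thesis
      using coset_image_mem[OF I ideal_foldl_adjoin[OF I sub] subset_foldl_adjoin that]
      by (simp add: sequence_submodule_eq[OF I sub])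
  qed
  have "(\<forall>x\<in>carrier ?N. (as ! i) \<odot>\<^bsub>?N\<^esub> x \<in> sequence_submodule ?N (take i as) \<longrightarrow>
        x \<in> sequence_submodule ?N (take i as)) \<longleftrightarrow>
      nonzerodivisor_mod (foldl adjoin I (take i as)) (as ! i)" if "i < length as" for i
  proof -
    have ai: "as ! i \<in> polys" by (rule subsetD[OF as nth_mem[OF that]])
    have "(as ! i \<odot>\<^bsub>?N\<^esub> coset I x \<in> sequence_submodule ?N (take i as) \<longrightarrow>
        coset I x \<in> sequence_submodule ?N (take i as)) \<longleftrightarrow>
      (as ! i * x \<in> foldl adjoin I (take i as) \<longrightarrow> x \<in> foldl adjoin I (take i as))"
      if "x \<in> polys" for x
      unfolding quotient_module_ops(4)[OF I ai that] mem[OF that] mem[OF mult_C[OF ai that]] ..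
    then show ?thesis
      by (simp add: nonzerodivisor_mod_def quotient_module_ops(1)[OF I])
  qed
  moreover have "sequence_submodule ?N as = carrier ?N \<longleftrightarrow> foldl adjoin I as = polys"
  proof
    assume *: "sequence_submodule ?N as = carrier ?N"
    have "x \<in> foldl adjoin I as" if "x \<in> polys" for x
      using mem[OF that, of "length as"] * that by (simp add: quotient_module_ops(1)[OF I])
    then show "foldl adjoin I as = polys"
      using ideal_subset[OF ideal_foldl_adjoin[OF I as]] by blast
  qed (simp add: sequence_submodule_eq[OF I as] quotient_module_ops(1)[OF I])
  ultimately show ?thesis
    by (simp add: regular_sequence_def regular_mod_iff_nth)
qed

lemma prime_mult:
  "prime_in P \<Longrightarrow> a \<in> polys \<Longrightarrow> b \<in> polys \<Longrightarrow> a * b \<in> P \<Longrightarrow> a \<in> P \<or> b \<in> P"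
  by (simp add: prime_in_def)

lemma prime_prod:
  assumes P: "prime_in P" and "finite A" "\<And>a. a \<in> A \<Longrightarrow> f a \<in> polys" "prod f A \<in> P"
  shows "\<exists>a\<in>A. f a \<in> P"
  using assms(2-4)
proof (induction A rule: finite_induct)
  case empty
  then show ?case using P by (simp add: prime_in_def)
next
  case (insert a A)
  have "prod f A \<in> polys" using insert.prems by (intro prod_C) simp
  then have "f a \<in> P \<or> prod f A \<in> P"
    using P insert by (auto simp: prime_in_def)
  then show ?case using insert by blast
qed

text \<open>The annihilator of \<open>g\<close> is the intersection of the primes of those facets on
  which \<open>g\<close> does not vanish; if it is prime, it contains and hence equals one of them.
  Conversely, the product of the variables of a facet has the prime of that facet as its
  annihilator.\<close>

lemma associated_primes_facets:
  assumes \<Delta>: "down_closed \<Delta>" "\<And>F. F \<in> \<Delta> \<Longrightarrow> F \<subseteq> V"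
  shows "associated_primes R (quotient_module R (sr_ideal \<Delta>)) = (\<lambda>F. sr_ideal (Pow F)) ` facets \<Delta>"
proof -
  let ?I = "sr_ideal \<Delta>"
  let ?N = "quotient_module R ?I"
  have I: "ideal_in ?I" by (rule ideal_sr_ideal[OF \<Delta>(1)])
  have ann: "annihilator R ?N (coset ?I g) = {r \<in> polys. r * g \<in> ?I}" if "g \<in> polys" for g
  proof -
    have "r \<odot>\<^bsub>?N\<^esub> coset ?I g = \<zero>\<^bsub>?N\<^esub> \<longleftrightarrow> r * g \<in> ?I" if "r \<in> polys" for r
      unfolding quotient_module_ops(2)[OF I] quotient_module_ops(4)[OF I that \<open>g \<in> polys\<close>]
      by (rule coset_eq_zero_iff[OF I mult_C[OF that \<open>g \<in> polys\<close>]])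
    then show ?thesis unfolding annihilator_def by auto
  qed
  have fin\<Delta>: "finite \<Delta>" using \<Delta>(2) finite_V by (intro finite_subset[of \<Delta> "Pow V"]) auto
  have sub: "?I \<subseteq> sr_ideal (Pow F)" if "F \<in> \<Delta>" for F
    using \<Delta>(1) that by (auto simp: sr_ideal_def down_closed_def)
  have inter: "p \<in> ?I" if pC: "p \<in> polys" and pF: "\<And>F. F \<in> facets \<Delta> \<Longrightarrow> p \<in> sr_ideal (Pow F)" for p
  proof -
    have "Poly_Mapping.keys m \<notin> \<Delta>" if m: "m \<in> Poly_Mapping.keys p" for m
    proof
      assume "Poly_Mapping.keys m \<in> \<Delta>"
      then obtain F where F: "F \<in> \<Delta>" "Poly_Mapping.keys m \<subseteq> F" "\<forall>F'\<in>\<Delta>. F \<le> F' \<longrightarrow> F = F'"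
        using finite_has_maximal2[OF fin\<Delta>] by metis
      then have "F \<in> facets \<Delta>" by (auto simp: facets_def)
      then show False using pF[of F] m F(2) by (auto simp: sr_ideal_def)
    qed
    then show ?thesis using pC by (simp add: sr_ideal_def)
  qed
  show ?thesis
  proof (intro equalityI subsetI)
    fix P assume "P \<in> associated_primes R ?N"
    then obtain g where P: "prime_in P" "g \<in> polys" "P = {r \<in> polys. r * g \<in> ?I}"
      using ann by (auto simp: associated_primes_def prime_iff quotient_module_ops(1)[OF I])
    define A where "A = {F \<in> facets \<Delta>. g \<notin> sr_ideal (Pow F)}"
    have finA: "finite A" using fin\<Delta> by (simp add: A_def facets_def)
    have "\<exists>F\<in>A. sr_ideal (Pow F) \<subseteq> P"
    proof (rule ccontr)
      assume "\<not> ?thesis"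
      then have "\<forall>F\<in>A. \<exists>r. r \<in> sr_ideal (Pow F) \<and> r \<notin> P" by blast
      \<comment> \<open>The product of elements chosen from the primes of all facets in
        \<open>A\<close> kills \<open>g\<close>, so it lies in \<open>P\<close>; then one of the
        factors does as well.\<close>
      then obtain f where f: "\<And>F. F \<in> A \<Longrightarrow> f F \<in> sr_ideal (Pow F) \<and> f F \<notin> P" by metis
      then have fC: "f F \<in> polys" if "F \<in> A" for F using that by (auto simp: sr_ideal_def)
      have rC: "prod f A \<in> polys" using fC by (rule prod_C)
      have "prod f A * g \<in> sr_ideal (Pow F)" if F: "F \<in> facets \<Delta>" for F
      proof -
        have PF: "ideal_in (sr_ideal (Pow F))" by (rule ideal_sr_ideal[OF down_closed_Pow])
        show ?thesis
        proof (cases "F \<in> A")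
          case True
          have "prod f A = f F * prod f (A - {F})" by (rule prod.remove[OF finA True])
          moreover have "prod f (A - {F}) \<in> polys" by (rule prod_C) (simp add: fC)
          ultimately have "prod f A \<in> sr_ideal (Pow F)"
            using ideal_mult_right[OF PF] f[OF True] by simp
          then show ?thesis by (rule ideal_mult_right[OF PF P(2)])
        next
          case False
          then have "g \<in> sr_ideal (Pow F)" using F by (simp add: A_def)
          then show ?thesis by (rule ideal_mult[OF PF rC])
        qed
      qed
      then have "prod f A * g \<in> ?I" by (rule inter[OF mult_C[OF rC P(2)]])
      then have "prod f A \<in> P" using rC by (simp add: P(3))
      have "\<exists>F\<in>A. f F \<in> P" by (rule prime_prod[OF P(1) finA fC \<open>prod f A \<in> P\<close>])
      then show False using f by blast
    qed
    then obtain F where F: "F \<in> facets \<Delta>" "g \<notin> sr_ideal (Pow F)" "sr_ideal (Pow F) \<subseteq> P"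
      by (auto simp: A_def)
    have "P \<subseteq> sr_ideal (Pow F)"
    proof
      fix r assume "r \<in> P"
      then have "r \<in> polys" "r * g \<in> sr_ideal (Pow F)"
        using P(3) sub[of F] F(1) unfolding facets_def by blast+
      then show "r \<in> sr_ideal (Pow F)"
        using prime_mult[OF prime_sr_ideal_Pow _ P(2)] F(2) by blast
    qed
    then show "P \<in> (\<lambda>F. sr_ideal (Pow F)) ` facets \<Delta>" using F by blast
  next
    fix P assume "P \<in> (\<lambda>F. sr_ideal (Pow F)) ` facets \<Delta>"
    then obtain F where F: "F \<in> facets \<Delta>" "P = sr_ideal (Pow F)" by blast
    have FV: "F \<subseteq> V" "F \<in> \<Delta>" using F(1) \<Delta>(2) by (auto simp: facets_def)
    have finF: "finite F" using FV(1) finite_V finite_subset by blast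
    define g :: "('v, 'k) mpoly" where "g = (\<Prod>v\<in>F. var v)"
    have gC: "g \<in> polys" unfolding g_def by (rule prod_var_C[OF FV(1)])
    have gkeys: "Poly_Mapping.keys m = F" if "m \<in> Poly_Mapping.keys g" for m
      using that keys_square_free[OF finF] unfolding g_def prod_var[OF finF] by (simp split: if_splits)
    have gF: "g \<notin> sr_ideal (Pow F)"
    proof -
      have "g \<noteq> 0" unfolding g_def prod_var[OF finF] by (metis lookup_single_eq lookup_zero zero_neq_one)
      then obtain m where "m \<in> Poly_Mapping.keys g" by (metis all_not_in_conv keys_eq_empty)
      then show ?thesis using gkeys by (auto simp: sr_ideal_def)
    qed
    have "P = {r \<in> polys. r * g \<in> ?I}"
    proof (intro equalityI subsetI)
      fix r assume r: "r \<in> P"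
      have "Poly_Mapping.keys m \<notin> \<Delta>" if "m \<in> Poly_Mapping.keys (r * g)" for m
      proof
        assume m: "Poly_Mapping.keys m \<in> \<Delta>"
        obtain a b where ab: "a \<in> Poly_Mapping.keys r" "b \<in> Poly_Mapping.keys g" "m = a + b"
          using \<open>m \<in> Poly_Mapping.keys (r * g)\<close> by (rule keys_mult_mpoly)
        \<comment> \<open>By maximality of the facet, a face that contains \<open>F\<close> is
          \<open>F\<close>, so \<open>a\<close> uses variables of \<open>F\<close> only.\<close>
        have "F \<subseteq> Poly_Mapping.keys m" using gkeys[OF ab(2)] ab(3) by (simp add: keys_plus_nat)
        then have "Poly_Mapping.keys m = F" using F(1) m by (simp add: facets_def)
        then have "Poly_Mapping.keys a \<subseteq> F" using ab(3) by (auto simp: keys_plus_nat)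
        then show False using r F(2) ab(1) by (auto simp: sr_ideal_def)
      qed
      moreover have "r \<in> polys" using r F(2) by (simp add: sr_ideal_def)
      ultimately show "r \<in> {r \<in> polys. r * g \<in> ?I}" using mult_C gC by (simp add: sr_ideal_def)
    next
      fix r assume "r \<in> {r \<in> polys. r * g \<in> ?I}"
      then have "r \<in> polys" "r * g \<in> sr_ideal (Pow F)" using sub[OF FV(2)] by auto
      then show "r \<in> P"
        using prime_mult[OF prime_sr_ideal_Pow _ gC] gF unfolding F(2) by blast
    qed
    then show "P \<in> associated_primes R ?N"
      using ann[OF gC] gC prime_sr_ideal_Pow[of F] F(2)
      by (auto simp: associated_primes_def prime_iff quotient_module_ops(1)[OF I])
  qed
qed

end

context poly_graph
begin

section \<open>Depth and initial dimension of the clique complex\<close>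

lemma module_indim_clique_complex:
  "module_indim R (quotient_module R (sr_ideal (clique_complex V))) = enat (min_facet_card V)"
proof -
  let ?F = "facets (clique_complex V)"
  have ass: "associated_primes R (quotient_module R (sr_ideal (clique_complex V))) =
      (\<lambda>F. sr_ideal (Pow F)) ` ?F"
    by (rule associated_primes_facets[OF down_closed_clique_complex]) (simp add: clique_complex_def)
  have dim: "krull_dim (R Quot sr_ideal (Pow F)) = enat (card F)" if "F \<in> ?F" for F
    using that by (intro krull_dim_face) (simp add: facets_def clique_complex_def)
  show ?thesis
    unfolding module_indim_def ass
  proof (rule antisym)
    obtain M where M: "M \<in> ?F" "card M = min_facet_card V"
      using min_facet_card_attained[OF finite_V] .
    show "Inf ((\<lambda>P. krull_dim (R Quot P)) ` (\<lambda>F. sr_ideal (Pow F)) ` ?F) \<le> enat (min_facet_card V)"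
      using M dim[OF M(1)] by (intro Inf_lower) force
    show "enat (min_facet_card V) \<le> Inf ((\<lambda>P. krull_dim (R Quot P)) ` (\<lambda>F. sr_ideal (Pow F)) ` ?F)"
      by (rule Inf_greatest) (auto simp: dim min_facet_card_le[OF finite_V])
  qed
qed

definition depth_attained :: "nat \<Rightarrow> bool" where
  "depth_attained k \<longleftrightarrow>
     (\<exists>as. length as = k \<and> set as \<subseteq> irrelevant \<and> regular_mod (sr_ideal (clique_complex V)) as)"

lemma module_depth_clique_complex:
  "module_depth (irrelevant_ideal V) (quotient_module R (sr_ideal (clique_complex V))) =
    Sup {enat k | k. depth_attained k}"
proof -
  let ?I = "sr_ideal (clique_complex V)"
  have I: "ideal_in ?I" by (rule ideal_clique_complex)
  have "{} \<in> clique_complex V" by (simp add: clique_complex_def clique_def)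
  then have Ii: "?I \<subseteq> irrelevant" by (force simp: sr_ideal_def irrelevant_def in_keys_iff)
  have "regular_sequence (quotient_module R ?I) as \<longleftrightarrow> regular_mod ?I as" if as: "set as \<subseteq> irrelevant" for as
  proof -
    have C: "set as \<subseteq> polys" using as by (auto simp: irrelevant_def)
    \<comment> \<open>Everything adjoined stays in the irrelevant ideal, so 1 is never reached and
      the properness condition of \<open>regular_sequence\<close> holds.\<close>
    have "foldl adjoin J as \<subseteq> irrelevant" if "J \<subseteq> irrelevant" for J
      using as that
    proof (induction as arbitrary: J)
      case (Cons a as)
      have "adjoin J a \<subseteq> irrelevant"
      proof
        fix p assume "p \<in> adjoin J a"
        then obtain x r where p: "p = x + a * r" "x \<in> J" "r \<in> polys" by (rule adjoinE)
        have "a * r \<in> irrelevant"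
          by (rule ideal_mult_right[OF ideal_irrelevant p(3)]) (use Cons.prems in simp)
        moreover have "x \<in> irrelevant" using Cons.prems p(2) by blast
        ultimately show "p \<in> irrelevant" unfolding p(1) by (intro ideal_add[OF ideal_irrelevant])
      qed
      then show ?case using Cons by simp
    qed simp
    then have "foldl adjoin ?I as \<subseteq> irrelevant" using Ii by simp
    moreover have "1 \<notin> irrelevant" by (simp add: irrelevant_def)
    ultimately have "foldl adjoin ?I as \<noteq> polys" using one_C by blast
    then show ?thesis using regular_sequence_iff[OF I C] by simp
  qed
  then have "{enat (length as) | as. set as \<subseteq> irrelevant \<and> regular_sequence (quotient_module R ?I) as} =
      {enat k | k. depth_attained k}"
    by (auto simp: depth_attained_def)
  then show ?thesis by (simp add: module_depth_def irrelevant_ideal_eq)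
qed

text \<open>Applied to a smallest facet, \<open>facet_separation\<close> bounds every attained depth
  by \<open>min_facet_card V\<close>, through a separator or through \<open>card V\<close>. Under
  connectivity the symmetric polynomials attain this value; conversely, a separator that is too
  small would force the depth below it.\<close>

lemma depth_eq_indim_iff:
  assumes dec: "decomposable V"
  shows "Sup {enat k | k. depth_attained k} = enat (min_facet_card V) \<longleftrightarrow>
    connectivity_ge (min_facet_card V) V"
proof -
  let ?d = "min_facet_card V"
  obtain M where M: "M \<in> facets (clique_complex V)" "card M = ?d"
    using min_facet_card_attained[OF finite_V] .
  have le_sep: "k \<le> Suc (card S)" if k: "depth_attained k" and sep: "separation V S A B" for k S A B
  proof -
    obtain as where as: "length as = k" "set as \<subseteq> irrelevant" "regular_mod (sr_ideal (clique_complex V)) as"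
      using k unfolding depth_attained_def by blast
    then show ?thesis using regular_length_le_separation[OF sep as(3,2)] by simp
  qed
  have le_card: "k \<le> card V" if k: "depth_attained k" for k
  proof -
    obtain as where as: "length as = k" "set as \<subseteq> irrelevant" "regular_mod (sr_ideal (clique_complex V)) as"
      using k unfolding depth_attained_def by blast
    have "{} \<in> clique_complex V" by (simp add: clique_complex_def clique_def)
    then show ?thesis
      using regular_length_le_card[OF down_closed_clique_complex _ as(3,2)] as(1) by simp
  qed
  show ?thesis
  proof
    assume con: "connectivity_ge ?d V"
    have "depth_attained ?d"
      unfolding depth_attained_def
      using regular_mod_esyms[OF dec subset_refl con] esyms_irrelevant
      by (intro exI[of _ "esyms ?d"]) simp
    moreover have "k \<le> ?d" if k: "depth_attained k" for k
    proof -
      from facet_separation[OF dec finite_V M(1)] show ?thesis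
      proof
        assume "M = V"
        then show ?thesis using le_card[OF k] M(2) by simp
      next
        assume "\<exists>S A B. separation V S A B \<and> card S < card M"
        then obtain S A B where "separation V S A B" "card S < card M" by blast
        then show ?thesis using le_sep[OF k] M(2) by fastforce
      qed
    qed
    ultimately show "Sup {enat k | k. depth_attained k} = enat ?d"
      by (intro antisym Sup_least Sup_upper) auto
  next
    assume eq: "Sup {enat k | k. depth_attained k} = enat ?d"
    have dV: "?d \<le> card V"
      using M card_mono[OF finite_V, of M] by (simp add: facets_def clique_complex_def)
    show "connectivity_ge ?d V"
      unfolding connectivity_ge_def
    proof (intro conjI dV allI impI)
      fix S A B assume sep: "separation V S A B"
      have "Sup {enat k | k. depth_attained k} \<le> enat (Suc (card S))"
        using le_sep[OF _ sep] by (intro Sup_least) auto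
      then show "?d \<le> Suc (card S)" by (simp add: eq)
    qed
  qed
qed

lemma initially_cohen_macaulay_iff:
  assumes "decomposable V"
  shows "initially_cohen_macaulay K V (clique_complex V) \<longleftrightarrow> weakly_connected (clique_complex V)"
  unfolding initially_cohen_macaulay_def stanley_reisner_ring_def
    stanley_reisner_ideal_eq[OF down_closed_clique_complex]
    module_depth_clique_complex module_indim_clique_complex depth_eq_indim_iff[OF assms]
    weakly_connected_iff_connectivity[OF finite_V assms] ..

end

theorem theorem1p10:
  fixes G :: "'v pair_pre_digraph"
  assumes "pair_graph G" and "co_chordal G"
  shows "initially_cohen_macaulay TYPE('k::field) (pverts G) (independence_complex G) \<longleftrightarrow>
         weakly_connected (independence_complex G)"
proof -
  interpret pair_graph G by (rule assms(1))
  \<comment> \<open>\<open>E\<close> also relates elements outside \<open>pverts G\<close>; on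
    \<open>pverts G\<close> it is adjacency in the complement.\<close>
  define E where "E u v \<longleftrightarrow> u \<noteq> v \<and> (u, v) \<notin> parcs G" for u v
  have parcs_sym: "(v, u) \<in> parcs G" if "(u, v) \<in> parcs G" for u v
    using that sym_arcs by (auto simp: symmetric_def elim: symE)
  interpret poly_graph "pverts G" "TYPE('k)" E
  proof
    show "E v u" if "E u v" for u v using that parcs_sym by (auto simp: E_def)
  qed (auto simp: E_def)
  have "(u, u) \<notin> parcs G" for u using no_loops[of "(u, u)"] by auto
  then have "(\<forall>u\<in>W. \<forall>v\<in>W. (u, v) \<notin> parcs G) \<longleftrightarrow> clique W" for W
    unfolding clique_def E_def by metis
  then have "independence_complex G = clique_complex (pverts G)"
    by (simp add: independence_complex_def clique_complex_def)
  moreover have "chordal_on (pverts G)"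
    unfolding chordal_on_def
  proof (intro allI impI notI)
    fix k :: nat assume k: "4 \<le> k"
    assume "\<exists>c. inj_on c {..<k} \<and> c ` {..<k} \<subseteq> pverts G \<and>
      (\<forall>i<k. \<forall>j<k. E (c i) (c j) \<longleftrightarrow> j = Suc i mod k \<or> i = Suc j mod k)"
    then obtain c where c: "inj_on c {..<k}" "c ` {..<k} \<subseteq> pverts G"
      "\<forall>i<k. \<forall>j<k. E (c i) (c j) \<longleftrightarrow> j = Suc i mod k \<or> i = Suc j mod k" by blast
    have "(c i, c j) \<in> parcs (complement_graph G) \<longleftrightarrow> E (c i) (c j)" if "i < k" "j < k" for i j
      using c(2) that by (auto simp: complement_graph_def E_def)
    then have "has_induced_cycle (complement_graph G) k"
      unfolding has_induced_cycle_def using c by (intro exI[of _ c]) (simp add: complement_graph_def)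
    then show False using assms(2) k by (simp add: co_chordal_def chordal_def)
  qed
  ultimately show ?thesis
    using initially_cohen_macaulay_iff chordal_decomposable[OF finite_V] by simp
qed

end
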